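(* In undirected graphs, there is a polynomial-time $O(\log k)$-approximation algorithm for Cap-SNDP with multiple copies, where $k$ is the number of vertex pairs $\{i,j\}$ with $R_{ij}>0$.
   Context: Cap-SNDP with multiple copies: the input is an undirected multigraph $G=(V,E)$, each edge $e$ having a cost $c(e)\ge 0$ and an integer capacity $u(e)>0$, together with an integer requirement $R_{ij}\ge 0$ for each unordered pair of vertices. A solution assigns to every edge $e$ a nonnegative integer multiplicity $\alpha_e$ (buying $\alpha_e$ copies of $e$), at cost $\sum_e \alpha_e c(e)$, giving edge $e$ capacity $\alpha_e u(e)$. It is feasible if for every pair $\{i,j\}$ the minimum $i$-$j$ cut with respect to capacities $\alpha_e u(e)$ is at least $R_{ij}$. The goal is to minimize cost. *)

theory Defs
  imports
    Complex_Main
    "HOL-Library.Landau_Symbols"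
    "HOL-Library.Log_Nat"
    "HOL-Computational_Algebra.Polynomial"
begin

section \<open>Capacitated survivable network design with multiple copies\<close>

text \<open>
  The vertices are \<open>0, ..., num_verts - 1\<close>. The edges form a list, so that parallel edges are
  distinct positions of that list; loops are allowed. The endpoints of an edge carry no
  orientation (see \<open>crosses\<close>). Costs are rational so that an instance has a finite encoding.
\<close>

record edge =
  end1 :: nat
  end2 :: nat
  edge_cost :: rat
  edge_cap :: nat

record cap_sndp =
  num_verts :: nat
  edges :: "edge list"
  req :: "nat set \<Rightarrow> nat"

definition verts :: "cap_sndp \<Rightarrow> nat set" where
  "verts I = {..<num_verts I}"

definition vertex_pairs :: "cap_sndp \<Rightarrow> nat set set" where
  "vertex_pairs I = {{i, j} | i j. i \<in> verts I \<and> j \<in> verts I \<and> i \<noteq> j}"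

definition valid_instance :: "cap_sndp \<Rightarrow> bool" where
  "valid_instance I \<longleftrightarrow>
     (\<forall>e \<in> set (edges I). end1 e \<in> verts I \<and> end2 e \<in> verts I \<and>
        edge_cost e \<ge> 0 \<and> edge_cap e > 0)"

definition num_demands :: "cap_sndp \<Rightarrow> nat" where
  "num_demands I = card {P \<in> vertex_pairs I. req I P > 0}"

definition crosses :: "edge \<Rightarrow> nat set \<Rightarrow> bool" where
  "crosses e S \<longleftrightarrow> (end1 e \<in> S) \<noteq> (end2 e \<in> S)"

text \<open>A solution is the list of multiplicities, parallel to the list of edges.\<close>

definition cut_capacity :: "cap_sndp \<Rightarrow> nat list \<Rightarrow> nat set \<Rightarrow> nat" where
  "cut_capacity I \<alpha> S =
     (\<Sum>e | e < length (edges I) \<and> crosses (edges I ! e) S. \<alpha> ! e * edge_cap (edges I ! e))"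

definition min_cut :: "cap_sndp \<Rightarrow> nat list \<Rightarrow> nat \<Rightarrow> nat \<Rightarrow> nat" where
  "min_cut I \<alpha> i j = Min (cut_capacity I \<alpha> ` {S. S \<subseteq> verts I \<and> i \<in> S \<and> j \<notin> S})"

definition feasible :: "cap_sndp \<Rightarrow> nat list \<Rightarrow> bool" where
  "feasible I \<alpha> \<longleftrightarrow> length \<alpha> = length (edges I) \<and>
     (\<forall>i \<in> verts I. \<forall>j \<in> verts I. i \<noteq> j \<longrightarrow> min_cut I \<alpha> i j \<ge> req I {i, j})"

definition solution_cost :: "cap_sndp \<Rightarrow> nat list \<Rightarrow> real" where
  "solution_cost I \<alpha> =
     (\<Sum>e < length (edges I). real (\<alpha> ! e) * of_rat (edge_cost (edges I ! e)))"

definition opt_cost :: "cap_sndp \<Rightarrow> real" where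
  "opt_cost I = (INF \<alpha> \<in> {\<alpha>. feasible I \<alpha>}. solution_cost I \<alpha>)"


section \<open>A random access machine with logarithmic cost\<close>

text \<open>
  Programs are structured while programs over finitely many arrays of natural numbers with
  computed indices (array \<open>a\<close> is named by a literal in the program; a scalar variable is a fixed
  cell of an array). Every access or arithmetic operation is charged the bit lengths of all
  indices and values involved, as in the logarithmic-cost RAM, so that running times are
  polynomially related to those of Turing machines.
\<close>

type_synonym store = "nat \<Rightarrow> nat \<Rightarrow> nat"

datatype exp =
    Num nat
  | Get nat exp
  | Plus exp exp
  | Minus exp exp
  | Times exp exp
  | Div exp exp

datatype com =
    Skip
  | Assign nat exp exp
  | Seq com com
  | Cond exp com com
  | While exp com

text \<open>The number of binary digits; zero is charged one digit.\<close>

definition nbits :: "nat \<Rightarrow> nat" where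
  "nbits n = max 1 (floorlog 2 n)"

text \<open>\<open>Minus\<close> is truncated at zero, and division by zero yields zero.\<close>

fun eval_exp :: "exp \<Rightarrow> store \<Rightarrow> nat" where
  "eval_exp (Num n) s = n"
| "eval_exp (Get a e) s = s a (eval_exp e s)"
| "eval_exp (Plus e1 e2) s = eval_exp e1 s + eval_exp e2 s"
| "eval_exp (Minus e1 e2) s = eval_exp e1 s - eval_exp e2 s"
| "eval_exp (Times e1 e2) s = eval_exp e1 s * eval_exp e2 s"
| "eval_exp (Div e1 e2) s = eval_exp e1 s div eval_exp e2 s"

definition operands_cost :: "nat \<Rightarrow> nat \<Rightarrow> nat" where
  "operands_cost x y = nbits x + nbits y"

fun exp_time :: "exp \<Rightarrow> store \<Rightarrow> nat" where
  "exp_time (Num n) s = nbits n"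
| "exp_time (Get a e) s =
     exp_time e s + operands_cost (eval_exp e s) (s a (eval_exp e s))"
| "exp_time (Plus e1 e2) s =
     exp_time e1 s + exp_time e2 s + operands_cost (eval_exp e1 s) (eval_exp e2 s)"
| "exp_time (Minus e1 e2) s =
     exp_time e1 s + exp_time e2 s + operands_cost (eval_exp e1 s) (eval_exp e2 s)"
| "exp_time (Times e1 e2) s =
     exp_time e1 s + exp_time e2 s + operands_cost (eval_exp e1 s) (eval_exp e2 s)"
| "exp_time (Div e1 e2) s =
     exp_time e1 s + exp_time e2 s + operands_cost (eval_exp e1 s) (eval_exp e2 s)"

text \<open>
  \<open>exec c s t s'\<close>: started in \<open>s\<close>, the program \<open>c\<close> halts in \<open>s'\<close> after time \<open>t\<close>.
  \<open>Assign a e1 e2\<close> stores the value of \<open>e2\<close> in cell \<open>e1\<close> of array \<open>a\<close>; a guard holds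
  iff its value is nonzero.
\<close>

inductive exec :: "com \<Rightarrow> store \<Rightarrow> nat \<Rightarrow> store \<Rightarrow> bool" where
  exec_Skip: "exec Skip s 1 s"
| exec_Assign:
    "exec (Assign a e1 e2) s
       (exp_time e1 s + exp_time e2 s + operands_cost (eval_exp e1 s) (eval_exp e2 s))
       (s(a := (s a)(eval_exp e1 s := eval_exp e2 s)))"
| exec_Seq:
    "\<lbrakk>exec c1 s t1 s1; exec c2 s1 t2 s2\<rbrakk> \<Longrightarrow> exec (Seq c1 c2) s (t1 + t2) s2"
| exec_CondT:
    "\<lbrakk>eval_exp e s \<noteq> 0; exec c1 s t s1\<rbrakk>
       \<Longrightarrow> exec (Cond e c1 c2) s (exp_time e s + nbits (eval_exp e s) + t) s1"
| exec_CondF: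
    "\<lbrakk>eval_exp e s = 0; exec c2 s t s1\<rbrakk>
       \<Longrightarrow> exec (Cond e c1 c2) s (exp_time e s + nbits (eval_exp e s) + t) s1"
| exec_WhileF:
    "eval_exp e s = 0 \<Longrightarrow> exec (While e c) s (exp_time e s + nbits (eval_exp e s)) s"
| exec_WhileT:
    "\<lbrakk>eval_exp e s \<noteq> 0; exec c s t1 s1; exec (While e c) s1 t2 s2\<rbrakk>
       \<Longrightarrow> exec (While e c) s (exp_time e s + nbits (eval_exp e s) + t1 + t2) s2"

inductive_cases exec_SkipE: "exec Skip s t s'"
inductive_cases exec_AssignE: "exec (Assign a e1 e2) s t s'"
inductive_cases exec_SeqE: "exec (Seq c1 c2) s t s'"
inductive_cases exec_CondE: "exec (Cond e c1 c2) s t s'"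
inductive_cases exec_WhileE: "exec (While e c) s t s'"

lemma exec_deterministic:
  "exec c s t s1 \<Longrightarrow> exec c s t' s1' \<Longrightarrow> t' = t \<and> s1' = s1"
proof (induction arbitrary: t' s1' rule: exec.induct)
  case (exec_Skip s)
  then show ?case by (elim exec_SkipE) simp
next
  case (exec_Assign a e1 e2 s)
  then show ?case by (elim exec_AssignE) simp
next
  case (exec_Seq c1 s t1 s1 c2 t2 s2)
  from exec_Seq.prems obtain u1 r u2
    where "exec c1 s u1 r" and r: "exec c2 r u2 s1'" and t': "t' = u1 + u2"
    by (rule exec_SeqE)
  then have *: "u1 = t1" "r = s1" using exec_Seq.IH(1) by blast+
  have "u2 = t2 \<and> s1' = s2" by (rule exec_Seq.IH(2)) (use r * in simp)
  with * t' show ?case by simp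
next
  case (exec_CondT e s c1 t s1 c2)
  from exec_CondT.prems obtain u
    where "exec c1 s u s1'" and t': "t' = exp_time e s + nbits (eval_exp e s) + u"
    by (rule exec_CondE) (use exec_CondT.hyps(1) in simp_all)
  then have "u = t \<and> s1' = s1" using exec_CondT.IH by blast
  with t' show ?case by simp
next
  case (exec_CondF e s c2 t s1 c1)
  from exec_CondF.prems obtain u
    where "exec c2 s u s1'" and t': "t' = exp_time e s + nbits (eval_exp e s) + u"
    by (rule exec_CondE) (use exec_CondF.hyps(1) in simp_all)
  then have "u = t \<and> s1' = s1" using exec_CondF.IH by blast
  with t' show ?case by simp
next
  case (exec_WhileF e s c)
  from exec_WhileF.prems show ?case
    by (rule exec_WhileE) (use exec_WhileF.hyps(1) in simp_all)
next
  case (exec_WhileT e s c t1 s1 t2 s2)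
  from exec_WhileT.prems obtain u1 r u2
    where "exec c s u1 r" and r: "exec (While e c) r u2 s1'"
      and t': "t' = exp_time e s + nbits (eval_exp e s) + u1 + u2"
    by (rule exec_WhileE) (use exec_WhileT.hyps(1) in simp_all)
  then have *: "u1 = t1" "r = s1" using exec_WhileT.IH(1) by blast+
  have "u2 = t2 \<and> s1' = s2" by (rule exec_WhileT.IH(2)) (use r * in simp)
  with * t' show ?case by simp
qed

text \<open>
  Array 0 holds the input and array 1 the output, each as a length in cell 0 followed by the
  entries; all other cells are initially zero.
\<close>

definition init_store :: "nat list \<Rightarrow> store" where
  "init_store xs = (\<lambda>a i.
     if a = 0 \<and> i = 0 then length xs
     else if a = 0 \<and> i \<le> length xs then xs ! (i - 1)
     else 0)"

definition output_of :: "store \<Rightarrow> nat list" where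
  "output_of s = map (\<lambda>i. s 1 (Suc i)) [0..<s 1 0]"

definition runs :: "com \<Rightarrow> nat list \<Rightarrow> nat \<Rightarrow> nat list \<Rightarrow> bool" where
  "runs c xs t ys \<longleftrightarrow> (\<exists>s. exec c (init_store xs) t s \<and> ys = output_of s)"

definition input_size :: "nat list \<Rightarrow> nat" where
  "input_size xs = (\<Sum>x\<leftarrow>xs. nbits x)"

definition polynomial_time :: "com \<Rightarrow> nat list set \<Rightarrow> bool" where
  "polynomial_time c X \<longleftrightarrow>
     (\<exists>p :: nat poly. \<forall>xs \<in> X. \<exists>t ys. runs c xs t ys \<and> t \<le> poly p (input_size xs))"


section \<open>Approximation algorithms for the problem\<close>

definition encode_edge :: "edge \<Rightarrow> nat list" where
  "encode_edge e =
     [end1 e, end2 e,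
      nat (fst (quotient_of (edge_cost e))), nat (snd (quotient_of (edge_cost e))),
      edge_cap e]"

definition encode_instance :: "cap_sndp \<Rightarrow> nat list" where
  "encode_instance I =
     [num_verts I, length (edges I)] @ concat (map encode_edge (edges I)) @
     concat (map (\<lambda>j. map (\<lambda>i. req I {i, j}) [0..<j]) [0..<num_verts I])"

text \<open>
  The ratio may depend on the number of pairs with positive requirement. Only instances that
  have a feasible solution are constrained.
\<close>

definition approximation_algorithm :: "com \<Rightarrow> (nat \<Rightarrow> real) \<Rightarrow> bool" where
  "approximation_algorithm c \<rho> \<longleftrightarrow>
     (\<forall>I. valid_instance I \<and> (\<exists>\<beta>. feasible I \<beta>) \<longrightarrow>
        (\<exists>t \<alpha>. runs c (encode_instance I) t \<alpha> \<and> feasible I \<alpha> \<and>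
           solution_cost I \<alpha> \<le> \<rho> (num_demands I) * opt_cost I))"

end

theory Submission
  imports Defs
begin

text \<open>
  The algorithm serves the demands in order of decreasing requirement \<open>r\<close>, buying for each a shortest
  path, where an edge that is already bought has length 0 and any other edge \<open>e\<close> costs
  \<open>\<lceil>r / u e\<rceil>\<close> copies; an edge bought once suffices for all later demands. Since an
  edge of capacity above \<open>r\<close> counts only \<open>r\<close> for the present demand, a ball around an endpoint that
  excludes the other endpoint forces any solution to pay its radius, up to a constant factor. To get
  many disjoint balls at every distance scale we follow Berman and Coulston: a demand at distance
  \<open>d\<close> either has an endpoint that is far from all centres of scale at least \<open>d / 2\<close> and becomes
  a centre, or both endpoints are connected to nearby centres, which merges two components. Hence at
  most \<open>O(OPT / x)\<close> demands are served at distance at least \<open>x\<close>, and the distances add up to at most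
  \<open>O(OPT)\<close> times the \<open>k\<close>-th harmonic number.

  The lengths only decrease in time. Therefore a ball taken in an early metric is contained in the
  ball of the same radius in a later one, and the balls of one scale are disjoint although each of
  them is taken in its own metric.
\<close>

section \<open>Bounded loops and their running time\<close>

text \<open>Rounding up to whole copies is harmless only after truncation:
  \<open>\<lceil>r / u e\<rceil>\<close> copies times the truncated capacity
  \<open>min (u e) r\<close> is at most \<open>2 * r\<close>, so the price of an edge and its
  contribution to a cut stay comparable. A step at distance \<open>d\<close> pays at most
  \<open>2 * d\<close>: \<open>d\<close> for the path itself and less than \<open>d / 2\<close> for
  each of two links to near centres. Long steps are counted through a potential, the number of
  components that contain large centres: a new centre raises it by at most one, a merge lowers it.
  Hence there are at most two long steps per large centre. A separate obstacle is the cost of the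
  machine, which depends on bit lengths: repeated multiplication could make the numbers
  exponentially long. Loops therefore run a number of times fixed in the input, and polynomial time
  follows by induction on the program, independently of what it computes. Rational costs are made
  integral by the product of all denominators.\<close>

datatype fcom =
    FSkip
  | FAssign nat exp exp
  | FSeq fcom fcom
  | FIf exp fcom fcom
  | FFor nat nat fcom

definition upd :: "store \<Rightarrow> nat \<Rightarrow> nat \<Rightarrow> nat \<Rightarrow> store" where
  "upd s a i v = s(a := (s a)(i := v))"

lemma upd_apply: "upd s a i v b j = (if b = a \<and> j = i then v else s b j)"
  by (simp add: upd_def)

lemma upd_other [simp]: "b \<noteq> a \<Longrightarrow> upd s a i v b = s b"
  by (simp add: upd_def)

lemma upd_same [simp]: "upd s a i v a = (s a)(i := v)"
  by (simp add: upd_def)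

primrec compile :: "fcom \<Rightarrow> com" where
  "compile FSkip = Skip"
| "compile (FAssign a e1 e2) = Assign a e1 e2"
| "compile (FSeq c1 c2) = Seq (compile c1) (compile c2)"
| "compile (FIf e c1 c2) = Cond e (compile c1) (compile c2)"
| "compile (FFor v k c) =
     Seq (Assign v (Num 0) (Num 0))
         (While (Minus (Get 0 (Num k)) (Get v (Num 0)))
                (Seq (compile c) (Assign v (Num 0) (Plus (Get v (Num 0)) (Num 1)))))"

primrec fexec :: "fcom \<Rightarrow> store \<Rightarrow> store" where
  "fexec FSkip s = s"
| "fexec (FAssign a e1 e2) s = upd s a (eval_exp e1 s) (eval_exp e2 s)"
| "fexec (FSeq c1 c2) s = fexec c2 (fexec c1 s)"
| "fexec (FIf e c1 c2) s = (if eval_exp e s \<noteq> 0 then fexec c1 s else fexec c2 s)"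
| "fexec (FFor v k c) s =
     ((\<lambda>s. upd (fexec c s) v 0 (Suc (fexec c s v 0))) ^^ s 0 k) (upd s v 0 0)"

primrec writes :: "fcom \<Rightarrow> nat set" where
  "writes FSkip = {}"
| "writes (FAssign a e1 e2) = {a}"
| "writes (FSeq c1 c2) = writes c1 \<union> writes c2"
| "writes (FIf e c1 c2) = writes c1 \<union> writes c2"
| "writes (FFor v k c) = insert v (writes c)"

lemma fexec_frame: "a \<notin> writes c \<Longrightarrow> fexec c s a = s a"
proof (induction c arbitrary: s)
  case (FFor v k c)
  have "((\<lambda>s. upd (fexec c s) v 0 (Suc (fexec c s v 0))) ^^ j) s a = s a" for j s
    by (induction j arbitrary: s) (use FFor in simp_all)
  with FFor.prems show ?case by simp
qed simp_all

text \<open>The invariant is indexed by the number of completed rounds. Since the body does not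
  write the counter, each round starts with the counter equal to its index, and the step may assume
  this.\<close>

lemma fexec_For_invariant:
  assumes "v \<notin> writes c" "0 \<noteq> v"
    and "Inv 0 (upd s v 0 0)"
    and step: "\<And>i s'. i < s 0 k \<Longrightarrow> Inv i s' \<Longrightarrow> s' v 0 = i \<Longrightarrow>
                 Inv (Suc i) (upd (fexec c s') v 0 (Suc i))"
  shows "Inv (s 0 k) (fexec (FFor v k c) s)"
proof -
  let ?f = "\<lambda>s. upd (fexec c s) v 0 (Suc (fexec c s v 0))"
  have "Inv i ((?f ^^ i) (upd s v 0 0)) \<and> (?f ^^ i) (upd s v 0 0) v 0 = i" if "i \<le> s 0 k" for i
    using that
  proof (induction i)
    case 0
    then show ?case using assms by simp
  next
    case (Suc i)
    let ?s = "(?f ^^ i) (upd s v 0 0)"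
    have "Inv i ?s" "?s v 0 = i" using Suc by simp_all
    with step[of i ?s] Suc.prems have "Inv (Suc i) (upd (fexec c ?s) v 0 (Suc i))" by simp
    moreover have "fexec c ?s v 0 = i" using \<open>?s v 0 = i\<close> assms(1) by (simp add: fexec_frame)
    ultimately show ?case by simp
  qed
  then show ?thesis by simp
qed

text \<open>
  A product is \<open>good\<close> if its second factor is computed from the input alone; then one assignment
  lengthens the stored numbers by an amount that depends on the input only.
\<close>

fun small :: "exp \<Rightarrow> bool" where
  "small (Num n) = True"
| "small (Get a e) = (a = 0)"
| "small (Plus e1 e2) = (small e1 \<and> small e2)"
| "small (Minus e1 e2) = small e1"
| "small (Times e1 e2) = (small e1 \<and> small e2)"
| "small (Div e1 e2) = small e1"

fun good :: "exp \<Rightarrow> bool" where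
  "good (Num n) = True"
| "good (Get a e) = good e"
| "good (Plus e1 e2) = (good e1 \<and> good e2)"
| "good (Minus e1 e2) = (good e1 \<and> good e2)"
| "good (Times e1 e2) = (good e1 \<and> good e2 \<and> small e2)"
| "good (Div e1 e2) = (good e1 \<and> good e2)"

text \<open>Array 0 is never assigned, so the input and with it every trip count stays fixed. The
  cells \<open>k = 1\<close> and \<open>k = 2\<close> hold the numbers of vertices and edges, both
  bounded by the input size.\<close>

primrec ok :: "fcom \<Rightarrow> bool" where
  "ok FSkip = True"
| "ok (FAssign a e1 e2) = (a \<noteq> 0 \<and> good e1 \<and> good e2)"
| "ok (FSeq c1 c2) = (ok c1 \<and> ok c2)"
| "ok (FIf e c1 c2) = (good e \<and> ok c1 \<and> ok c2)"
| "ok (FFor v k c) = (v \<noteq> 0 \<and> v \<notin> writes c \<and> ok c \<and> (k = 1 \<or> k = 2))"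

lemma ok_writes: "ok c \<Longrightarrow> 0 \<notin> writes c"
  by (induction c) auto

text \<open>A polynomial in the input size that serves two estimates: for \<open>small\<close>
  expressions it bounds the bit length itself, for \<open>good\<close> ones the excess over a bound
  on all stored numbers. A read is charged the input size, which bounds the bit length of any input
  cell.\<close>

fun bits_growth :: "exp \<Rightarrow> nat poly" where
  "bits_growth (Num n) = [:nbits n:]"
| "bits_growth (Get a e) = [:0, 1:]"
| "bits_growth (Plus e1 e2) = bits_growth e1 + bits_growth e2 + 1"
| "bits_growth (Minus e1 e2) = bits_growth e1"
| "bits_growth (Times e1 e2) = bits_growth e1 + bits_growth e2"
| "bits_growth (Div e1 e2) = bits_growth e1"

fun exp_time_bound :: "exp \<Rightarrow> nat poly \<Rightarrow> nat poly" where
  "exp_time_bound (Num n) b = [:nbits n:]"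
| "exp_time_bound (Get a e) b = exp_time_bound e b + (b + bits_growth e) + b"
| "exp_time_bound (Plus e1 e2) b =
     exp_time_bound e1 b + exp_time_bound e2 b + (b + bits_growth e1) + (b + bits_growth e2)"
| "exp_time_bound (Minus e1 e2) b =
     exp_time_bound e1 b + exp_time_bound e2 b + (b + bits_growth e1) + (b + bits_growth e2)"
| "exp_time_bound (Times e1 e2) b =
     exp_time_bound e1 b + exp_time_bound e2 b + (b + bits_growth e1) + (b + bits_growth e2)"
| "exp_time_bound (Div e1 e2) b =
     exp_time_bound e1 b + exp_time_bound e2 b + (b + bits_growth e1) + (b + bits_growth e2)"

primrec com_growth :: "fcom \<Rightarrow> nat poly" where
  "com_growth FSkip = 0"
| "com_growth (FAssign a e1 e2) = bits_growth e2"
| "com_growth (FSeq c1 c2) = com_growth c1 + com_growth c2"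
| "com_growth (FIf e c1 c2) = com_growth c1 + com_growth c2"
| "com_growth (FFor v k c) = [:0, 1:] * (com_growth c + 1)"

definition assign_time_bound :: "exp \<Rightarrow> exp \<Rightarrow> nat poly \<Rightarrow> nat poly" where
  "assign_time_bound e1 e2 b =
     exp_time_bound e1 b + exp_time_bound e2 b + (b + bits_growth e1) + (b + bits_growth e2)"

definition guard_time_bound :: "exp \<Rightarrow> nat poly \<Rightarrow> nat poly" where
  "guard_time_bound e b = exp_time_bound e b + (b + bits_growth e)"

text \<open>Every round of a loop is charged with \<open>b'\<close>, the bound on bit lengths that
  is valid after all rounds. The separate \<open>g\<close> pays for the guard that fails at the
  end.\<close>

primrec com_time_bound :: "fcom \<Rightarrow> nat poly \<Rightarrow> nat poly" where
  "com_time_bound FSkip b = 1"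
| "com_time_bound (FAssign a e1 e2) b = assign_time_bound e1 e2 b"
| "com_time_bound (FSeq c1 c2) b = com_time_bound c1 b + com_time_bound c2 (b + com_growth c1)"
| "com_time_bound (FIf e c1 c2) b =
     guard_time_bound e b + com_time_bound c1 b + com_time_bound c2 b"
| "com_time_bound (FFor v k c) b =
     (let b' = b + [:0, 1:] * (com_growth c + 1);
          g = guard_time_bound (Minus (Get 0 (Num k)) (Get v (Num 0))) b'
      in assign_time_bound (Num 0) (Num 0) b + g +
         [:0, 1:] * (g + com_time_bound c b' +
                     assign_time_bound (Num 0) (Plus (Get v (Num 0)) (Num 1)) (b' + com_growth c)))"

text \<open>Cells 1 and 2 are bounded by value and not merely by bit length, because they serve as
  trip counts.\<close>

definition input_bounded :: "nat \<Rightarrow> store \<Rightarrow> bool" where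
  "input_bounded N s \<longleftrightarrow> (\<forall>i. nbits (s 0 i) \<le> N) \<and> s 0 1 \<le> N \<and> s 0 2 \<le> N"

definition bits_bounded :: "nat \<Rightarrow> store \<Rightarrow> bool" where
  "bits_bounded b s \<longleftrightarrow> (\<forall>a i. nbits (s a i) \<le> b)"

section \<open>Bit lengths and the time of one command\<close>

lemma nbits_le_iff: "nbits x \<le> b \<longleftrightarrow> 1 \<le> b \<and> x < 2 ^ b"
  by (auto simp: nbits_def floorlog_le_iff)

lemma less_power_nbits: "x < 2 ^ nbits x"
  using nbits_le_iff by blast

lemma nbits_pos: "1 \<le> nbits x"
  by (simp add: nbits_def)

lemma nbits_mono: "x \<le> y \<Longrightarrow> nbits x \<le> nbits y"
  unfolding nbits_le_iff[of x] using less_power_nbits[of y] nbits_pos[of y] by simp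

lemma nbits_add: "nbits x \<le> p \<Longrightarrow> nbits y \<le> p \<Longrightarrow> nbits (x + y) \<le> Suc p"
  by (auto simp: nbits_le_iff)

lemma nbits_mult: "nbits (x * y) \<le> nbits x + nbits y"
  using mult_strict_mono[OF less_power_nbits[of x] less_power_nbits[of y]] nbits_pos[of x]
  by (simp add: nbits_le_iff power_add)

lemma nbits_le_self: "1 \<le> x \<Longrightarrow> nbits x \<le> x"
  by (simp add: nbits_le_iff)

lemma nbits_eval_small:
  assumes "input_bounded N s"
  shows "small e \<Longrightarrow> nbits (eval_exp e s) \<le> poly (bits_growth e) N"
proof (induction e)
  case (Plus e1 e2)
  have "nbits (eval_exp e1 s + eval_exp e2 s)
      \<le> Suc (poly (bits_growth e1) N + poly (bits_growth e2) N)"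
    by (rule nbits_add) (use Plus in auto)
  then show ?case by simp
next
  case (Minus e1 e2)
  then show ?case
    using nbits_mono[of "eval_exp e1 s - eval_exp e2 s" "eval_exp e1 s"] by simp
next
  case (Div e1 e2)
  then show ?case
    using nbits_mono[of "eval_exp e1 s div eval_exp e2 s" "eval_exp e1 s"] by simp
next
  case (Times e1 e2)
  then show ?case using nbits_mult[of "eval_exp e1 s" "eval_exp e2 s"] by simp
qed (use assms in \<open>simp_all add: input_bounded_def\<close>)

lemma nbits_eval:
  assumes "input_bounded N s" and "bits_bounded b s"
  shows "good e \<Longrightarrow> nbits (eval_exp e s) \<le> b + poly (bits_growth e) N"
proof (induction e)
  case (Plus e1 e2)
  have "nbits (eval_exp e1 s + eval_exp e2 s)
      \<le> Suc (b + poly (bits_growth e1) N + poly (bits_growth e2) N)"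
    by (rule nbits_add) (use Plus in auto)
  then show ?case by simp
next
  case (Minus e1 e2)
  then show ?case
    using nbits_mono[of "eval_exp e1 s - eval_exp e2 s" "eval_exp e1 s"] by simp
next
  case (Div e1 e2)
  then show ?case
    using nbits_mono[of "eval_exp e1 s div eval_exp e2 s" "eval_exp e1 s"] by simp
next
  case (Times e1 e2)
  then have "nbits (eval_exp e1 s) \<le> b + poly (bits_growth e1) N" by simp
  \<comment> \<open>The bound on the second factor is independent of \<open>b\<close>. With two
    unrestricted factors the bit length could double in each assignment and become exponential over
    the rounds of a loop.\<close>
  moreover have "nbits (eval_exp e2 s) \<le> poly (bits_growth e2) N"
    by (rule nbits_eval_small[OF assms(1)]) (use Times.prems in simp)
  ultimately show ?case using nbits_mult[of "eval_exp e1 s" "eval_exp e2 s"] by simp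
qed (use assms in \<open>simp_all add: bits_bounded_def trans_le_add1\<close>)

lemma exp_time_le:
  assumes "input_bounded N s" and "bits_bounded (poly b N) s"
  shows "good e \<Longrightarrow> exp_time e s \<le> poly (exp_time_bound e b) N"
proof (induction e)
  case (Get a e)
  then have "nbits (eval_exp e s) \<le> poly b N + poly (bits_growth e) N"
    using nbits_eval[OF assms] by simp
  moreover have "nbits (s a (eval_exp e s)) \<le> poly b N"
    using assms(2) by (simp add: bits_bounded_def)
  ultimately show ?case using Get by (simp add: operands_cost_def)
next
  case (Plus e1 e2)
  then show ?case
    using nbits_eval[OF assms, of e1] nbits_eval[OF assms, of e2] by (simp add: operands_cost_def)
next
  case (Minus e1 e2)
  then show ?case
    using nbits_eval[OF assms, of e1] nbits_eval[OF assms, of e2] by (simp add: operands_cost_def)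
next
  case (Times e1 e2)
  then show ?case
    using nbits_eval[OF assms, of e1] nbits_eval[OF assms, of e2] by (simp add: operands_cost_def)
next
  case (Div e1 e2)
  then show ?case
    using nbits_eval[OF assms, of e1] nbits_eval[OF assms, of e2] by (simp add: operands_cost_def)
qed simp

lemma assign_time_le:
  assumes "input_bounded N s" and "bits_bounded (poly b N) s" and "good e1" "good e2"
  shows "exp_time e1 s + exp_time e2 s + operands_cost (eval_exp e1 s) (eval_exp e2 s)
    \<le> poly (assign_time_bound e1 e2 b) N"
  using add_mono[OF add_mono[OF exp_time_le[OF assms(1,2,3)] exp_time_le[OF assms(1,2,4)]]
    add_mono[OF nbits_eval[OF assms(1,2,3)] nbits_eval[OF assms(1,2,4)]]]
  by (simp add: assign_time_bound_def operands_cost_def add.assoc)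

lemma guard_time_le:
  assumes "input_bounded N s" and "bits_bounded (poly b N) s" and "good e"
  shows "exp_time e s + nbits (eval_exp e s) \<le> poly (guard_time_bound e b) N"
  using exp_time_le[OF assms] nbits_eval[OF assms] by (simp add: guard_time_bound_def)

lemma exp_time_bound_mono:
  "poly b N \<le> poly b' N \<Longrightarrow> poly (exp_time_bound e b) N \<le> poly (exp_time_bound e b') N"
  for N :: nat
  by (induction e) simp_all

lemma assign_time_bound_mono:
  "poly b N \<le> poly b' N \<Longrightarrow> poly (assign_time_bound e1 e2 b) N \<le> poly (assign_time_bound e1 e2 b') N"
  for N :: nat
  using exp_time_bound_mono[of b N b' e1] exp_time_bound_mono[of b N b' e2]
  by (simp add: assign_time_bound_def)

lemma guard_time_bound_mono:
  "poly b N \<le> poly b' N \<Longrightarrow> poly (guard_time_bound e b) N \<le> poly (guard_time_bound e b') N"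
  for N :: nat
  using exp_time_bound_mono[of b N b' e]
  by (simp add: guard_time_bound_def)

lemma com_time_bound_mono:
  "poly b N \<le> poly b' N \<Longrightarrow> poly (com_time_bound c b) N \<le> poly (com_time_bound c b') N"
  for N :: nat
proof (induction c arbitrary: b b')
  case (FFor v k c)
  show ?case
    unfolding com_time_bound.simps Let_def poly_add poly_mult
    by (intro add_mono mult_mono assign_time_bound_mono guard_time_bound_mono FFor)
      (use FFor.prems in simp_all)
qed (simp_all add: assign_time_bound_mono guard_time_bound_mono add_mono)

lemma bits_bounded_upd:
  "bits_bounded b s \<Longrightarrow> nbits v \<le> b \<Longrightarrow> bits_bounded b (upd s a i v)"
  by (simp add: bits_bounded_def upd_apply)

lemma bits_bounded_mono: "bits_bounded b s \<Longrightarrow> b \<le> b' \<Longrightarrow> bits_bounded b' s"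
  unfolding bits_bounded_def using le_trans by blast

text \<open>Simulation and both resource bounds are proved in one induction, since the time of a
  sequence or a loop depends on the bit lengths left behind by earlier commands. The polynomial
  \<open>b\<close> is generalised because later commands start from longer numbers.\<close>

theorem compile_correct:
  assumes "ok c" and "input_bounded N s" and "bits_bounded (poly b N) s"
  shows "\<exists>t. exec (compile c) s t (fexec c s) \<and> t \<le> poly (com_time_bound c b) N \<and>
           bits_bounded (poly (b + com_growth c) N) (fexec c s)"
  using assms
proof (induction c arbitrary: s b)
  case FSkip
  then show ?case using exec_Skip by auto
next
  case (FAssign a e1 e2)
  have "nbits (eval_exp e2 s) \<le> poly (b + bits_growth e2) N"
    using nbits_eval[OF FAssign.prems(2,3)] FAssign.prems(1) by simp
  then have "bits_bounded (poly (b + bits_growth e2) N) (upd s a (eval_exp e1 s) (eval_exp e2 s))"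
    by (intro bits_bounded_upd bits_bounded_mono[OF FAssign.prems(3)]) simp_all
  moreover have "exec (compile (FAssign a e1 e2)) s
      (exp_time e1 s + exp_time e2 s + operands_cost (eval_exp e1 s) (eval_exp e2 s))
      (fexec (FAssign a e1 e2) s)"
    using exec_Assign[of a e1 e2 s] by (simp add: upd_def)
  moreover have "exp_time e1 s + exp_time e2 s + operands_cost (eval_exp e1 s) (eval_exp e2 s)
      \<le> poly (com_time_bound (FAssign a e1 e2) b) N"
    using assign_time_le[OF FAssign.prems(2,3), of e1 e2] FAssign.prems(1) by simp
  ultimately show ?case unfolding fexec.simps com_growth.simps by blast
next
  case (FSeq c1 c2)
  have "ok c1" "ok c2" using FSeq.prems by simp_all
  obtain t1 where 1: "exec (compile c1) s t1 (fexec c1 s)" "t1 \<le> poly (com_time_bound c1 b) N"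
      "bits_bounded (poly (b + com_growth c1) N) (fexec c1 s)"
    using FSeq.IH(1)[OF \<open>ok c1\<close> FSeq.prems(2,3)] by blast
  have "input_bounded N (fexec c1 s)"
    using FSeq.prems(2) fexec_frame[of 0 c1 s] ok_writes[OF \<open>ok c1\<close>]
    by (simp add: input_bounded_def)
  from FSeq.IH(2)[OF \<open>ok c2\<close> this 1(3)]
  obtain t2 where 2: "exec (compile c2) (fexec c1 s) t2 (fexec c2 (fexec c1 s))"
      "t2 \<le> poly (com_time_bound c2 (b + com_growth c1)) N"
      "bits_bounded (poly (b + com_growth c1 + com_growth c2) N) (fexec c2 (fexec c1 s))"
    by blast
  show ?case
    using exec_Seq[OF 1(1) 2(1)] add_mono[OF 1(2) 2(2)] 2(3)
    by (intro exI[of _ "t1 + t2"]) (simp add: add.assoc)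
next
  case (FIf e c1 c2)
  have "ok c1" "ok c2" using FIf.prems by simp_all
  have g: "exp_time e s + nbits (eval_exp e s) \<le> poly (guard_time_bound e b) N"
    using guard_time_le[OF FIf.prems(2,3)] FIf.prems(1) by simp
  show ?case
  proof (cases "eval_exp e s = 0")
    case True
    obtain t where t: "exec (compile c2) s t (fexec c2 s)" "t \<le> poly (com_time_bound c2 b) N"
      "bits_bounded (poly (b + com_growth c2) N) (fexec c2 s)"
      using FIf.IH(2)[OF \<open>ok c2\<close> FIf.prems(2,3)] by blast
    show ?thesis
      using exec_CondF[OF True t(1), of "compile c1"] True g t(2) bits_bounded_mono[OF t(3)]
      by (intro exI[of _ "exp_time e s + nbits (eval_exp e s) + t"]) simp
  next
    case False
    obtain t where t: "exec (compile c1) s t (fexec c1 s)" "t \<le> poly (com_time_bound c1 b) N"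
      "bits_bounded (poly (b + com_growth c1) N) (fexec c1 s)"
      using FIf.IH(1)[OF \<open>ok c1\<close> FIf.prems(2,3)] by blast
    show ?thesis
      using exec_CondT[OF False t(1), of "compile c2"] False g t(2) bits_bounded_mono[OF t(3)]
      by (intro exI[of _ "exp_time e s + nbits (eval_exp e s) + t"]) simp
  qed
next
  case (FFor v k c)
  define B where "B = b + [:0, 1:] * (com_growth c + 1)"
  define G where "G = poly (com_growth c) N + 1"
  define guard where "guard = Minus (Get 0 (Num k)) (Get v (Num 0))"
  define incr where "incr = Plus (Get v (Num 0)) (Num 1)"
  define body where "body = Seq (compile c) (Assign v (Num 0) incr)"
  define f where "f = (\<lambda>s. upd (fexec c s) v 0 (Suc (fexec c s v 0)))"
  define tg where "tg = poly (guard_time_bound guard B) N"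
  define tb where "tb = poly (com_time_bound c B) N"
  define ta where "ta = poly (assign_time_bound (Num 0) incr (B + com_growth c)) N"
  have v: "v \<noteq> 0" "v \<notin> writes c" "ok c" "s 0 k \<le> N"
    using FFor.prems by (auto simp: input_bounded_def)
  have B: "poly B N = poly b N + N * G" by (simp add: B_def G_def)
  have good: "good guard" "good incr" by (simp_all add: guard_def incr_def)
  have f0: "f s' 0 = s' 0" for s'
    using v ok_writes[of c] by (simp add: f_def fexec_frame)
  \<comment> \<open>Induction on the number \<open>r\<close> of rounds still to come,
    \<open>i\<close> rounds being done. The bit bound grows linearly: \<open>G\<close> per round,
    including one bit for the counter.\<close>
  have "\<exists>t. exec (While guard body) s' t ((f ^^ r) s') \<and> t \<le> tg + r * (tg + tb + ta) \<and>
          bits_bounded (poly b N + (i + r) * G) ((f ^^ r) s')"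
    if "i + r \<le> N" "s' v 0 = i" "s' 0 k = i + r" "input_bounded N s'"
      "bits_bounded (poly b N + i * G) s'" for i r s'
    using that
  proof (induction r arbitrary: i s')
    case 0
    have bb: "bits_bounded (poly B N) s'"
      using bits_bounded_mono[OF "0.prems"(5)] 0 by (simp add: B)
    have "eval_exp guard s' = 0" using 0 by (simp add: guard_def)
    from exec_WhileF[OF this, of body] guard_time_le[OF "0.prems"(4) bb good(1)] 0
    show ?case by (auto simp: tg_def)
  next
    case (Suc r)
    have "poly b N + i * G \<le> poly B N" using Suc.prems(1) by (simp add: B)
    then have bb: "bits_bounded (poly B N) s'"
      using bits_bounded_mono[OF Suc.prems(5)] by blast
    have g: "eval_exp guard s' \<noteq> 0" using Suc.prems by (simp add: guard_def)
    have tg: "exp_time guard s' + nbits (eval_exp guard s') \<le> tg"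
      using guard_time_le[OF Suc.prems(4) bb good(1)] by (simp add: tg_def)
    have "bits_bounded (poly (b + [:i * G:]) N) s'" using Suc.prems(5) by simp
    from FFor.IH[OF v(3) Suc.prems(4) this]
    obtain t1 where 1: "exec (compile c) s' t1 (fexec c s')"
      "t1 \<le> poly (com_time_bound c (b + [:i * G:])) N"
      "bits_bounded (poly b N + i * G + poly (com_growth c) N) (fexec c s')"
      by auto
    have "t1 \<le> tb" unfolding tb_def
      by (rule le_trans[OF 1(2) com_time_bound_mono]) (use Suc.prems(1) in \<open>simp add: B\<close>)
    have ib: "input_bounded N (fexec c s')"
      using Suc.prems(4) fexec_frame[of 0 c s'] ok_writes[OF v(3)] by (simp add: input_bounded_def)
    have "poly b N + i * G + poly (com_growth c) N \<le> poly (B + com_growth c) N"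
      using Suc.prems(1) by (simp add: B)
    then have bb2: "bits_bounded (poly (B + com_growth c) N) (fexec c s')"
      using bits_bounded_mono[OF 1(3)] by blast
    have i: "fexec c s' v 0 = i" using v Suc.prems(2) by (simp add: fexec_frame)
    have fs: "f s' = (fexec c s')(v := (fexec c s' v)(eval_exp (Num 0) (fexec c s') := eval_exp incr (fexec c s')))"
      by (simp add: f_def upd_def incr_def)
    obtain t2 where 2: "exec (Assign v (Num 0) incr) (fexec c s') t2 (f s')" "t2 \<le> ta"
      using exec_Assign[of v "Num 0" incr "fexec c s'"] assign_time_le[OF ib bb2 _ good(2), of "Num 0"]
      unfolding fs ta_def by auto
    have body: "exec body s' (t1 + t2) (f s')"
      unfolding body_def by (rule exec_Seq[OF 1(1) 2(1)])
    have "nbits i \<le> poly b N + i * G + poly (com_growth c) N"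
      using 1(3) i unfolding bits_bounded_def by metis
    moreover from this have "nbits 1 \<le> poly b N + i * G + poly (com_growth c) N"
      using nbits_pos[of i] nbits_le_self[of 1] by linarith
    ultimately have "nbits (i + 1) \<le> Suc (poly b N + i * G + poly (com_growth c) N)"
      by (rule nbits_add)
    then have "bits_bounded (poly b N + Suc i * G) (f s')"
      unfolding f_def i
      by (intro bits_bounded_upd bits_bounded_mono[OF 1(3)]) (simp_all add: G_def)
    moreover have "input_bounded N (f s')" using Suc.prems(4) by (simp add: input_bounded_def f0)
    moreover have "f s' v 0 = Suc i" using i by (simp add: f_def)
    moreover have "f s' 0 k = Suc i + r" using Suc.prems(3) by (simp add: f0)
    ultimately obtain t3 where 3: "exec (While guard body) (f s') t3 ((f ^^ r) (f s'))"
      "t3 \<le> tg + r * (tg + tb + ta)"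
      "bits_bounded (poly b N + (Suc i + r) * G) ((f ^^ r) (f s'))"
      using Suc.IH[of "Suc i" "f s'"] Suc.prems(1) by auto
    from exec_WhileT[OF g body 3(1)] tg \<open>t1 \<le> tb\<close> \<open>t2 \<le> ta\<close> 3(2,3)
    show ?case
      by (intro exI[of _ "exp_time guard s' + nbits (eval_exp guard s') + (t1 + t2) + t3"])
        (simp add: funpow_swap1)
  qed
  note loop = this
  have "1 \<le> poly b N"
    using FFor.prems(3) nbits_pos[of "s 0 0"] unfolding bits_bounded_def by (meson le_trans)
  then have "bits_bounded (poly b N) (upd s v 0 0)"
    by (intro bits_bounded_upd FFor.prems) (simp add: nbits_le_iff)
  moreover have "input_bounded N (upd s v 0 0)"
    using FFor.prems(2) v by (simp add: input_bounded_def)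
  ultimately obtain t where t: "exec (While guard body) (upd s v 0 0) t ((f ^^ s 0 k) (upd s v 0 0))"
      "t \<le> tg + s 0 k * (tg + tb + ta)"
      "bits_bounded (poly b N + s 0 k * G) ((f ^^ s 0 k) (upd s v 0 0))"
    using loop[of 0 "s 0 k" "upd s v 0 0"] v by auto
  obtain t0 where t0: "exec (Assign v (Num 0) (Num 0)) s t0 (upd s v 0 0)"
      "t0 \<le> poly (assign_time_bound (Num 0) (Num 0) b) N"
    using exec_Assign[of v "Num 0" "Num 0" s] assign_time_le[OF FFor.prems(2,3), of "Num 0" "Num 0"]
    by (auto simp: upd_def)
  have "exec (compile (FFor v k c)) s (t0 + t) (fexec (FFor v k c) s)"
    using exec_Seq[OF t0(1) t(1)] by (simp add: f_def body_def guard_def incr_def)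
  moreover have "t0 + t \<le> poly (com_time_bound (FFor v k c) b) N"
  proof -
    have "t \<le> tg + N * (tg + tb + ta)"
      using t(2) mult_le_mono1[OF v(4), of "tg + tb + ta"] by linarith
    then show ?thesis
      using t0(2) unfolding com_time_bound.simps Let_def B_def[symmetric] guard_def[symmetric] incr_def[symmetric]
      by (simp add: tg_def tb_def ta_def)
  qed
  moreover have "bits_bounded (poly (b + com_growth (FFor v k c)) N) (fexec (FFor v k c) s)"
    using bits_bounded_mono[OF t(3), of "poly b N + N * G"] mult_le_mono1[OF v(4), of G]
    by (simp add: f_def G_def)
  ultimately show ?case by blast
qed

section \<open>A harmonic bound for sums\<close>

text \<open>The inequality \<open>ln x \<le> x - 1\<close> at \<open>x = k / (k + 1)\<close> bounds
  \<open>1 / (k + 1)\<close> by \<open>ln (k + 1) - ln k\<close>.\<close>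

lemma harmonic_le: "(\<Sum>i=1..k. 1 / real i) \<le> 1 + ln (real k)"
proof (induction k)
  case (Suc k)
  show ?case
  proof (cases "k = 0")
    case False
    have "ln (real k / real (Suc k)) \<le> real k / real (Suc k) - 1"
      by (rule ln_le_minus_one) (use False in simp)
    then have "1 / real (Suc k) \<le> ln (real (Suc k)) - ln (real k)"
      using False by (simp add: ln_div field_simps)
    with Suc show ?thesis by simp
  qed simp
qed simp

text \<open>The smallest entry \<open>d\<close> is at most \<open>A / length ds\<close>, because
  every entry is at least \<open>d\<close>. It is removed, and the hypothesis survives since the
  counts only go down.\<close>

lemma sum_list_le_harmonic:
  fixes A :: real
  assumes "\<And>X. 0 < X \<Longrightarrow> real (length (filter (\<lambda>d. X \<le> d) ds)) * real X \<le> A" "0 \<le> A"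
  shows "real (sum_list ds) \<le> A * (\<Sum>i=1..length ds. 1 / real i)"
  using assms(1)
proof (induction "length ds" arbitrary: ds)
  case (Suc k)
  define d where "d = Min (set ds)"
  have ne: "ds \<noteq> []" using Suc.hyps(2) by auto
  then have d: "d \<in> set ds" and min: "\<forall>x\<in>set ds. d \<le> x" by (auto simp: d_def)
  have len: "length (remove1 d ds) = k" using Suc.hyps(2) d by (simp add: length_remove1)
  have "length (filter (\<lambda>x. X \<le> x) (remove1 d ds)) \<le> length (filter (\<lambda>x. X \<le> x) ds)" for X
    by (simp add: filter_remove1 length_remove1)
  then have "real (sum_list (remove1 d ds)) \<le> A * (\<Sum>i=1..k. 1 / real i)"
    using Suc.hyps(1)[of "remove1 d ds"] Suc.prems len
    by (metis (no_types, lifting) mult_right_mono of_nat_0_le_iff of_nat_mono order_trans)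
  moreover have "real d \<le> A * (1 / real (Suc k))"
  proof (cases "d = 0")
    case False
    have "filter (\<lambda>x. d \<le> x) ds = ds" using min by (simp add: filter_id_conv)
    with Suc.prems[of d] False show ?thesis using ne unfolding Suc.hyps(2) by (simp add: field_simps)
  qed (use assms(2) in simp)
  moreover have "sum_list ds = d + sum_list (remove1 d ds)"
    using d by (rule sum_list_map_remove1[where f = "\<lambda>x. x", simplified])
  ultimately show ?case unfolding Suc.hyps(2)[symmetric] by (simp add: distrib_left)
qed simp

section \<open>Shortest walks and cuts\<close>

locale network =
  fixes n m :: nat and a b c u :: "nat \<Rightarrow> nat" and R :: "nat \<Rightarrow> nat \<Rightarrow> nat"
  assumes ends_less: "e < m \<Longrightarrow> a e < n" "e < m \<Longrightarrow> b e < n"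
    and cap_pos: "e < m \<Longrightarrow> 0 < u e"
begin

definition joins :: "nat \<Rightarrow> nat \<Rightarrow> nat \<Rightarrow> bool" where
  "joins e x y \<longleftrightarrow> a e = x \<and> b e = y \<or> a e = y \<and> b e = x"

definition copies :: "nat \<Rightarrow> nat \<Rightarrow> nat" where
  "copies r e = (r + u e - 1) div u e"

definition len :: "(nat \<Rightarrow> nat) \<Rightarrow> nat \<Rightarrow> nat \<Rightarrow> nat" where
  "len \<alpha> r e = (if \<alpha> e = 0 then c e * copies r e else 0)"

definition cost :: "(nat \<Rightarrow> nat) \<Rightarrow> nat" where
  "cost \<alpha> = (\<Sum>e<m. \<alpha> e * c e)"

inductive walk :: "(nat \<Rightarrow> nat) \<Rightarrow> nat \<Rightarrow> nat \<Rightarrow> nat \<Rightarrow> nat \<Rightarrow> bool" for l x where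
  walk_0: "walk l x 0 x 0"
| walk_Suc: "walk l x k y L \<Longrightarrow> e < m \<Longrightarrow> joins e y z \<Longrightarrow> walk l x (Suc k) z (L + l e)"

definition conn :: "(nat \<Rightarrow> bool) \<Rightarrow> nat \<Rightarrow> nat \<Rightarrow> bool" where
  "conn P x y \<longleftrightarrow> (x, y) \<in> {(x, y). \<exists>e<m. P e \<and> joins e x y}\<^sup>*"

lemma joins_sym: "joins e x y \<Longrightarrow> joins e y x"
  by (auto simp: joins_def)

lemma joins_less: "joins e x y \<Longrightarrow> e < m \<Longrightarrow> y < n"
  using ends_less by (auto simp: joins_def)

lemma copies_mult_ge:
  assumes "e < m" shows "r \<le> copies r e * u e"
proof -
  have "r + u e - 1 < u e + copies r e * u e"
    unfolding copies_def using dividend_less_div_times[OF cap_pos[OF assms]] .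
  then show ?thesis using cap_pos[OF assms] by linarith
qed

lemma copies_pos: "e < m \<Longrightarrow> 0 < r \<Longrightarrow> 0 < copies r e"
  using copies_mult_ge[of e r] by (cases "copies r e") auto

lemma copies_mono: "r \<le> r' \<Longrightarrow> copies r e \<le> copies r' e"
  unfolding copies_def by (intro div_le_mono) simp

text \<open>Rounding up loses only a factor of two: for \<open>u e \<le> r\<close> the copies
  overshoot \<open>r\<close> by less than one \<open>u e\<close>, and for \<open>u e > r\<close>
  there is at most one copy, counted as \<open>r\<close>. In the second case the truncation is
  essential.\<close>

lemma min_cap_copies:
  assumes "e < m" shows "min (u e) r * copies r e \<le> 2 * r"
proof (cases "u e \<le> r")
  case True
  have "copies r e * u e \<le> r + u e - 1" unfolding copies_def by simp
  with True show ?thesis by (simp add: mult.commute)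
next
  case False
  have "copies r e \<le> 1"
  proof -
    have "r + u e - 1 < 2 * u e" using False by simp
    then have "(r + u e - 1) div u e < 2" by (simp add: div_less_iff_less_mult cap_pos[OF assms])
    then show ?thesis by (simp add: copies_def)
  qed
  then have "r * copies r e \<le> r * 2" by (intro mult_le_mono2) simp
  moreover have "min (u e) r = r" using False by simp
  ultimately show ?thesis by (simp only: mult.commute)
qed

section \<open>Walks: concatenation, reversal, shortening\<close>

lemma walk_less: "walk l x k y L \<Longrightarrow> x < n \<Longrightarrow> y < n"
  by (induction rule: walk.induct) (auto dest: joins_less)

lemma walk_append:
  assumes "walk l y k' z L'" "walk l x k y L"
  shows "walk l x (k + k') z (L + L')"
  using assms by (induction rule: walk.induct) (auto intro: walk_Suc simp flip: add.assoc)

lemma walk_edge: "e < m \<Longrightarrow> joins e x y \<Longrightarrow> walk l x (Suc 0) y (l e)"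
  using walk_Suc[OF walk_0] by simp

lemma walk_sym: "walk l x k y L \<Longrightarrow> walk l y k x L"
proof (induction rule: walk.induct)
  case (walk_Suc k y L e z)
  then have "walk l z (Suc 0 + k) x (l e + L)"
    by (intro walk_append[OF walk_Suc.IH] walk_edge) (auto intro: joins_sym)
  then show ?case by (simp add: add.commute)
qed (rule walk_0)

lemma walk_mono:
  assumes "walk l x k y L" and "\<And>e. e < m \<Longrightarrow> l' e \<le> l e"
  shows "\<exists>L'\<le>L. walk l' x k y L'"
  using assms(1)
proof (induction rule: walk.induct)
  case (walk_Suc k y L e z)
  then obtain L' where "L' \<le> L" "walk l' x k y L'" by blast
  with walk_Suc.hyps assms(2)[of e] show ?case
    by (intro exI[of _ "L' + l' e"]) (auto intro: walk.walk_Suc)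
qed (use walk_0 in blast)

text \<open>\<open>f i\<close> is the vertex reached after \<open>i\<close> edges and
  \<open>g i\<close> the length of that prefix. In this form a walk can be cut at two places, as
  \<open>walk_shorten\<close> requires.\<close>

lemma walk_trace:
  "walk l x k y L \<Longrightarrow> \<exists>f g. f k = y \<and> (\<forall>i\<le>k. walk l x i (f i) (g i) \<and> g i \<le> L \<and> walk l (f i) (k - i) y (L - g i))
     \<and> (\<forall>j\<le>k. \<forall>i\<le>j. g i \<le> g j)"
proof (induction rule: walk.induct)
  case walk_0
  show ?case by (intro exI[of _ "\<lambda>_. x"] exI[of _ "\<lambda>_. 0"]) (auto intro: walk.walk_0)
next
  case (walk_Suc k y L e z)
  then obtain f g where fg: "f k = y"
      "\<forall>i\<le>k. walk l x i (f i) (g i) \<and> g i \<le> L \<and> walk l (f i) (k - i) y (L - g i)"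
      "\<forall>j\<le>k. \<forall>i\<le>j. g i \<le> g j" by blast
  let ?f = "f(Suc k := z)" and ?g = "g(Suc k := L + l e)"
  have *: "walk l x i (?f i) (?g i) \<and> ?g i \<le> L + l e \<and> walk l (?f i) (Suc k - i) z (L + l e - ?g i)"
    if "i \<le> Suc k" for i
  proof (cases "i = Suc k")
    case True
    then show ?thesis using walk_Suc.hyps by (auto intro: walk.intros)
  next
    case False
    then have i: "i \<le> k" using that by simp
    then have "walk l (f i) (Suc (k - i)) z (L - g i + l e)"
      using fg(2) i walk.walk_Suc[OF _ walk_Suc.hyps(2,3), of l "f i" "k - i" "L - g i"] by blast
    moreover have "Suc k - i = Suc (k - i)" "L - g i + l e = L + l e - g i"
      using i fg(2) by (auto simp: Suc_diff_le)
    ultimately show ?thesis using False i fg(2) by (auto intro: trans_le_add1)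
  qed
  have "\<forall>j\<le>Suc k. \<forall>i\<le>j. ?g i \<le> ?g j"
    using fg(2,3) by (auto simp: le_Suc_eq intro: trans_le_add1)
  with * show ?case by (intro exI[of _ ?f] exI[of _ ?g]) auto
qed

text \<open>With more than \<open>n\<close> edges some vertex repeats, and the closed part between
  two visits is cut out. Lengths are nonnegative, so the walk does not get longer.\<close>

lemma walk_shorten:
  "walk l x k y L \<Longrightarrow> x < n \<Longrightarrow> \<exists>k'\<le>n. \<exists>L'\<le>L. walk l x k' y L'"
proof (induction k arbitrary: L rule: less_induct)
  case (less k)
  show ?case
  proof (cases "k \<le> n")
    case True
    with less.prems show ?thesis by blast
  next
    case False
    from walk_trace[OF less.prems(1)] obtain f g where fg:
      "\<forall>i\<le>k. walk l x i (f i) (g i) \<and> g i \<le> L \<and> walk l (f i) (k - i) y (L - g i)"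
      "\<forall>j\<le>k. \<forall>i\<le>j. g i \<le> g j" by blast
    have "f ` {..k} \<subseteq> {..<n}" using fg(1) walk_less less.prems(2) by blast
    then have "card (f ` {..k}) \<le> n" using card_mono[of "{..<n}"] by fastforce
    then have "\<not> inj_on f {..k}" using False card_image[of f "{..k}"] by auto
    then obtain i j where "i \<le> k" "j \<le> k" "i \<noteq> j" "f i = f j" by (auto simp: inj_on_def)
    then obtain i j where ij: "i < j" "j \<le> k" "f i = f j"
      by (metis linorder_neqE_nat)
    have "i \<le> k" using ij by simp
    then have "walk l x i (f j) (g i)" using fg(1) ij(3) by metis
    then have "walk l x (i + (k - j)) y (g i + (L - g j))"
      using walk_append[of l "f j" "k - j" y "L - g j"] fg(1) ij(2) by blast
    moreover have "g i + (L - g j) \<le> L"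
    proof -
      have "g i \<le> g j" "g j \<le> L" using fg ij by auto
      then show ?thesis by linarith
    qed
    moreover have "i + (k - j) < k" using ij by linarith
    ultimately show ?thesis using less.IH less.prems(2) by (meson le_trans)
  qed
qed

lemma conn_refl: "conn P x x"
  by (simp add: conn_def)

lemma conn_trans: "conn P x y \<Longrightarrow> conn P y z \<Longrightarrow> conn P x z"
  unfolding conn_def by (rule rtrancl_trans)

lemma conn_edge: "e < m \<Longrightarrow> P e \<Longrightarrow> joins e x y \<Longrightarrow> conn P x y"
  unfolding conn_def by (rule r_into_rtrancl) auto

lemma conn_sym: "conn P x y \<Longrightarrow> conn P y x"
  unfolding conn_def
proof (induction rule: rtrancl_induct)
  case (step y z)
  then show ?case by (auto intro: converse_rtrancl_into_rtrancl joins_sym)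
qed simp

lemma conn_mono:
  assumes "conn P x y" "\<And>e. e < m \<Longrightarrow> P e \<Longrightarrow> Q e" shows "conn Q x y"
  using assms(1) unfolding conn_def
  by (rule rev_subsetD[OF _ rtrancl_mono]) (use assms(2) in auto)

lemma conn_imp_walk: "conn (\<lambda>e. 0 < \<alpha> e) x y \<Longrightarrow> \<exists>k. walk (len \<alpha> r) x k y 0"
  unfolding conn_def
proof (induction rule: rtrancl_induct)
  case base
  then show ?case using walk_0 by blast
next
  case (step y z)
  then obtain k e where "walk (len \<alpha> r) x k y 0" "e < m" "0 < \<alpha> e" "joins e y z" by auto
  from walk_Suc[OF this(1,2,4)] this(3) have "walk (len \<alpha> r) x (Suc k) z 0" by (simp add: len_def)
  then show ?case by blast
qed

lemma conn_crossing:
  assumes "conn P x y" "x \<in> S" "y \<notin> S"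
  shows "\<exists>e<m. P e \<and> (a e \<in> S) \<noteq> (b e \<in> S)"
  using assms unfolding conn_def
proof (induction rule: rtrancl_induct)
  case (step y z)
  then show ?case by (cases "y \<in> S") (auto simp: joins_def)
qed simp

section \<open>Cuts and feasible multiplicities\<close>

definition cut :: "(nat \<Rightarrow> nat) \<Rightarrow> nat set \<Rightarrow> nat" where
  "cut w S = (\<Sum>e | e < m \<and> (a e \<in> S) \<noteq> (b e \<in> S). w e)"

definition demands :: "(nat \<times> nat) set" where
  "demands = {(i, j). i < j \<and> j < n \<and> 0 < R i j}"

definition satisfies :: "(nat \<Rightarrow> nat) \<Rightarrow> bool" where
  "satisfies \<beta> \<longleftrightarrow> (\<forall>(i, j)\<in>demands. \<forall>S\<subseteq>{..<n}. (i \<in> S) \<noteq> (j \<in> S) \<longrightarrow> R i j \<le> cut (\<lambda>e. \<beta> e * u e) S)"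

lemma satisfiesD:
  assumes "satisfies \<beta>" "(i, j) \<in> demands" "S \<subseteq> {..<n}" "(i \<in> S) \<noteq> (j \<in> S)"
  shows "R i j \<le> cut (\<lambda>e. \<beta> e * u e) S"
  using assms unfolding satisfies_def by blast

lemma finite_demands: "finite demands"
  by (rule finite_subset[of _ "{..<n} \<times> {..<n}"]) (auto simp: demands_def)

text \<open>If \<open>t\<close> is unreachable, no edge crosses the set reachable from
  \<open>s\<close>, so its cut is 0 although the requirement is positive. Thus solvability makes the
  distances of all demands finite.\<close>

lemma satisfies_reachable:
  assumes "satisfies \<beta>" "(s, t) \<in> demands"
  shows "\<exists>k L. walk l s k t L"
proof (rule ccontr)
  assume no: "\<not> ?thesis"
  let ?S = "{y. \<exists>k L. walk l s k y L}"
  have sub: "?S \<subseteq> {..<n}" using walk_less assms(2) by (auto simp: demands_def)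
  have "s \<in> ?S" "t \<notin> ?S" using no walk_0[of l s] by blast+
  then have le: "R s t \<le> cut (\<lambda>e. \<beta> e * u e) ?S"
    by (intro satisfiesD[OF assms sub]) simp
  have empty: "{e. e < m \<and> (a e \<in> ?S) \<noteq> (b e \<in> ?S)} = {}"
  proof -
    have step: "y \<in> ?S" if "x \<in> ?S" "e < m" "joins e x y" for x y e
      using that walk_Suc by blast
    have "(a e \<in> ?S) = (b e \<in> ?S)" if "e < m" for e
      using step[OF _ that, of "a e" "b e"] step[OF _ that, of "b e" "a e"] unfolding joins_def by blast
    then show ?thesis by blast
  qed
  have "cut (\<lambda>e. \<beta> e * u e) ?S = 0" unfolding cut_def empty by (rule sum.empty)
  with le show False using assms(2) by (simp add: demands_def)
qed


text \<open>Either a single bought crossing edge has capacity at least \<open>r\<close> and still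
  contributes \<open>r\<close> after truncation, or truncation changes no bought crossing
  edge.\<close>

lemma cut_truncate:
  assumes "r \<le> cut (\<lambda>e. \<beta> e * u e) S"
  shows "r \<le> cut (\<lambda>e. \<beta> e * min (u e) r) S"
proof (cases "\<exists>e. e < m \<and> (a e \<in> S) \<noteq> (b e \<in> S) \<and> 0 < \<beta> e \<and> r \<le> u e")
  case True
  then obtain e where e: "e < m" "(a e \<in> S) \<noteq> (b e \<in> S)" "0 < \<beta> e" "r \<le> u e" by blast
  have "r \<le> \<beta> e * min (u e) r" using e by simp
  also have "\<dots> \<le> cut (\<lambda>e. \<beta> e * min (u e) r) S"
    unfolding cut_def by (rule member_le_sum) (use e in auto)
  finally show ?thesis .
next
  case False
  then have "cut (\<lambda>e. \<beta> e * u e) S = cut (\<lambda>e. \<beta> e * min (u e) r) S"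
    unfolding cut_def by (intro sum.cong) (auto simp: min_def)
  with assms show ?thesis by simp
qed

section \<open>Disjoint balls bound every solution from below\<close>

text \<open>
  A centre records the endpoint of a demand that was far from the earlier centres, the other
  endpoint, the requirement, the copies bought so far, and the distance to the other endpoint.
\<close>

datatype centre = Centre (site: nat) (mate: nat) (rq: nat) (bought: "nat \<Rightarrow> nat") (scale: nat)

definition clen :: "centre \<Rightarrow> nat \<Rightarrow> nat" where
  "clen g = len (bought g) (rq g)"

text \<open>An open ball of radius \<open>X / 8\<close>, written without division. Two centres of
  scale at least \<open>X / 2\<close> that are half the later scale apart have distance at least
  \<open>X / 4\<close>, just twice this radius.\<close>

definition ball :: "centre \<Rightarrow> nat \<Rightarrow> nat set" where
  "ball g X = {y. \<exists>k L. walk (clen g) (site g) k y L \<and> 8 * L < X}"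

definition valid_centre :: "centre \<Rightarrow> bool" where
  "valid_centre g \<longleftrightarrow>
     ((site g, mate g) \<in> demands \<and> rq g = R (site g) (mate g) \<or>
      (mate g, site g) \<in> demands \<and> rq g = R (mate g) (site g)) \<and>
     (\<forall>k L. walk (clen g) (site g) k (mate g) L \<longrightarrow> scale g \<le> L)"

text \<open>The levels in question start no earlier than 8 times the distance of \<open>y\<close>
  and end before \<open>z\<close> is reached through \<open>e\<close>, so they lie in an interval of
  \<open>8 * l e\<close> integers.\<close>

lemma card_separating_levels:
  assumes "e < m" "joins e y z"
  shows "card {\<theta>::nat. \<theta> < X \<and> (\<exists>k L. walk l x k y L \<and> 8 * L \<le> \<theta>) \<and> \<not> (\<exists>k L. walk l x k z L \<and> 8 * L \<le> \<theta>)}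
    \<le> 8 * l e" (is "card ?A \<le> _")
proof (cases "\<exists>L k. walk l x k y L")
  case False
  then have "?A = {}" by blast
  then show ?thesis by (metis card.empty zero_le)
next
  case True
  define L0 where "L0 = (LEAST L. \<exists>k. walk l x k y L)"
  have "\<exists>k. walk l x k y L0" unfolding L0_def using True by (rule LeastI_ex)
  then obtain k0 where k0: "walk l x k0 y L0" by blast
  have "?A \<subseteq> {8 * L0..<8 * L0 + 8 * l e}"
  proof
    fix \<theta> assume \<theta>: "\<theta> \<in> ?A"
    then obtain k L where "walk l x k y L" "8 * L \<le> \<theta>" by blast
    moreover from this have "L0 \<le> L" unfolding L0_def by (metis (mono_tags, lifting) Least_le)
    moreover have "\<not> 8 * (L0 + l e) \<le> \<theta>" using \<theta> walk_Suc[OF k0 assms] by blast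
    ultimately show "\<theta> \<in> {8 * L0..<8 * L0 + 8 * l e}" by simp
  qed
  then have "card ?A \<le> card {8 * L0..<8 * L0 + 8 * l e}" by (rule card_mono[rotated]) simp
  then show ?thesis by simp
qed

text \<open>A moat-packing argument in integral form. Each of the \<open>X\<close> level sets
  separates the site from the mate and so carries truncated capacity at least \<open>r\<close>.
  Summing over the levels and exchanging the sums charges an edge for at most
  \<open>16 * l e\<close> levels, and only if it touches the ball. The factor \<open>r\<close> then
  cancels by \<open>min_cap_copies\<close>, whose factor 2 turns 16 into 32.\<close>

lemma ball_bound:
  assumes "satisfies \<beta>" "valid_centre g" "X \<le> 2 * scale g" "0 < X"
  shows "X \<le> 32 * (\<Sum>e<m. \<beta> e * c e * (of_bool (a e \<in> ball g X) + of_bool (b e \<in> ball g X)))"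
proof -
  define r where "r = rq g"
  define l where "l = clen g"
  define S where "S \<theta> = {y. \<exists>k L. walk l (site g) k y L \<and> 8 * L \<le> \<theta>}" for \<theta>
  define w where "w e = \<beta> e * min (u e) r" for e
  define sep where "sep e \<theta> \<longleftrightarrow> (a e \<in> S \<theta>) \<noteq> (b e \<in> S \<theta>)" for e \<theta>
  define touch :: "nat \<Rightarrow> nat" where
    "touch e = of_bool (a e \<in> ball g X) + of_bool (b e \<in> ball g X)" for e
  have r: "0 < r" and less: "site g < n"
    using assms(2) by (auto simp: valid_centre_def demands_def r_def)
  have cutS: "r \<le> cut w (S \<theta>)" if "\<theta> < X" for \<theta>
  proof -
    have "8 * 0 \<le> \<theta>" by simp
    then have 1: "site g \<in> S \<theta>" unfolding S_def using walk_0[of l] by blast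
    have "\<theta> < 8 * L" if "walk l (site g) k (mate g) L" for k L
      using that assms(2,3) \<open>\<theta> < X\<close> unfolding valid_centre_def l_def by fastforce
    then have 2: "mate g \<notin> S \<theta>" unfolding S_def using not_le by blast
    have 3: "S \<theta> \<subseteq> {..<n}" using walk_less less by (auto simp: S_def)
    have "r \<le> cut (\<lambda>e. \<beta> e * u e) (S \<theta>)"
      using assms(1,2) 1 2 3 unfolding satisfies_def valid_centre_def r_def by fastforce
    then show ?thesis unfolding w_def by (rule cut_truncate)
  qed
  \<comment> \<open>An edge without endpoint in the ball is separated at no level below
    \<open>X\<close>. For any other edge, each of its two directions accounts for at most
    \<open>8 * l e\<close> levels.\<close>
  have lev: "card {\<theta>. \<theta> < X \<and> sep e \<theta>} \<le> 16 * l e * touch e" if e: "e < m" for e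
  proof (cases "touch e = 0")
    case True
    have "S \<theta> \<subseteq> ball g X" if "\<theta> < X" for \<theta>
      using that unfolding S_def ball_def l_def by (auto intro: le_less_trans)
    with True have "{\<theta>. \<theta> < X \<and> sep e \<theta>} = {}" by (auto simp: sep_def touch_def)
    then show ?thesis by (simp only: card.empty)
  next
    case False
    let ?A = "\<lambda>y z. {\<theta>. \<theta> < X \<and> y \<in> S \<theta> \<and> z \<notin> S \<theta>}"
    have "{\<theta>. \<theta> < X \<and> sep e \<theta>} \<subseteq> ?A (a e) (b e) \<union> ?A (b e) (a e)" by (auto simp: sep_def)
    then have "card {\<theta>. \<theta> < X \<and> sep e \<theta>} \<le> card (?A (a e) (b e)) + card (?A (b e) (a e))"
      by (rule le_trans[OF card_mono card_Un_le, rotated]) simp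
    also have "\<dots> \<le> 8 * l e + 8 * l e"
      unfolding S_def mem_Collect_eq
      by (intro add_mono card_separating_levels[OF e]) (auto simp: joins_def)
    also have "\<dots> \<le> 16 * l e * touch e" using False by (cases "touch e") auto
    finally show ?thesis .
  qed
  have "X * r = (\<Sum>\<theta><X. r)" by simp
  also have "\<dots> \<le> (\<Sum>\<theta><X. cut w (S \<theta>))" by (rule sum_mono) (simp add: cutS)
  also have "\<dots> = (\<Sum>\<theta><X. \<Sum>e<m. w e * of_bool (sep e \<theta>))"
  proof (rule sum.cong[OF refl])
    fix \<theta>
    have "cut w (S \<theta>) = (\<Sum>e\<in>{e\<in>{..<m}. sep e \<theta>}. w e)" by (simp add: cut_def sep_def)
    also have "\<dots> = (\<Sum>e<m. if sep e \<theta> then w e else 0)" by (rule sum.inter_filter) simp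
    also have "\<dots> = (\<Sum>e<m. w e * of_bool (sep e \<theta>))" by (intro sum.cong) auto
    finally show "cut w (S \<theta>) = (\<Sum>e<m. w e * of_bool (sep e \<theta>))" .
  qed
  also have "\<dots> = (\<Sum>e<m. \<Sum>\<theta><X. w e * of_bool (sep e \<theta>))" by (rule sum.swap)
  also have "\<dots> = (\<Sum>e<m. w e * card {\<theta>. \<theta> < X \<and> sep e \<theta>})"
  proof (rule sum.cong[OF refl])
    fix e
    have "(\<Sum>\<theta><X. of_bool (sep e \<theta>)) = card {\<theta>. \<theta> < X \<and> sep e \<theta>}"
      by (simp add: sum.If_cases of_bool_def Int_def)
    then show "(\<Sum>\<theta><X. w e * of_bool (sep e \<theta>)) = w e * card {\<theta>. \<theta> < X \<and> sep e \<theta>}"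
      by (simp flip: sum_distrib_left)
  qed
  also have "\<dots> \<le> (\<Sum>e<m. 32 * r * (\<beta> e * c e * touch e))"
  proof (rule sum_mono)
    fix e assume "e \<in> {..<m}"
    then have e: "e < m" by simp
    have "w e * card {\<theta>. \<theta> < X \<and> sep e \<theta>} \<le> w e * (16 * (c e * copies r e) * touch e)"
      by (rule mult_le_mono2, rule le_trans[OF lev[OF e]])
        (auto simp: l_def clen_def len_def r_def)
    also have "\<dots> = 16 * (\<beta> e * c e * touch e) * (min (u e) r * copies r e)"
      by (simp add: w_def)
    also have "\<dots> \<le> 16 * (\<beta> e * c e * touch e) * (2 * r)"
      by (rule mult_le_mono2[OF min_cap_copies[OF e]])
    finally show "w e * card {\<theta>. \<theta> < X \<and> sep e \<theta>} \<le> 32 * r * (\<beta> e * c e * touch e)"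
      by (simp add: ac_simps)
  qed
  finally have "r * X \<le> r * (32 * (\<Sum>e<m. \<beta> e * c e * touch e))"
    by (simp add: sum_distrib_left ac_simps)
  then show ?thesis using r unfolding touch_def by simp
qed

text \<open>By disjointness an endpoint of an edge lies in at most one ball of the family, so adding
  \<open>ball_bound\<close> over the family counts each edge at most twice: 64 is 32 times
  2.\<close>

lemma class_bound:
  assumes "satisfies \<beta>" "finite I" "0 < X"
    and "\<And>i. i \<in> I \<Longrightarrow> valid_centre (G i) \<and> X \<le> 2 * scale (G i)"
    and "\<And>i j. i \<in> I \<Longrightarrow> j \<in> I \<Longrightarrow> i \<noteq> j \<Longrightarrow> ball (G i) X \<inter> ball (G j) X = {}"
  shows "card I * X \<le> 64 * cost \<beta>"
proof -
  have one: "(\<Sum>i\<in>I. of_bool (x \<in> ball (G i) X)) \<le> (1::nat)" for x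
  proof -
    have "(\<Sum>i\<in>I. of_bool (x \<in> ball (G i) X)) = card {i \<in> I. x \<in> ball (G i) X}"
      using assms(2) by (simp add: of_bool_def sum.If_cases Int_def)
    also have "\<dots> \<le> 1"
      using assms(2,5) by (auto simp: card_le_Suc0_iff_eq)
    finally show ?thesis .
  qed
  have "card I * X = (\<Sum>i\<in>I. X)" by simp
  also have "\<dots> \<le> (\<Sum>i\<in>I. 32 * (\<Sum>e<m. \<beta> e * c e * (of_bool (a e \<in> ball (G i) X) + of_bool (b e \<in> ball (G i) X))))"
    by (rule sum_mono, rule ball_bound) (use assms in auto)
  also have "\<dots> = 32 * (\<Sum>e<m. \<beta> e * c e * ((\<Sum>i\<in>I. of_bool (a e \<in> ball (G i) X)) + (\<Sum>i\<in>I. of_bool (b e \<in> ball (G i) X))))"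
    unfolding sum_distrib_left[symmetric] sum.distrib[symmetric]
    by (subst sum.swap) (simp add: sum_distrib_left)
  also have "\<dots> \<le> 32 * (\<Sum>e<m. \<beta> e * c e * (1 + 1))"
    by (intro mult_le_mono2 sum_mono add_mono one)
  also have "\<dots> = 64 * cost \<beta>"
    by (simp add: cost_def sum_distrib_left mult_ac)
  finally show ?thesis .
qed

text \<open>Only centres whose scales both lie in [X / 2, X) are compared. All \<open>X\<close> are
  allowed, not only powers of two, because the dyadic decomposition starts from an arbitrary
  threshold.\<close>

definition disjoint_balls :: "centre list \<Rightarrow> bool" where
  "disjoint_balls G \<longleftrightarrow> (\<forall>j<length G. \<forall>i<j. \<forall>X.
     X \<le> 2 * scale (G ! i) \<and> 2 * scale (G ! i) < 2 * X \<and>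
     X \<le> 2 * scale (G ! j) \<and> 2 * scale (G ! j) < 2 * X \<longrightarrow> ball (G ! i) X \<inter> ball (G ! j) X = {})"

text \<open>Centres of scale at least \<open>X / 2\<close> split into the class of \<open>X\<close>
  and those of scale at least \<open>X\<close>. The thresholds double from class to class, so a
  geometric series turns the 64 of \<open>class_bound\<close> into 128. The induction ends beyond
  the largest doubled scale.\<close>

lemma large_centres_bound:
  assumes "satisfies \<beta>" "\<forall>g\<in>set G. valid_centre g" "disjoint_balls G" "0 < X"
  shows "length (filter (\<lambda>g. X \<le> 2 * scale g) G) * X \<le> 128 * cost \<beta>"
proof -
  obtain M where M: "\<forall>g\<in>set G. 2 * scale g < M"
    using finite_nat_set_iff_bounded[of "(\<lambda>g. 2 * scale g) ` set G"] by auto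
  show ?thesis using assms(4)
  proof (induction "M - X" arbitrary: X rule: less_induct)
    case less
    let ?C = "\<lambda>X. {i. i < length G \<and> X \<le> 2 * scale (G ! i)}"
    let ?I = "{i. i < length G \<and> X \<le> 2 * scale (G ! i) \<and> 2 * scale (G ! i) < 2 * X}"
    show ?case
    proof (cases "X < M")
      case False
      then have "filter (\<lambda>g. X \<le> 2 * scale g) G = []" using M by (auto simp: filter_empty_conv)
      then show ?thesis by simp
    next
      case True
      have "?C X \<subseteq> ?I \<union> ?C (2 * X)" by auto
      then have "card (?C X) \<le> card ?I + card (?C (2 * X))"
        by (rule le_trans[OF card_mono card_Un_le, rotated]) simp
      moreover have "card ?I * X \<le> 64 * cost \<beta>"
      proof (rule class_bound[OF assms(1), where G = "\<lambda>i. G ! i"])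
        fix i j assume "i \<in> ?I" "j \<in> ?I" "i \<noteq> j"
        then show "ball (G ! i) X \<inter> ball (G ! j) X = {}"
          using assms(3) unfolding disjoint_balls_def
          by (cases "i < j") (auto simp: Int_commute)
      qed (use assms less.prems in auto)
      moreover have "card (?C (2 * X)) * (2 * X) \<le> 128 * cost \<beta>"
        using less.hyps[of "2 * X"] less.prems True by (simp add: length_filter_conv_card)
      ultimately have "card (?C X) * X \<le> 128 * cost \<beta>"
        using mult_le_mono1[of "card (?C X)" "card ?I + card (?C (2 * X))" X]
        by (simp add: algebra_simps)
      then show ?thesis by (simp add: length_filter_conv_card)
    qed
  qed
qed

section \<open>The invariant of the greedy algorithm\<close>

definition comp_of :: "(nat \<Rightarrow> nat) \<Rightarrow> nat \<Rightarrow> nat set" where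
  "comp_of \<alpha> v = {w. conn (\<lambda>e. 0 < \<alpha> e) v w}"

definition large_sites :: "centre list \<Rightarrow> nat \<Rightarrow> nat set" where
  "large_sites G X = site ` {g \<in> set G. X \<le> 2 * scale g}"

lemma comp_of_eq_iff: "comp_of \<alpha> v = comp_of \<alpha> w \<longleftrightarrow> conn (\<lambda>e. 0 < \<alpha> e) v w"
  unfolding comp_of_def by (blast intro: conn_refl conn_sym conn_trans)

text \<open>Each old component is sent to the new component that contains it. The new components are
  thus an image of the old ones, and their number can be compared as that of an image.\<close>

lemma comp_of_image:
  assumes "\<forall>e<m. 0 < \<alpha> e \<longrightarrow> 0 < \<alpha>' e"
  shows "comp_of \<alpha>' ` V = (\<lambda>K. \<Union>(comp_of \<alpha>' ` K)) ` comp_of \<alpha> ` V"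
proof -
  have "\<Union>(comp_of \<alpha>' ` comp_of \<alpha> v) = comp_of \<alpha>' v" for v
    unfolding comp_of_def
    using conn_mono[of "\<lambda>e. 0 < \<alpha> e" v _ "\<lambda>e. 0 < \<alpha>' e"] assms
    by (auto intro: conn_refl conn_trans)
  then show ?thesis by (simp add: image_image)
qed

lemma card_comp_of_le:
  assumes "\<forall>e<m. 0 < \<alpha> e \<longrightarrow> 0 < \<alpha>' e" "finite V"
  shows "card (comp_of \<alpha>' ` V) \<le> card (comp_of \<alpha> ` V)"
  by (subst comp_of_image[OF assms(1)], rule card_image_le) (use assms(2) in simp)

text \<open>If the number of components did not drop, the map between components would be injective,
  but it identifies those of \<open>v\<close> and \<open>w\<close>.\<close>

lemma card_comp_of_less:
  assumes mono: "\<forall>e<m. 0 < \<alpha> e \<longrightarrow> 0 < \<alpha>' e" and "finite V" "v \<in> V" "w \<in> V"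
    and "\<not> conn (\<lambda>e. 0 < \<alpha> e) v w" "conn (\<lambda>e. 0 < \<alpha>' e) v w"
  shows "card (comp_of \<alpha>' ` V) < card (comp_of \<alpha> ` V)"
proof (rule ccontr)
  assume "\<not> ?thesis"
  with card_comp_of_le[of \<alpha> \<alpha>' V] assms(1,2)
  have eq: "card (comp_of \<alpha>' ` V) = card (comp_of \<alpha> ` V)" by force
  let ?F = "\<lambda>K. \<Union>(comp_of \<alpha>' ` K)"
  have "inj_on ?F (comp_of \<alpha> ` V)"
    by (rule eq_card_imp_inj_on)
      (use eq assms(2) comp_of_image[of \<alpha> \<alpha>' V] mono in simp_all)
  moreover have "?F (comp_of \<alpha> x) = comp_of \<alpha>' x" for x
    using comp_of_image[of \<alpha> \<alpha>' "{x}"] mono by simp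
  ultimately have "comp_of \<alpha> v = comp_of \<alpha> w"
    using assms(3-6) comp_of_eq_iff by (metis image_eqI inj_onD)
  with assms(5) show False by (simp add: comp_of_eq_iff)
qed

text \<open>
  The last clause counts the steps at distance at least \<open>X\<close>: each of them either creates a centre
  or merges two components of the bought edges that contain large centres.
\<close>

definition ghost_invariant ::
    "(nat \<Rightarrow> nat) \<Rightarrow> (nat \<Rightarrow> nat) \<Rightarrow> (nat \<times> nat) set \<Rightarrow> centre list \<Rightarrow> nat list \<Rightarrow> bool" where
  "ghost_invariant \<alpha> \<sigma> D G ds \<longleftrightarrow>
     cost \<alpha> \<le> 2 * sum_list ds \<and> length ds = card D \<and> D \<subseteq> demands \<and>
     (\<forall>e<m. 0 < \<alpha> e \<longrightarrow> (\<forall>(i, j)\<in>demands - D. R i j \<le> \<alpha> e * u e)) \<and>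
     (\<forall>(i, j)\<in>D. conn (\<lambda>e. R i j \<le> \<alpha> e * u e) i j) \<and>
     (\<forall>g\<in>set G. valid_centre g \<and> (\<forall>e<m. 0 < bought g e \<longrightarrow> 0 < \<alpha> e) \<and>
        (\<forall>(i, j)\<in>demands - D. R i j \<le> rq g) \<and> scale g \<le> \<sigma> (site g)) \<and>
     disjoint_balls G \<and>
     (\<forall>v. 0 < \<sigma> v \<longrightarrow> (\<exists>g\<in>set G. site g = v \<and> scale g = \<sigma> v)) \<and>
     (\<forall>X>0. length (filter (\<lambda>d. X \<le> d) ds) + card (comp_of \<alpha> ` large_sites G X)
        \<le> 2 * length (filter (\<lambda>g. X \<le> 2 * scale g) G))"

text \<open>The list of centres and the list of distances belong to the analysis only. Of the
  centres the program stores \<open>\<sigma>\<close>, the largest scale at each vertex.\<close>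

definition greedy_invariant :: "(nat \<Rightarrow> nat) \<Rightarrow> (nat \<Rightarrow> nat) \<Rightarrow> (nat \<times> nat) set \<Rightarrow> bool" where
  "greedy_invariant \<alpha> \<sigma> D \<longleftrightarrow> (\<exists>G ds. ghost_invariant \<alpha> \<sigma> D G ds)"

lemma greedy_invariant_init: "greedy_invariant (\<lambda>_. 0) (\<lambda>_. 0) {}"
  unfolding greedy_invariant_def ghost_invariant_def
  by (intro exI[of _ "[]"]) (simp add: cost_def disjoint_balls_def large_sites_def)

lemma len_le:
  assumes "0 < \<alpha>0 e \<Longrightarrow> 0 < \<alpha> e" "r \<le> r0"
  shows "len \<alpha> r e \<le> len \<alpha>0 r0 e"
  using assms copies_mono[of r r0 e] by (auto simp: len_def)

text \<open>A bought edge is never topped up. The relation is therefore transitive and describes a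
  whole step, in which up to three paths are bought for the same \<open>r\<close>.\<close>

definition buys :: "nat \<Rightarrow> (nat \<Rightarrow> nat) \<Rightarrow> (nat \<Rightarrow> nat) \<Rightarrow> bool" where
  "buys r \<alpha> \<alpha>' \<longleftrightarrow> (\<forall>e<m. \<alpha>' e = \<alpha> e \<or> \<alpha> e = 0 \<and> \<alpha>' e = copies r e)"

lemma buys_refl: "buys r \<alpha> \<alpha>"
  by (simp add: buys_def)

lemma buys_trans: "buys r \<alpha> \<alpha>' \<Longrightarrow> buys r \<alpha>' \<alpha>'' \<Longrightarrow> buys r \<alpha> \<alpha>''"
  unfolding buys_def by fastforce

lemma buys_pos: "buys r \<alpha> \<alpha>' \<Longrightarrow> e < m \<Longrightarrow> 0 < \<alpha> e \<Longrightarrow> 0 < \<alpha>' e"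
  unfolding buys_def by fastforce

lemma buys_le: "buys r \<alpha> \<alpha>' \<Longrightarrow> e < m \<Longrightarrow> \<alpha> e \<le> \<alpha>' e"
  unfolding buys_def by fastforce

text \<open>The bookkeeping common to all kinds of steps. For the potential in the last clause: a
  merge adds one long step and removes a component; a large new centre adds at most one long step
  and one component, while the right-hand side grows by two.\<close>

lemma ghost_invariant_step:
  assumes inv: "ghost_invariant \<alpha> \<sigma> D G ds"
    and st: "(s, t) \<in> demands - D" and max: "\<And>i j. (i, j) \<in> demands - D \<Longrightarrow> R i j \<le> R s t"
    and buys: "buys (R s t) \<alpha> \<alpha>'" and cost: "cost \<alpha>' \<le> cost \<alpha> + 2 * d"
    and conn: "conn (\<lambda>e. 0 < \<alpha>' e) s t"
    and cases: "G' = G \<and> \<sigma>' = \<sigma> \<and> (0 < d \<longrightarrow>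
        (\<exists>g1\<in>set G. \<exists>g2\<in>set G. d \<le> 2 * scale g1 \<and> d \<le> 2 * scale g2 \<and>
           \<not> conn (\<lambda>e. 0 < \<alpha> e) (site g1) (site g2) \<and> conn (\<lambda>e. 0 < \<alpha>' e) (site g1) (site g2)))
      \<or> (\<exists>v w. G' = G @ [Centre v w (R s t) \<alpha> d] \<and> \<sigma>' = \<sigma>(v := d) \<and> 0 < d \<and>
           valid_centre (Centre v w (R s t) \<alpha> d) \<and>
           (\<forall>g\<in>set G. d \<le> 2 * scale g \<longrightarrow>
              (\<forall>k L. walk (len \<alpha> (R s t)) (site g) k v L \<longrightarrow> d \<le> 2 * L)))"
  shows "ghost_invariant \<alpha>' \<sigma>' (insert (s, t) D) G' (ds @ [d])"
proof -
  let ?r = "R s t"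
  note I = inv[unfolded ghost_invariant_def]
  have r: "0 < ?r" using st by (simp add: demands_def)
  have "D \<subseteq> demands" using I by (elim conjE)
  then have finD: "finite D" using finite_demands by (rule finite_subset)
  have pos: "\<forall>e<m. 0 < \<alpha> e \<longrightarrow> 0 < \<alpha>' e" using buys buys_pos by blast
  have sub: "demands - insert (s, t) D \<subseteq> demands - D" by blast
  \<comment> \<open>Edges bought earlier have enough capacity for every unserved demand, hence for
    this one, and new edges by rounding up. Maximality of \<open>?r\<close> passes the bound on to
    the demands that remain.\<close>
  have enough: "?r \<le> \<alpha>' e * u e" if e: "e < m" "0 < \<alpha>' e" for e
  proof (cases "\<alpha> e = 0")
    case True
    then have "\<alpha>' e = copies ?r e" using buys e by (auto simp: buys_def)
    then show ?thesis using copies_mult_ge[OF e(1), of ?r] by simp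
  next
    case False
    then have "?r \<le> \<alpha> e * u e" using I e(1) st by fastforce
    then show ?thesis using buys_le[OF buys e(1)] by (meson le_trans mult_le_mono1)
  qed
  have 1: "cost \<alpha>' \<le> 2 * sum_list (ds @ [d])" using I cost by simp
  have 2: "length (ds @ [d]) = card (insert (s, t) D)" using I finD st by simp
  have 3: "insert (s, t) D \<subseteq> demands" using I st by blast
  have 4: "\<forall>e<m. 0 < \<alpha>' e \<longrightarrow> (\<forall>(i, j)\<in>demands - insert (s, t) D. R i j \<le> \<alpha>' e * u e)"
    using enough max sub by (fastforce intro: le_trans)
  have 5: "\<forall>(i, j)\<in>insert (s, t) D. conn (\<lambda>e. R i j \<le> \<alpha>' e * u e) i j"
  proof (clarify)
    fix i j assume "(i, j) \<in> insert (s, t) D"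
    then consider "i = s" "j = t" | "(i, j) \<in> D" by blast
    then show "conn (\<lambda>e. R i j \<le> \<alpha>' e * u e) i j"
    proof cases
      case 1
      then show ?thesis using conn_mono[OF conn] enough by simp
    next
      case 2
      then have "conn (\<lambda>e. R i j \<le> \<alpha> e * u e) i j" using I by blast
      then show ?thesis
        by (rule conn_mono) (meson buys buys_le le_trans mult_le_mono1)
    qed
  qed
  have old: "\<forall>g\<in>set G. valid_centre g \<and> (\<forall>e<m. 0 < bought g e \<longrightarrow> 0 < \<alpha>' e) \<and>
        (\<forall>(i, j)\<in>demands - insert (s, t) D. R i j \<le> rq g)"
    using I pos sub by blast
  have fin: "finite (large_sites G X)" for X by (simp add: large_sites_def)
  have le: "card (comp_of \<alpha>' ` large_sites G X) \<le> card (comp_of \<alpha> ` large_sites G X)" for X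
    by (rule card_comp_of_le) (use pos fin in auto)
  have count: "length (filter (\<lambda>d. X \<le> d) ds) + card (comp_of \<alpha> ` large_sites G X)
        \<le> 2 * length (filter (\<lambda>g. X \<le> 2 * scale g) G)" if "0 < X" for X
    using I that by blast
  from cases show ?thesis
  proof (elim disjE exE conjE)
    assume G: "G' = G" "\<sigma>' = \<sigma>" and merge: "0 < d \<longrightarrow>
        (\<exists>g1\<in>set G. \<exists>g2\<in>set G. d \<le> 2 * scale g1 \<and> d \<le> 2 * scale g2 \<and>
           \<not> conn (\<lambda>e. 0 < \<alpha> e) (site g1) (site g2) \<and> conn (\<lambda>e. 0 < \<alpha>' e) (site g1) (site g2))"
    have "length (filter (\<lambda>d. X \<le> d) (ds @ [d])) + card (comp_of \<alpha>' ` large_sites G X)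
        \<le> 2 * length (filter (\<lambda>g. X \<le> 2 * scale g) G)" if X: "0 < X" for X
    proof (cases "X \<le> d")
      case True
      with X merge obtain g1 g2 where g: "g1 \<in> set G" "g2 \<in> set G" "d \<le> 2 * scale g1" "d \<le> 2 * scale g2"
        "\<not> conn (\<lambda>e. 0 < \<alpha> e) (site g1) (site g2)" "conn (\<lambda>e. 0 < \<alpha>' e) (site g1) (site g2)"
        by auto
      \<comment> \<open>The merged centres may have scale as small as \<open>d / 2\<close>; this is
        why centres are counted by \<open>X \<le> 2 * scale g\<close> but steps by
        \<open>X \<le> d\<close>.\<close>
      have "site g1 \<in> large_sites G X" "site g2 \<in> large_sites G X"
        using g True by (auto simp: large_sites_def intro: le_trans)
      then have "card (comp_of \<alpha>' ` large_sites G X) < card (comp_of \<alpha> ` large_sites G X)"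
        by (rule card_comp_of_less[OF pos fin _ _ g(5,6)])
      then show ?thesis using count[OF X] True by simp
    next
      case False
      then show ?thesis using count[OF X] le[of X] by simp
    qed
    then have 9: "\<forall>X>0. length (filter (\<lambda>d. X \<le> d) (ds @ [d])) + card (comp_of \<alpha>' ` large_sites G X)
        \<le> 2 * length (filter (\<lambda>g. X \<le> 2 * scale g) G)" by blast
    have 6: "\<forall>g\<in>set G. valid_centre g \<and> (\<forall>e<m. 0 < bought g e \<longrightarrow> 0 < \<alpha>' e) \<and>
        (\<forall>(i, j)\<in>demands - insert (s, t) D. R i j \<le> rq g) \<and> scale g \<le> \<sigma> (site g)"
      using old I by simp
    have 7: "disjoint_balls G" and 8: "\<forall>v. 0 < \<sigma> v \<longrightarrow> (\<exists>g\<in>set G. site g = v \<and> scale g = \<sigma> v)"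
      using I by simp_all
    show ?thesis unfolding ghost_invariant_def G by (intro conjI 1 2 3 4 5 6 7 8 9)
  next
    fix v w
    let ?g = "Centre v w ?r \<alpha> d"
    assume G: "G' = G @ [?g]" "\<sigma>' = \<sigma>(v := d)" and d: "0 < d" and valid: "valid_centre ?g"
      and far: "\<forall>g\<in>set G. d \<le> 2 * scale g \<longrightarrow>
              (\<forall>k L. walk (len \<alpha> ?r) (site g) k v L \<longrightarrow> d \<le> 2 * L)"
    \<comment> \<open>A centre of scale at least \<open>d / 2\<close> at \<open>v\<close> itself
      would have distance 0 and contradict \<open>far\<close>. Hence overwriting
      \<open>\<sigma> v\<close> by \<open>d\<close> never lowers it.\<close>
    have own: "2 * scale g < d" if "g \<in> set G" "site g = v" for g
    proof (rule ccontr)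
      assume "\<not> 2 * scale g < d"
      then have "d \<le> 2 * 0" using far that walk_0[of "len \<alpha> ?r" v] by fastforce
      with d show False by simp
    qed
    have 6: "\<forall>g\<in>set G'. valid_centre g \<and> (\<forall>e<m. 0 < bought g e \<longrightarrow> 0 < \<alpha>' e) \<and>
        (\<forall>(i, j)\<in>demands - insert (s, t) D. R i j \<le> rq g) \<and> scale g \<le> \<sigma>' (site g)"
    proof
      fix g assume "g \<in> set G'"
      then consider "g = ?g" | "g \<in> set G" by (auto simp: G)
      then show "valid_centre g \<and> (\<forall>e<m. 0 < bought g e \<longrightarrow> 0 < \<alpha>' e) \<and>
        (\<forall>(i, j)\<in>demands - insert (s, t) D. R i j \<le> rq g) \<and> scale g \<le> \<sigma>' (site g)"
      proof cases
        case 1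
        then show ?thesis using valid pos max by (auto simp: G)
      next
        case 2
        have "scale g \<le> \<sigma>' (site g)"
        proof (cases "site g = v")
          case True
          then show ?thesis using own[OF 2] by (simp add: G)
        next
          case False
          then show ?thesis using I 2 by (simp add: G)
        qed
        then show ?thesis using old 2 by blast
      qed
    qed
    have 7: "disjoint_balls G'"
      unfolding disjoint_balls_def
    proof (intro allI impI; elim conjE)
      fix i j X
      assume j: "j < length G'" and i: "i < j"
        and X: "X \<le> 2 * scale (G' ! i)" "2 * scale (G' ! i) < 2 * X"
          "X \<le> 2 * scale (G' ! j)" "2 * scale (G' ! j) < 2 * X"
      show "ball (G' ! i) X \<inter> ball (G' ! j) X = {}"
      proof (cases "j < length G")
        case True
        then show ?thesis using I i X unfolding disjoint_balls_def by (auto simp: G nth_append)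
      next
        case False
        then have ji: "G' ! j = ?g" "G' ! i = G ! i" "G ! i \<in> set G"
          using i j by (auto simp: G nth_append)
        show ?thesis
        proof (rule ccontr)
          assume "\<not> ?thesis"
          then obtain k1 L1 k2 L2 y where
            y: "walk (clen (G ! i)) (site (G ! i)) k1 y L1" "8 * L1 < X"
              "walk (len \<alpha> ?r) v k2 y L2" "8 * L2 < X"
            using ji by (auto simp: ball_def clen_def)
          have "?r \<le> rq (G ! i)" using I ji(3) st by fastforce
          then have "len \<alpha> ?r e \<le> clen (G ! i) e" if "e < m" for e
            unfolding clen_def using I ji(3) that by (intro len_le) auto
          then obtain L0 where L0: "L0 \<le> L1" "walk (len \<alpha> ?r) (site (G ! i)) k1 y L0"
            using walk_mono[OF y(1), of "len \<alpha> ?r"] by blast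
          have "walk (len \<alpha> ?r) (site (G ! i)) (k1 + k2) v (L0 + L2)"
            using walk_append[OF walk_sym[OF y(3)] L0(2)] .
          \<comment> \<open>Both scales belong to one class, so
            \<open>d < X \<le> 2 * scale (G ! i)\<close> and \<open>far\<close> applies to the
            earlier centre. A common point of the balls would put the centres at distance below
            \<open>X / 4\<close>, which is at most \<open>d / 2\<close>.\<close>
          moreover have "d \<le> 2 * scale (G ! i)" using X ji by simp
          ultimately have "d \<le> 2 * (L0 + L2)" using far ji(3) by blast
          then show False using y(2,4) L0(1) X(3) ji(1) by simp
        qed
      qed
    qed
    have 8: "\<forall>x. 0 < \<sigma>' x \<longrightarrow> (\<exists>g\<in>set G'. site g = x \<and> scale g = \<sigma>' x)"
      using I by (auto simp: G)
    have "length (filter (\<lambda>d. X \<le> d) (ds @ [d])) + card (comp_of \<alpha>' ` large_sites G' X)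
        \<le> 2 * length (filter (\<lambda>g. X \<le> 2 * scale g) G')" if X: "0 < X" for X
    proof (cases "X \<le> 2 * d")
      case True
      have "large_sites G' X = insert v (large_sites G X)"
        using True unfolding large_sites_def G
        by (auto intro: image_eqI[of _ site "Centre v w ?r \<alpha> d"])
      then have "card (comp_of \<alpha>' ` large_sites G' X) \<le> Suc (card (comp_of \<alpha>' ` large_sites G X))"
        using card_insert_le_m1 fin[of X] by (simp add: card_insert_if)
      then show ?thesis using count[OF X] le[of X] True by (simp add: G)
    next
      case False
      have "large_sites G' X = large_sites G X"
        using False by (auto simp: large_sites_def G)
      then show ?thesis using count[OF X] le[of X] False by (simp add: G)
    qed
    then have 9: "\<forall>X>0. length (filter (\<lambda>d. X \<le> d) (ds @ [d])) + card (comp_of \<alpha>' ` large_sites G' X)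
        \<le> 2 * length (filter (\<lambda>g. X \<le> 2 * scale g) G')" by blast
    show ?thesis unfolding ghost_invariant_def by (intro conjI 1 2 3 4 5 6 7 8 9)
  qed
qed

text \<open>A centre of scale at least \<open>d / 2\<close> at \<open>x\<close>, at distance less
  than \<open>d / 2\<close> from \<open>v\<close>. Vertices without a centre have
  \<open>\<sigma> x = 0\<close> and are ruled out when \<open>d\<close> is positive.\<close>

definition near :: "(nat \<Rightarrow> nat) \<Rightarrow> (nat \<Rightarrow> nat) \<Rightarrow> nat \<Rightarrow> nat \<Rightarrow> nat \<Rightarrow> nat \<Rightarrow> bool" where
  "near \<alpha> \<sigma> r d v x \<longleftrightarrow> d \<le> 2 * \<sigma> x \<and> (\<exists>k L. walk (len \<alpha> r) v k x L \<and> 2 * L < d)"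

text \<open>Distance 0 need not mean that bought edges already connect \<open>s\<close> and
  \<open>t\<close>: edges of cost 0 may still have to be bought. The step changes no count of long
  steps, since only positive thresholds occur.\<close>

lemma greedy_step_zero:
  assumes "greedy_invariant \<alpha> \<sigma> D" "(s, t) \<in> demands - D"
    "\<And>i j. (i, j) \<in> demands - D \<Longrightarrow> R i j \<le> R s t"
    "buys (R s t) \<alpha> \<alpha>'" "cost \<alpha>' \<le> cost \<alpha>" "conn (\<lambda>e. 0 < \<alpha>' e) s t"
  shows "greedy_invariant \<alpha>' \<sigma> (insert (s, t) D)"
proof -
  from assms(1) obtain G ds where "ghost_invariant \<alpha> \<sigma> D G ds"
    by (auto simp: greedy_invariant_def)
  from ghost_invariant_step[OF this assms(2,3,4) _ assms(6), of 0 G \<sigma>] assms(5)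
  show ?thesis by (auto simp: greedy_invariant_def)
qed

lemma greedy_step_centre:
  assumes "greedy_invariant \<alpha> \<sigma> D" "(s, t) \<in> demands - D"
    "\<And>i j. (i, j) \<in> demands - D \<Longrightarrow> R i j \<le> R s t"
    "buys (R s t) \<alpha> \<alpha>'" "cost \<alpha>' \<le> cost \<alpha> + 2 * d" "conn (\<lambda>e. 0 < \<alpha>' e) s t"
    and "0 < d" and dist: "\<And>k L. walk (len \<alpha> (R s t)) s k t L \<Longrightarrow> d \<le> L"
    and v: "v = s \<or> v = t" and far: "\<And>x. \<not> near \<alpha> \<sigma> (R s t) d v x"
  shows "greedy_invariant \<alpha>' (\<sigma>(v := d)) (insert (s, t) D)"
proof -
  from assms(1) obtain G ds where G: "ghost_invariant \<alpha> \<sigma> D G ds"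
    by (auto simp: greedy_invariant_def)
  define w where "w = (if v = s then t else s)"
  have "valid_centre (Centre v w (R s t) \<alpha> d)"
    using v dist assms(2) dist[OF walk_sym]
    by (auto simp: valid_centre_def w_def clen_def)
  moreover have "d \<le> 2 * L" if "g \<in> set G" "d \<le> 2 * scale g" "walk (len \<alpha> (R s t)) (site g) k v L" for g k L
  proof -
    have "scale g \<le> \<sigma> (site g)" using G that(1) by (simp add: ghost_invariant_def)
    then have "d \<le> 2 * \<sigma> (site g)" using that(2) by simp
    then show ?thesis using far[of "site g"] walk_sym[OF that(3)] by (auto simp: near_def not_less)
  qed
  ultimately show ?thesis
    using ghost_invariant_step[OF G assms(2,3,4,5,6), of "G @ [Centre v w (R s t) \<alpha> d]" "\<sigma>(v := d)"] assms(7)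
    unfolding greedy_invariant_def by blast
qed

text \<open>Before the step \<open>x\<close> and \<open>y\<close> lie in different components: a
  connection by bought edges has length 0 and would yield a walk between \<open>s\<close> and
  \<open>t\<close> shorter than \<open>d / 2 + d / 2\<close>. Afterwards the path and the two links
  join them.\<close>

lemma greedy_step_merge:
  assumes "greedy_invariant \<alpha> \<sigma> D" "(s, t) \<in> demands - D"
    "\<And>i j. (i, j) \<in> demands - D \<Longrightarrow> R i j \<le> R s t"
    "buys (R s t) \<alpha> \<alpha>'" "cost \<alpha>' \<le> cost \<alpha> + 2 * d" "conn (\<lambda>e. 0 < \<alpha>' e) s t"
    and "0 < d" and dist: "\<And>k L. walk (len \<alpha> (R s t)) s k t L \<Longrightarrow> d \<le> L"
    and near: "near \<alpha> \<sigma> (R s t) d s x" "near \<alpha> \<sigma> (R s t) d t y"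
    and conn: "conn (\<lambda>e. 0 < \<alpha>' e) s x" "conn (\<lambda>e. 0 < \<alpha>' e) t y"
  shows "greedy_invariant \<alpha>' \<sigma> (insert (s, t) D)"
proof -
  from assms(1) obtain G ds where G: "ghost_invariant \<alpha> \<sigma> D G ds"
    by (auto simp: greedy_invariant_def)
  have centre: "\<exists>g\<in>set G. site g = z \<and> d \<le> 2 * scale g" if "d \<le> 2 * \<sigma> z" for z
    using G that assms(7) unfolding ghost_invariant_def by (metis gr_zeroI mult_0_right not_less)
  obtain g1 g2 where g: "g1 \<in> set G" "site g1 = x" "d \<le> 2 * scale g1"
      "g2 \<in> set G" "site g2 = y" "d \<le> 2 * scale g2"
    using centre near unfolding near_def by metis
  have "\<not> conn (\<lambda>e. 0 < \<alpha> e) x y"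
  proof
    assume "conn (\<lambda>e. 0 < \<alpha> e) x y"
    then obtain k0 where k0: "walk (len \<alpha> (R s t)) x k0 y 0" using conn_imp_walk by blast
    obtain k1 L1 k2 L2 where w: "walk (len \<alpha> (R s t)) s k1 x L1" "2 * L1 < d"
      "walk (len \<alpha> (R s t)) t k2 y L2" "2 * L2 < d" using near by (auto simp: near_def)
    from dist[OF walk_append[OF walk_sym[OF w(3)] walk_append[OF k0 w(1)]]] w(2,4)
    show False by simp
  qed
  moreover have "conn (\<lambda>e. 0 < \<alpha>' e) x y"
    using conn assms(6) conn_sym conn_trans by blast
  ultimately show ?thesis
    using ghost_invariant_step[OF G assms(2,3,4,5,6), of G \<sigma>] g
    unfolding greedy_invariant_def by blast
qed

text \<open>Each demand is connected by edges of sufficient capacity, so one edge across a cut is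
  enough. For the ratio, at most twice as many steps as large centres have distance at least
  \<open>X\<close>, which turns 128 into 256; the factor 2 between cost and total distance gives
  512.\<close>

lemma greedy_result:
  assumes "greedy_invariant \<alpha> \<sigma> demands"
  shows "satisfies \<alpha>"
    and "satisfies \<beta> \<Longrightarrow> real (cost \<alpha>) \<le> 512 * (1 + ln (real (card demands))) * real (cost \<beta>)"
proof -
  from assms obtain G ds where G: "ghost_invariant \<alpha> \<sigma> demands G ds"
    by (auto simp: greedy_invariant_def)
  note I = G[unfolded ghost_invariant_def]
  show "satisfies \<alpha>"
    unfolding satisfies_def
  proof (clarify)
    fix i j S assume ij: "(i, j) \<in> demands" and S: "(i \<in> S) \<noteq> (j \<in> S)"
    have *: "conn (\<lambda>e. R i j \<le> \<alpha> e * u e) i j" using I ij by fastforce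
    have "conn (\<lambda>e. R i j \<le> \<alpha> e * u e) j i" by (rule conn_sym[OF *])
    with * have "\<exists>e<m. R i j \<le> \<alpha> e * u e \<and> (a e \<in> S) \<noteq> (b e \<in> S)"
      using S conn_crossing[of "\<lambda>e. R i j \<le> \<alpha> e * u e" _ _ S] by (cases "i \<in> S") simp_all
    then obtain e where e: "e < m" "R i j \<le> \<alpha> e * u e" "(a e \<in> S) \<noteq> (b e \<in> S)" by blast
    have "\<alpha> e * u e \<le> cut (\<lambda>e. \<alpha> e * u e) S"
      unfolding cut_def by (rule member_le_sum) (use e in auto)
    with e(2) show "R i j \<le> cut (\<lambda>e. \<alpha> e * u e) S" by simp
  qed
  assume \<beta>: "satisfies \<beta>"
  have "length (filter (\<lambda>d. X \<le> d) ds) * X \<le> 256 * cost \<beta>" if "0 < X" for X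
  proof -
    have "length (filter (\<lambda>d. X \<le> d) ds) \<le> 2 * length (filter (\<lambda>g. X \<le> 2 * scale g) G)"
      using I that by (meson add_leD1)
    then have "length (filter (\<lambda>d. X \<le> d) ds) * X \<le> 2 * length (filter (\<lambda>g. X \<le> 2 * scale g) G) * X"
      by (rule mult_le_mono1)
    also have "\<dots> \<le> 2 * (128 * cost \<beta>)"
      using large_centres_bound[OF \<beta>, of G X] I that by (simp add: ac_simps)
    finally show ?thesis by simp
  qed
  then have "real (length (filter (\<lambda>d. X \<le> d) ds)) * real X \<le> 256 * real (cost \<beta>)" if "0 < X" for X
    using that by (metis of_nat_le_iff of_nat_mult of_nat_numeral)
  then have "real (sum_list ds) \<le> 256 * real (cost \<beta>) * (\<Sum>i=1..length ds. 1 / real i)"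
    by (rule sum_list_le_harmonic) simp_all
  also have "\<dots> \<le> 256 * real (cost \<beta>) * (1 + ln (real (card demands)))"
    using harmonic_le[of "length ds"] I by (intro mult_left_mono) simp_all
  finally have "real (sum_list ds) \<le> 256 * real (cost \<beta>) * (1 + ln (real (card demands)))" .
  moreover have "cost \<alpha> \<le> 2 * sum_list ds" using I by (elim conjE)
  then have "real (cost \<alpha>) \<le> 2 * real (sum_list ds)" by linarith
  ultimately show "real (cost \<alpha>) \<le> 512 * (1 + ln (real (card demands))) * real (cost \<beta>)"
    by (simp add: algebra_simps)
qed

end

section \<open>The program\<close>

text \<open>
  Array 1 holds the copies bought (shifted by one), 3 the integral costs, 4 the processed demands,
  5 the scales of the centres, 6 the edge lengths. Row \<open>k\<close> of the table 7 holds the distances from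
  cell 25 over at most \<open>k\<close> edges, increased by one so that 0 stands for infinity; 8 and 9 hold the
  last edge (increased by one, 0 if the row above is copied) and the last but one vertex.
  Cell 10 is the current edge and 21 the input cell of the selected requirement 24, whose endpoints
  are 22 and 23; 28 is their distance, and 29 and 30 are centres near them (increased by one).
\<close>

abbreviation var :: "nat \<Rightarrow> exp" where "var x \<equiv> Get x (Num 0)"

abbreviation set_var :: "nat \<Rightarrow> exp \<Rightarrow> fcom" where "set_var x e \<equiv> FAssign x (Num 0) e"

abbreviation field :: "nat \<Rightarrow> exp" where
  "field k \<equiv> Get 0 (Plus (Num k) (Times (var 10) (Num 5)))"

abbreviation cell :: "exp \<Rightarrow> exp \<Rightarrow> exp" where
  "cell k x \<equiv> Plus (Times k (Get 0 (Num 1))) x"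

abbreviation copies_exp :: exp where
  "copies_exp \<equiv> Div (Minus (Plus (Get 0 (var 21)) (field 7)) (Num 1)) (field 7)"

definition set_lengths :: fcom where
  "set_lengths = FFor 10 2
     (FIf (Get 1 (Plus (var 10) (Num 1)))
        (FAssign 6 (var 10) (Num 0))
        (FAssign 6 (var 10) (Times (Get 3 (var 10)) copies_exp)))"

text \<open>A sum of truncated differences expresses a disjunction: it is nonzero iff the entry in
  the new row is 0, which stands for infinity, or exceeds the candidate. The candidate inherits the
  shift by one from the previous row.\<close>

definition relax :: "exp \<Rightarrow> exp \<Rightarrow> fcom" where
  "relax x y =
     FIf (Get 7 (cell (var 12) x))
       (FIf (Plus (Minus (Num 1) (Get 7 (cell (Plus (var 12) (Num 1)) y)))
               (Minus (Get 7 (cell (Plus (var 12) (Num 1)) y))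
                  (Plus (Get 7 (cell (var 12) x)) (Get 6 (var 10)))))
          (FSeq (FAssign 7 (cell (Plus (var 12) (Num 1)) y) (Plus (Get 7 (cell (var 12) x)) (Get 6 (var 10))))
          (FSeq (FAssign 8 (cell (Plus (var 12) (Num 1)) y) (Plus (var 10) (Num 1)))
                (FAssign 9 (cell (Plus (var 12) (Num 1)) y) x)))
          FSkip)
       FSkip"

definition copy_row :: fcom where
  "copy_row = FFor 11 1
     (FSeq (FAssign 7 (cell (Plus (var 12) (Num 1)) (var 11)) (Get 7 (cell (var 12) (var 11))))
           (FAssign 8 (cell (Plus (var 12) (Num 1)) (var 11)) (Num 0)))"

definition relax_edges :: fcom where
  "relax_edges = FFor 10 2 (FSeq (relax (field 3) (field 4)) (relax (field 4) (field 3)))"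

definition distances :: fcom where
  "distances =
     FSeq set_lengths
    (FSeq (FFor 11 1 (FAssign 7 (var 11) (Num 0)))
    (FSeq (FAssign 7 (var 25) (Num 1))
          (FFor 12 1 (FSeq copy_row relax_edges))))"

text \<open>Backtracking takes one round per row, and copied entries are passed without moving.
  Edges already bought are left alone.\<close>

definition buy_path :: fcom where
  "buy_path =
     FSeq (set_var 27 (var 26))
          (FFor 12 1
             (FSeq (set_var 31 (cell (Minus (Get 0 (Num 1)) (var 12)) (var 27)))
                   (FIf (Get 8 (var 31))
                      (FSeq (set_var 10 (Minus (Get 8 (var 31)) (Num 1)))
                      (FSeq (FIf (Get 1 (Plus (var 10) (Num 1))) FSkip
                               (FAssign 1 (Plus (var 10) (Num 1)) copies_exp))
                            (set_var 27 (Get 9 (var 31)))))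
                      FSkip)))"

definition connect :: "exp \<Rightarrow> exp \<Rightarrow> fcom" where
  "connect x y = FSeq (set_var 25 x) (FSeq (set_var 26 y) (FSeq distances buy_path))"

text \<open>The nested tests are: finite distance, twice the distance below cell 28, and twice the
  scale at least cell 28, the last through the zero branch. Any such vertex will do; the last one
  found is kept.\<close>

definition find_near :: "nat \<Rightarrow> fcom" where
  "find_near w =
     FSeq (set_var w (Num 0))
          (FFor 11 1
             (FIf (Get 7 (cell (Get 0 (Num 1)) (var 11)))
               (FIf (Minus (var 28) (Times (Minus (Get 7 (cell (Get 0 (Num 1)) (var 11))) (Num 1)) (Num 2)))
                 (FIf (Minus (var 28) (Times (Get 5 (var 11)) (Num 2)))
                    FSkip
                    (set_var w (Plus (var 11) (Num 1))))
                 FSkip)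
               FSkip))"

text \<open>Requirements are stored only for pairs with first index below the second, so the pointer
  in cell 20 moves only then. The comparison with cell 24 is strict and starts from 0, hence a zero
  requirement is never selected.\<close>

definition select_body :: fcom where
  "select_body =
     FIf (Minus (var 14) (var 13))
       (FSeq (FIf (Get 4 (var 20)) FSkip
                (FIf (Minus (Get 0 (var 20)) (var 24))
                   (FSeq (set_var 21 (var 20)) (FSeq (set_var 22 (var 13))
                   (FSeq (set_var 23 (var 14)) (set_var 24 (Get 0 (var 20))))))
                   FSkip))
             (set_var 20 (Plus (var 20) (Num 1))))
       FSkip"

definition select :: fcom where
  "select =
     FSeq (set_var 24 (Num 0))
    (FSeq (set_var 20 (Plus (Num 3) (Times (Get 0 (Num 2)) (Num 5))))
          (FFor 14 1 (FFor 13 1 select_body)))"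

text \<open>On entry the table holds the distances from cell 22, which the first search reads. Only
  the two links are bought here; the path of the demand itself follows in
  \<open>process\<close>.\<close>

definition add_centres :: fcom where
  "add_centres =
     FSeq (find_near 29)
    (FSeq (set_var 25 (var 23))
    (FSeq distances
    (FSeq (find_near 30)
          (FIf (var 29)
             (FIf (var 30)
                (FSeq (connect (var 22) (Minus (var 29) (Num 1)))
                      (connect (var 23) (Minus (var 30) (Num 1))))
                (FAssign 5 (var 23) (var 28)))
             (FAssign 5 (var 22) (var 28))))))"

definition process :: fcom where
  "process =
     FSeq (FAssign 4 (var 21) (Num 1))
    (FSeq (set_var 25 (var 22))
    (FSeq distances
    (FSeq (set_var 28 (Minus (Get 7 (cell (Get 0 (Num 1)) (var 23))) (Num 1)))
    (FSeq (FIf (var 28) add_centres FSkip)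
          (connect (var 22) (var 23))))))"

definition step :: fcom where
  "step = FSeq select (FIf (var 24) process FSkip)"

text \<open>Trip counts are restricted to the two sizes in the input, so the number of demands is
  overestimated by two nested loops with \<open>n * n\<close> steps. Surplus steps buy
  nothing.\<close>

definition greedy :: fcom where
  "greedy =
     FSeq (set_var 1 (Get 0 (Num 2)))
    (FSeq (set_var 2 (Num 1))
    (FSeq (FFor 10 2 (set_var 2 (Times (var 2) (field 6))))
    (FSeq (FFor 10 2 (FAssign 3 (var 10) (Times (Div (var 2) (field 6)) (field 5))))
          (FFor 15 1 (FFor 16 1 step)))))"

lemmas program_defs = greedy_def step_def process_def add_centres_def select_def select_body_def
  find_near_def connect_def buy_path_def distances_def relax_edges_def copy_row_def relax_def
  set_lengths_def

text \<open>Every product is written with the factor controlled by the input second: a field of an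
  edge, the number of vertices, a constant, or the number of copies.\<close>

lemma ok_greedy: "ok greedy"
  by (simp add: program_defs)

lemmas fexec_For = fexec.simps(5)
declare fexec_For [simp del]

context network
begin

text \<open>
  The tables are functions on \<open>k * n + y\<close> for row \<open>k\<close> and column \<open>y\<close>.
\<close>

definition traced :: "(nat \<Rightarrow> nat) \<Rightarrow> nat \<Rightarrow> (nat \<Rightarrow> nat) \<Rightarrow> (nat \<Rightarrow> nat) \<Rightarrow> (nat \<Rightarrow> nat) \<Rightarrow> nat \<Rightarrow> nat \<Rightarrow> bool" where
  "traced l x T PE PV k y \<longleftrightarrow>
     (case k of 0 \<Rightarrow> y = x \<and> T y = 1
      | Suc k' \<Rightarrow>
          (PE (k * n + y) = 0 \<and> T (k' * n + y) = T (k * n + y)) \<or>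
          (\<exists>e<m. PE (k * n + y) = Suc e \<and> joins e (PV (k * n + y)) y \<and> T (k' * n + PV (k * n + y)) \<noteq> 0 \<and>
             T (k' * n + PV (k * n + y)) + l e = T (k * n + y)))"

text \<open>Completeness is stated for walks with at most \<open>k\<close> edges. Soundness is kept
  as one predecessor per nonzero entry, from which a walk of exactly the recorded length is
  recovered row by row.\<close>

definition rows_correct :: "(nat \<Rightarrow> nat) \<Rightarrow> nat \<Rightarrow> (nat \<Rightarrow> nat) \<Rightarrow> (nat \<Rightarrow> nat) \<Rightarrow> (nat \<Rightarrow> nat) \<Rightarrow> nat \<Rightarrow> bool" where
  "rows_correct l x T PE PV K \<longleftrightarrow> (\<forall>k\<le>K. \<forall>y<n.
     (T (k * n + y) \<noteq> 0 \<longrightarrow> traced l x T PE PV k y) \<and>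
     (\<forall>j\<le>k. \<forall>L. walk l x j y L \<longrightarrow> T (k * n + y) \<noteq> 0 \<and> T (k * n + y) \<le> Suc L))"

definition row_relaxed :: "(nat \<Rightarrow> nat) \<Rightarrow> nat \<Rightarrow> nat \<Rightarrow> (nat \<times> nat \<times> nat) set \<Rightarrow> (nat \<Rightarrow> nat) \<Rightarrow> (nat \<Rightarrow> nat) \<Rightarrow> (nat \<Rightarrow> nat) \<Rightarrow> bool" where
  "row_relaxed l x k J T PE PV \<longleftrightarrow>
     (\<forall>y<n. (T (Suc k * n + y) \<noteq> 0 \<longrightarrow> traced l x T PE PV (Suc k) y) \<and>
        (T (k * n + y) \<noteq> 0 \<longrightarrow> T (Suc k * n + y) \<noteq> 0 \<and> T (Suc k * n + y) \<le> T (k * n + y))) \<and>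
     (\<forall>(e, p, q)\<in>J. T (k * n + p) \<noteq> 0 \<longrightarrow>
        T (Suc k * n + q) \<noteq> 0 \<and> T (Suc k * n + q) \<le> T (k * n + p) + l e)"

section \<open>The distance table, row by row\<close>

lemma cell_less: "y < n \<Longrightarrow> k \<le> K \<Longrightarrow> k * n + y < Suc K * n"
  unfolding mult_Suc using mult_le_mono1[of k K n] by linarith

text \<open>Row \<open>K + 1\<close> can be written without disturbing the rows up to
  \<open>K\<close>: predecessors are vertices below \<open>n\<close>, so all cells consulted have an
  index below \<open>Suc K * n\<close>.\<close>

lemma rows_correct_cong:
  assumes "rows_correct l x T PE PV K"
    and eq: "\<And>i. i < Suc K * n \<Longrightarrow> T' i = T i \<and> PE' i = PE i \<and> PV' i = PV i"
  shows "rows_correct l x T' PE' PV' K"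
proof -
  have "T' (k * n + y) = T (k * n + y) \<and> traced l x T' PE' PV' k y = traced l x T PE PV k y"
    if ky: "k \<le> K" "y < n" for k y
  proof -
    have 1: "T' (j * n + z) = T (j * n + z)" "PE' (j * n + z) = PE (j * n + z)"
        "PV' (j * n + z) = PV (j * n + z)" if "j \<le> K" "z < n" for j z
      using eq[OF cell_less[OF that(2,1)]] by simp_all
    show ?thesis
    proof (cases k)
      case 0
      then show ?thesis using 1[of 0 y] ky by (simp add: traced_def)
    next
      case (Suc k')
      have 2: "z < n" if "joins e z y" "e < m" for e z
        using joins_less[OF joins_sym] that by blast
      have "traced l x T' PE' PV' k y = traced l x T PE PV k y"
        using 1[of k' y] 1[of k y] 1[of k' "PV (k * n + y)"] 2 ky Suc
        unfolding traced_def by auto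
      then show ?thesis using 1[OF ky] by simp
    qed
  qed
  with assms(1) show ?thesis unfolding rows_correct_def by metis
qed

lemma rows_correct_Suc:
  assumes rows: "rows_correct l x T PE PV k" and less: "x < n"
    and relaxed: "row_relaxed l x k J T PE PV"
    and J: "\<And>e p q. e < m \<Longrightarrow> joins e p q \<Longrightarrow> (e, p, q) \<in> J"
  shows "rows_correct l x T PE PV (Suc k)"
proof -
  have "T (Suc k * n + y) \<noteq> 0 \<and> T (Suc k * n + y) \<le> Suc L"
    if "walk l x j y L" "j \<le> Suc k" "y < n" for j y L
  proof (cases "j \<le> k")
    case True
    then have "T (k * n + y) \<noteq> 0 \<and> T (k * n + y) \<le> Suc L"
      using rows that unfolding rows_correct_def by blast
    with relaxed that(3) show ?thesis unfolding row_relaxed_def by fastforce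
  next
    case False
    with that(1,2) obtain z e L' where z: "walk l x k z L'" "e < m" "joins e z y" "L = L' + l e"
      by (cases rule: walk.cases) (auto simp: le_Suc_eq)
    have "z < n" using walk_less[OF z(1) less] .
    then have "T (k * n + z) \<noteq> 0 \<and> T (k * n + z) \<le> Suc L'"
      using rows z(1) unfolding rows_correct_def by blast
    moreover have "T (k * n + z) \<noteq> 0 \<longrightarrow> T (Suc k * n + y) \<noteq> 0 \<and> T (Suc k * n + y) \<le> T (k * n + z) + l e"
      using relaxed J[OF z(2,3)] unfolding row_relaxed_def by blast
    ultimately show ?thesis using z(4) by linarith
  qed
  note complete = this
  have "T (Suc k * n + y) \<noteq> 0 \<longrightarrow> traced l x T PE PV (Suc k) y" if "y < n" for y
    using relaxed that unfolding row_relaxed_def by blast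
  with complete show ?thesis
    using rows unfolding rows_correct_def by (metis le_SucE)
qed

lemma row_relaxed_step:
  assumes rel: "row_relaxed l x k J T PE PV" and e: "e < m" "joins e p q"
    and J: "\<forall>(e, p, q)\<in>J. p < n \<and> q < n"
    and new: "T (k * n + p) \<noteq> 0" "T (Suc k * n + q) = 0 \<or> T (k * n + p) + l e < T (Suc k * n + q)"
  shows "row_relaxed l x k (insert (e, p, q) J)
    (T(Suc k * n + q := T (k * n + p) + l e)) (PE(Suc k * n + q := Suc e)) (PV(Suc k * n + q := p))"
proof -
  let ?T = "T(Suc k * n + q := T (k * n + p) + l e)"
  have less: "p < n" "q < n" using joins_less[OF joins_sym] joins_less e by blast+
  have low: "?T (k * n + y) = T (k * n + y)" if "y < n" for y
    using that by simp
  have up: "?T (Suc k * n + y) \<noteq> 0 \<and> ?T (Suc k * n + y) \<le> X"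
    if "T (Suc k * n + y) \<noteq> 0 \<and> T (Suc k * n + y) \<le> X" "y < n" for y X
    using that new by auto
  have "?T (Suc k * n + y) \<noteq> 0 \<longrightarrow>
      traced l x ?T (PE(Suc k * n + q := Suc e)) (PV(Suc k * n + q := p)) (Suc k) y" if y: "y < n" for y
  proof (cases "y = q")
    case True
    then show ?thesis using e new low[OF less(1)] by (simp add: traced_def)
  next
    case False
    have same: "?T (Suc k * n + y) = T (Suc k * n + y)"
      "(PE(Suc k * n + q := Suc e)) (Suc k * n + y) = PE (Suc k * n + y)"
      "(PV(Suc k * n + q := p)) (Suc k * n + y) = PV (Suc k * n + y)"
      using False by simp_all
    have z: "?T (k * n + PV (Suc k * n + y)) = T (k * n + PV (Suc k * n + y))"
      if "joins e' (PV (Suc k * n + y)) y" "e' < m" for e'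
      by (rule low, rule joins_less[OF joins_sym]) (use that in auto)
    have "T (Suc k * n + y) \<noteq> 0 \<longrightarrow> traced l x T PE PV (Suc k) y"
      using rel y unfolding row_relaxed_def by blast
    then show ?thesis
      unfolding traced_def nat.case same low[OF y] using z by metis
  qed
  moreover have "?T (k * n + y) \<noteq> 0 \<longrightarrow> ?T (Suc k * n + y) \<noteq> 0 \<and> ?T (Suc k * n + y) \<le> ?T (k * n + y)"
    if y: "y < n" for y
  proof (simp only: low[OF y], intro impI)
    assume "T (k * n + y) \<noteq> 0"
    then have "T (Suc k * n + y) \<noteq> 0 \<and> T (Suc k * n + y) \<le> T (k * n + y)"
      using rel y unfolding row_relaxed_def by blast
    then show "?T (Suc k * n + y) \<noteq> 0 \<and> ?T (Suc k * n + y) \<le> T (k * n + y)"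
      using y by (rule up)
  qed
  moreover have "?T (k * n + p') \<noteq> 0 \<longrightarrow>
        ?T (Suc k * n + q') \<noteq> 0 \<and> ?T (Suc k * n + q') \<le> ?T (k * n + p') + l e'"
    if mem: "(e', p', q') \<in> insert (e, p, q) J" for e' p' q'
  proof (cases "(e', p', q') = (e, p, q)")
    case True
    then show ?thesis using low[OF less(1)] new by simp
  next
    case False
    then have "(e', p', q') \<in> J" using mem by blast
    then have "T (k * n + p') \<noteq> 0 \<longrightarrow>
      T (Suc k * n + q') \<noteq> 0 \<and> T (Suc k * n + q') \<le> T (k * n + p') + l e'" "p' < n" "q' < n"
      using rel J unfolding row_relaxed_def by blast+
    then show ?thesis using up[of q'] low[of p'] by auto
  qed
  ultimately show ?thesis unfolding row_relaxed_def by blast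
qed

lemma row_relaxed_skip:
  assumes rel: "row_relaxed l x k J T PE PV"
    and "T (k * n + p) = 0 \<or> T (Suc k * n + q) \<noteq> 0 \<and> T (Suc k * n + q) \<le> T (k * n + p) + l e"
  shows "row_relaxed l x k (insert (e, p, q) J) T PE PV"
  using assms unfolding row_relaxed_def by auto

lemma rows_correct_sound:
  assumes "rows_correct l x T PE PV K"
  shows "k \<le> K \<Longrightarrow> y < n \<Longrightarrow> T (k * n + y) = Suc L \<Longrightarrow> \<exists>j. walk l x j y L"
proof (induction k arbitrary: y L)
  case 0
  then have "traced l x T PE PV 0 y" using assms unfolding rows_correct_def by force
  with 0 show ?case using walk_0[of l x] by (auto simp: traced_def)
next
  case (Suc k)
  then have "traced l x T PE PV (Suc k) y" using assms unfolding rows_correct_def by force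
  then consider "T (k * n + y) = T (Suc k * n + y)"
    | e where "e < m" "joins e (PV (Suc k * n + y)) y" "T (k * n + PV (Suc k * n + y)) \<noteq> 0"
        "T (k * n + PV (Suc k * n + y)) + l e = T (Suc k * n + y)"
    unfolding traced_def by auto
  then show ?case
  proof cases
    case 1
    then show ?thesis using Suc by simp
  next
    case 2
    define z where "z = PV (Suc k * n + y)"
    have "z < n" using joins_less[OF joins_sym] 2 unfolding z_def by blast
    obtain L' where L': "T (k * n + z) = Suc L'" using 2(3) not0_implies_Suc unfolding z_def by blast
    then obtain j where "walk l x j z L'" using Suc.IH[of z L'] Suc.prems \<open>z < n\<close> by auto
    from walk_Suc[OF this 2(1) 2(2)[folded z_def]] have "walk l x (Suc j) y (L' + l e)" .
    moreover have "L' + l e = L" using L' 2(4) Suc.prems(3) unfolding z_def by simp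
    ultimately show ?thesis by blast
  qed
qed

text \<open>Row \<open>n\<close> already accounts for arbitrary walks, since every walk can be
  replaced by one with at most \<open>n\<close> edges that is no longer.\<close>

lemma rows_correct_complete:
  assumes "rows_correct l x T PE PV n" "x < n" "y < n" "walk l x k y L"
  shows "T (n * n + y) \<noteq> 0 \<and> T (n * n + y) \<le> Suc L"
proof -
  obtain k' L' where "k' \<le> n" "L' \<le> L" "walk l x k' y L'"
    using walk_shorten[OF assms(4,2)] by blast
  with assms(1,3) have "T (n * n + y) \<noteq> 0 \<and> T (n * n + y) \<le> Suc L'"
    unfolding rows_correct_def by blast
  with \<open>L' \<le> L\<close> show ?thesis by simp
qed

end

text \<open>\<open>I\<close> is the content of array 0: two sizes, five cells per edge, then the
  triangular table of requirements. The cost \<open>c e\<close> is the rational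
  \<open>num e / den e\<close> times the product of all denominators; dividing first leaves
  \<open>num e\<close>, an input cell, as the second factor.\<close>

locale encoded_network = network +
  fixes I num den :: "nat \<Rightarrow> nat"
  assumes I_sizes: "I 1 = n" "I 2 = m"
    and I_edges: "e < m \<Longrightarrow> I (3 + e * 5) = a e" "e < m \<Longrightarrow> I (4 + e * 5) = b e"
      "e < m \<Longrightarrow> I (5 + e * 5) = num e" "e < m \<Longrightarrow> I (6 + e * 5) = den e"
      "e < m \<Longrightarrow> I (7 + e * 5) = u e"
    and I_reqs: "i < j \<Longrightarrow> j < n \<Longrightarrow> I (3 + m * 5 + (\<Sum>{..<j} + i)) = R i j"
    and c_eq: "e < m \<Longrightarrow> c e = (\<Prod>e<m. den e) div den e * num e"
begin

definition bought_of :: "store \<Rightarrow> nat \<Rightarrow> nat" where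
  "bought_of s e = s 1 (Suc e)"

definition ready :: "store \<Rightarrow> bool" where
  "ready s \<longleftrightarrow> s 0 = I \<and> (\<forall>e<m. s 3 e = c e)"

section \<open>Correctness of the shortest-path subroutines\<close>

lemma set_lengths_correct:
  assumes "ready s" "e < m"
  shows "fexec set_lengths s 6 e = len (bought_of s) (I (s 21 0)) e"
proof -
  let ?Inv = "\<lambda>i s'. (\<forall>b. b \<notin> {6, 10} \<longrightarrow> s' b = s b) \<and>
    (\<forall>e<i. s' 6 e = len (bought_of s) (I (s 21 0)) e)"
  have "?Inv (s 0 2) (fexec set_lengths s)"
    unfolding set_lengths_def
  proof (rule fexec_For_invariant[where Inv = ?Inv])
    fix i s' assume "i < s 0 2" "?Inv i s'" "s' 10 0 = i"
    then show "?Inv (Suc i) (upd (fexec (FIf (Get 1 (Plus (var 10) (Num 1)))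
        (FAssign 6 (var 10) (Num 0)) (FAssign 6 (var 10) (Times (Get 3 (var 10)) copies_exp))) s') 10 0 (Suc i))"
      using assms I_edges I_sizes
      by (auto simp: ready_def less_Suc_eq len_def bought_of_def copies_def)
  qed auto
  then show ?thesis using assms I_sizes by (simp add: ready_def)
qed

lemma relax_correct:
  assumes s: "s 0 = I" "s 12 0 = k" "s 10 0 = e" "\<forall>e<m. s 6 e = l e"
    and e: "e < m" "joins e p q"
    and xy: "x = field 3 \<and> y = field 4 \<and> p = a e \<and> q = b e \<or>
      x = field 4 \<and> y = field 3 \<and> p = b e \<and> q = a e"
    and rel: "row_relaxed l v k J (s 7) (s 8) (s 9)"
    and J: "\<forall>(e, p, q)\<in>J. p < n \<and> q < n"
    and s': "s' = fexec (relax x y) s"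
  shows "row_relaxed l v k (insert (e, p, q) J) (s' 7) (s' 8) (s' 9)"
    and "\<And>i. i < Suc k * n \<Longrightarrow> s' 7 i = s 7 i \<and> s' 8 i = s 8 i \<and> s' 9 i = s 9 i"
proof -
  \<comment> \<open>The expressions \<open>x\<close> and \<open>y\<close> read only arrays 0 and 10,
    so the assignments to the three tables do not change their values.\<close>
  have xy': "eval_exp x s = p" "eval_exp y s = q"
    "\<And>t. t 0 = s 0 \<Longrightarrow> t 10 = s 10 \<Longrightarrow> eval_exp x t = p \<and> eval_exp y t = q"
    using xy s e I_edges by auto
  let ?new = "s 7 (k * n + p) \<noteq> 0 \<and> (s 7 (Suc k * n + q) = 0 \<or> s 7 (k * n + p) + l e < s 7 (Suc k * n + q))"
  have eff: "s' = (if ?new then upd (upd (upd s 7 (Suc k * n + q) (s 7 (k * n + p) + l e))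
       8 (Suc k * n + q) (Suc e)) 9 (Suc k * n + q) p else s)"
    unfolding s' relax_def using s e xy' I_sizes by (auto simp: mult.commute)
  show "row_relaxed l v k (insert (e, p, q) J) (s' 7) (s' 8) (s' 9)"
  proof (cases ?new)
    case True
    then have "s' 7 = (s 7)(Suc k * n + q := s 7 (k * n + p) + l e)"
      "s' 8 = (s 8)(Suc k * n + q := Suc e)" "s' 9 = (s 9)(Suc k * n + q := p)"
      by (auto simp: eff fun_eq_iff)
    then show ?thesis using row_relaxed_step[OF rel e J conjunct1[OF True] conjunct2[OF True]] by (simp only:)
  next
    case False
    then show ?thesis using row_relaxed_skip[OF rel, of p q e] unfolding eff by auto
  qed
  show "s' 7 i = s 7 i \<and> s' 8 i = s 8 i \<and> s' 9 i = s 9 i" if "i < Suc k * n" for i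
    using that unfolding eff by auto
qed

lemma copy_row_correct:
  assumes s: "s 0 = I" "s 12 0 = k" and s': "s' = fexec copy_row s"
  shows "row_relaxed l v k {} (s' 7) (s' 8) (s' 9)"
    and "\<And>i. i < Suc k * n \<Longrightarrow> s' 7 i = s 7 i \<and> s' 8 i = s 8 i \<and> s' 9 i = s 9 i"
proof -
  let ?Inv = "\<lambda>j s'. (\<forall>b. b \<notin> {7, 8, 11} \<longrightarrow> s' b = s b) \<and>
    (\<forall>i<Suc k * n. s' 7 i = s 7 i \<and> s' 8 i = s 8 i) \<and>
    (\<forall>y<j. s' 7 (Suc k * n + y) = s 7 (k * n + y) \<and> s' 8 (Suc k * n + y) = 0)"
  have "?Inv (s 0 1) s'"
    unfolding s' copy_row_def
  proof (rule fexec_For_invariant[where Inv = ?Inv])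
    fix j s'' assume j: "j < s 0 1" "?Inv j s''" "s'' 11 0 = j"
    then have "j < n" using s I_sizes by simp
    then show "?Inv (Suc j) (upd (fexec (FSeq (FAssign 7 (cell (Plus (var 12) (Num 1)) (var 11)) (Get 7 (cell (var 12) (var 11))))
           (FAssign 8 (cell (Plus (var 12) (Num 1)) (var 11)) (Num 0))) s'') 11 0 (Suc j))"
      using j s I_sizes cell_less[of j k k]
      by (auto simp: less_Suc_eq)
  qed auto
  then have inv: "?Inv n s'" using s I_sizes by simp
  show "s' 7 i = s 7 i \<and> s' 8 i = s 8 i \<and> s' 9 i = s 9 i" if "i < Suc k * n" for i
    using that inv by simp
  show "row_relaxed l v k {} (s' 7) (s' 8) (s' 9)"
    using inv cell_less[of _ k k] unfolding row_relaxed_def traced_def by auto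
qed

lemma relax_edges_correct:
  assumes s: "s 0 = I" "s 12 0 = k" "\<forall>e<m. s 6 e = l e"
    and rel: "row_relaxed l v k {} (s 7) (s 8) (s 9)"
    and s': "s' = fexec relax_edges s"
  shows "row_relaxed l v k {(e, p, q). e < m \<and> joins e p q} (s' 7) (s' 8) (s' 9)"
    and "\<And>i. i < Suc k * n \<Longrightarrow> s' 7 i = s 7 i \<and> s' 8 i = s 8 i \<and> s' 9 i = s 9 i"
proof -
  let ?J = "\<lambda>j. {(e, p, q). e < j \<and> joins e p q}"
  let ?Inv = "\<lambda>j s'. (\<forall>b. b \<notin> {7, 8, 9, 10} \<longrightarrow> s' b = s b) \<and>
    (\<forall>i<Suc k * n. s' 7 i = s 7 i \<and> s' 8 i = s 8 i \<and> s' 9 i = s 9 i) \<and>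
    row_relaxed l v k (?J j) (s' 7) (s' 8) (s' 9)"
  have "?Inv (s 0 2) s'"
    unfolding s' relax_edges_def
  proof (rule fexec_For_invariant[where Inv = ?Inv])
    fix j s1 assume j: "j < s 0 2" "?Inv j s1" "s1 10 0 = j"
    then have jm: "j < m" using s I_sizes by simp
    define s2 where "s2 = fexec (relax (field 3) (field 4)) s1"
    define s3 where "s3 = fexec (relax (field 4) (field 3)) s2"
    have J: "\<forall>(e, p, q)\<in>?J j. p < n \<and> q < n"
      using jm joins_less joins_less[OF joins_sym] by fastforce
    have s1: "s1 0 = I" "s1 12 0 = k" "\<forall>e<m. s1 6 e = l e" using j s by auto
    have fr2: "s2 b = s1 b" if "b \<notin> {7, 8, 9}" for b
      unfolding s2_def using that by (intro fexec_frame) (simp add: relax_def)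
    have fr3: "s3 b = s2 b" if "b \<notin> {7, 8, 9}" for b
      unfolding s3_def using that by (intro fexec_frame) (simp add: relax_def)
    have rel2: "row_relaxed l v k (insert (j, a j, b j) (?J j)) (s2 7) (s2 8) (s2 9)"
      "\<And>i. i < Suc k * n \<Longrightarrow> s2 7 i = s1 7 i \<and> s2 8 i = s1 8 i \<and> s2 9 i = s1 9 i"
      by (rule relax_correct[OF s1(1,2) j(3) s1(3) jm _ _ _ J s2_def, where v = v];
          use j(2) in \<open>simp add: joins_def\<close>)+
    have s2: "s2 0 = I" "s2 12 0 = k" "s2 10 0 = j" "\<forall>e<m. s2 6 e = l e"
      using s1 j(3) fr2 by simp_all
    have J2: "\<forall>(e, p, q)\<in>insert (j, a j, b j) (?J j). p < n \<and> q < n"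
      using J ends_less[OF jm] by simp
    have rel3: "row_relaxed l v k (insert (j, b j, a j) (insert (j, a j, b j) (?J j))) (s3 7) (s3 8) (s3 9)"
      "\<And>i. i < Suc k * n \<Longrightarrow> s3 7 i = s2 7 i \<and> s3 8 i = s2 8 i \<and> s3 9 i = s2 9 i"
      by (rule relax_correct[OF s2(1-4) jm _ _ rel2(1) J2 s3_def]; auto simp: joins_def)+
    have "?J (Suc j) = insert (j, b j, a j) (insert (j, a j, b j) (?J j))"
      by (auto simp: joins_def less_Suc_eq)
    then show "?Inv (Suc j) (upd (fexec (FSeq (relax (field 3) (field 4)) (relax (field 4) (field 3))) s1) 10 0 (Suc j))"
      using rel3 rel2(2) fr2 fr3 j(2) by (simp flip: s2_def s3_def)
  next
    have "?J 0 = {}" by auto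
    then show "?Inv 0 (upd s 10 0 0)" using rel by (simp only:) simp
  qed (auto simp: relax_def)
  then have inv: "?Inv m s'" using s I_sizes by simp
  then show "row_relaxed l v k {(e, p, q). e < m \<and> joins e p q} (s' 7) (s' 8) (s' 9)" by blast
  show "s' 7 i = s 7 i \<and> s' 8 i = s 8 i \<and> s' 9 i = s 9 i" if "i < Suc k * n" for i
    using that inv by blast
qed

lemma distances_correct:
  assumes s: "ready s" "s 25 0 = v" "v < n" and s': "s' = fexec distances s"
  shows "rows_correct (len (bought_of s) (I (s 21 0))) v (s' 7) (s' 8) (s' 9) n"
    and "\<And>b. b \<notin> {6, 7, 8, 9, 10, 11, 12} \<Longrightarrow> s' b = s b"
proof -
  show "s' b = s b" if "b \<notin> {6, 7, 8, 9, 10, 11, 12}" for b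
    unfolding s' using that by (intro fexec_frame) (simp add: program_defs)
  let ?l = "len (bought_of s) (I (s 21 0))"
  define s1 where "s1 = fexec set_lengths s"
  define s2 where "s2 = fexec (FFor 11 1 (FAssign 7 (var 11) (Num 0))) s1"
  define s3 where "s3 = upd s2 7 (s2 25 0) 1"
  have fr1: "s1 b = s b" if "b \<notin> {6, 10}" for b
    unfolding s1_def using that by (intro fexec_frame) (simp add: program_defs)
  have l1: "\<forall>e<m. s1 6 e = ?l e" using set_lengths_correct[OF s(1)] by (simp add: s1_def)
  have I: "s1 0 = I" using s(1) fr1 by (simp add: ready_def)
  let ?Inv2 = "\<lambda>j s'. (\<forall>b. b \<notin> {7, 11} \<longrightarrow> s' b = s1 b) \<and> (\<forall>y<j. s' 7 y = 0)"
  have "?Inv2 (s1 0 1) s2"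
    unfolding s2_def
    by (rule fexec_For_invariant[where Inv = ?Inv2]) (auto simp: less_Suc_eq)
  then have s2: "\<And>b. b \<notin> {7, 11} \<Longrightarrow> s2 b = s1 b" "\<forall>y<n. s2 7 y = 0"
    using I I_sizes by auto
  have s3: "s3 0 = I" "\<forall>e<m. s3 6 e = ?l e" "s3 7 = (s2 7)(v := 1)"
    using s2 fr1 I l1 s(2) by (simp_all add: s3_def)
  let ?Inv = "\<lambda>k (s' :: store). s' 0 = I \<and> (\<forall>e<m. s' 6 e = ?l e) \<and> rows_correct ?l v (s' 7) (s' 8) (s' 9) k"
  have "?Inv (s3 0 1) (fexec (FFor 12 1 (FSeq copy_row relax_edges)) s3)"
  proof (rule fexec_For_invariant[where Inv = ?Inv])
    have "rows_correct ?l v (s3 7) (s3 8) (s3 9) 0"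
      unfolding rows_correct_def s3(3) using s2(2)
      by (auto simp: traced_def elim: walk.cases)
    then show "?Inv 0 (upd s3 12 0 0)" using s3(1,2) by simp
  next
    fix k and t :: store assume t: "k < s3 0 1" "?Inv k t" "t 12 0 = k"
    define t1 where "t1 = fexec copy_row t"
    define t2 where "t2 = fexec relax_edges t1"
    have f1: "t1 b = t b" if "b \<notin> {7, 8, 11}" for b
      unfolding t1_def using that by (intro fexec_frame) (simp add: program_defs)
    have f2: "t2 b = t1 b" if "b \<notin> {7, 8, 9, 10}" for b
      unfolding t2_def using that by (intro fexec_frame) (simp add: program_defs)
    have r1: "row_relaxed ?l v k {} (t1 7) (t1 8) (t1 9)"
      "\<And>i. i < Suc k * n \<Longrightarrow> t1 7 i = t 7 i \<and> t1 8 i = t 8 i \<and> t1 9 i = t 9 i"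
      by (rule copy_row_correct[OF _ t(3) t1_def]; use t(2) in simp)+
    have t1: "t1 0 = I" "t1 12 0 = k" "\<forall>e<m. t1 6 e = ?l e" using t f1 by simp_all
    note r2 = relax_edges_correct[OF t1 r1(1) t2_def]
    have "rows_correct ?l v (t2 7) (t2 8) (t2 9) k"
      by (rule rows_correct_cong[of _ _ "t 7" "t 8" "t 9"]) (use t(2) r1(2) r2(2) in auto)
    then have "rows_correct ?l v (t2 7) (t2 8) (t2 9) (Suc k)"
      by (rule rows_correct_Suc[OF _ s(3) r2(1)]) simp
    then show "?Inv (Suc k) (upd (fexec (FSeq copy_row relax_edges) t) 12 0 (Suc k))"
      using t1 f2 by (simp flip: t1_def t2_def)
  qed (auto simp: program_defs)
  then show "rows_correct ?l v (s' 7) (s' 8) (s' 9) n"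
    using s3(1) I_sizes by (simp add: s' distances_def s3_def s2_def s1_def)
qed

lemma cost_upd:
  assumes "e < m" "\<alpha> e = 0"
  shows "cost (\<alpha>(e := q)) = cost \<alpha> + q * c e"
proof -
  have "cost (\<alpha>(e := q)) = q * c e + (\<Sum>e'\<in>{..<m} - {e}. \<alpha> e' * c e')"
    unfolding cost_def using assms by (subst sum.remove[of _ e]) (auto intro: sum.cong)
  moreover have "cost \<alpha> = (\<Sum>e'\<in>{..<m} - {e}. \<alpha> e' * c e')"
    unfolding cost_def using assms by (subst sum.remove[of _ e]) auto
  ultimately show ?thesis by simp
qed

text \<open>While backtracking, the cost so far plus the tabulated distance still to go never
  exceeds the initial cost plus \<open>L\<close>, and bought edges connect the current vertex to
  \<open>w\<close>.\<close>

lemma buy_path_correct: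
  assumes s: "ready s" "v < n" "s 26 0 = w" "w < n" "0 < r" "r = I (s 21 0)" "\<alpha> = bought_of s"
    and rows: "rows_correct (len \<alpha> r) v (s 7) (s 8) (s 9) n"
    and L: "s 7 (n * n + w) = Suc L"
    and s': "s' = fexec buy_path s"
  shows "buys r \<alpha> (bought_of s')" "cost (bought_of s') \<le> cost \<alpha> + L"
    and "conn (\<lambda>e. 0 < bought_of s' e) v w" "s' 1 0 = s 1 0"
proof -
  let ?l = "len \<alpha> r"
  let ?W = "{1, 10, 12, 27, 31}"
  let ?Inv = "\<lambda>i t. (\<forall>b. b \<notin> ?W \<longrightarrow> t b = s b) \<and> t 1 0 = s 1 0 \<and> buys r \<alpha> (bought_of t) \<and>
    t 27 0 < n \<and> conn (\<lambda>e. 0 < bought_of t e) (t 27 0) w \<and>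
    (\<exists>L'. s 7 ((n - i) * n + t 27 0) = Suc L' \<and> cost (bought_of t) + L' \<le> cost \<alpha> + L)"
  define s1 where "s1 = upd s 27 0 w"
  let ?body = "FSeq (set_var 31 (cell (Minus (Get 0 (Num 1)) (var 12)) (var 27)))
                   (FIf (Get 8 (var 31))
                      (FSeq (set_var 10 (Minus (Get 8 (var 31)) (Num 1)))
                      (FSeq (FIf (Get 1 (Plus (var 10) (Num 1))) FSkip
                               (FAssign 1 (Plus (var 10) (Num 1)) copies_exp))
                            (set_var 27 (Get 9 (var 31)))))
                      FSkip)"
  have "?Inv (s1 0 1) (fexec (FFor 12 1 ?body) s1)"
  proof (rule fexec_For_invariant[where Inv = ?Inv])
    show "?Inv 0 (upd s1 12 0 0)"
      using s L by (auto simp: s1_def bought_of_def[abs_def] buys_refl conn_refl)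
  next
    fix i t assume t: "i < s1 0 1" "?Inv i t" "t 12 0 = i"
    then have i: "i < n" using s I_sizes by (simp add: s1_def ready_def)
    define y where "y = t 27 0"
    obtain k where k: "n - i = Suc k" "n - Suc i = k" using i by (metis Suc_diff_Suc)
    obtain L' where L': "s 7 (Suc k * n + y) = Suc L'" "cost (bought_of t) + L' \<le> cost \<alpha> + L"
      using t(2) k by (auto simp: y_def)
    have y: "y < n" using t(2) by (simp add: y_def)
    have tr: "traced ?l v (s 7) (s 8) (s 9) (Suc k) y"
      using rows L'(1) y k(1) unfolding rows_correct_def by (metis Suc_neq_Zero diff_le_self)
    define idx where "idx = Suc k * n + y"
    have t0: "t 0 = I" "t 8 = s 8" "t 9 = s 9" "t 21 = s 21" using t(2) s(1) by (auto simp: ready_def)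
    have idx: "idx = (I (Suc 0) - i) * I (Suc 0) + y" using I_sizes k by (simp add: idx_def)
    from tr consider (stay) "s 8 idx = 0" "s 7 (k * n + y) = Suc L'"
      | (edge) e where "e < m" "s 8 idx = Suc e" "joins e (s 9 idx) y" "s 7 (k * n + s 9 idx) \<noteq> 0"
          "s 7 (k * n + s 9 idx) + ?l e = Suc L'"
      unfolding traced_def idx_def using L'(1) by auto
    then show "?Inv (Suc i) (upd (fexec ?body t) 12 0 (Suc i))"
    proof cases
      case stay
      have "fexec ?body t = upd t 31 0 idx"
        using stay t0 t(3) by (simp add: idx y_def[symmetric])
      then show ?thesis using t(2) stay L' k by (auto simp: bought_of_def[abs_def] y_def[symmetric])
    next
      case edge
      define z where "z = s 9 idx"
      have z: "z < n" using joins_less[OF joins_sym] edge unfolding z_def by blast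
      obtain L'' where L'': "s 7 (k * n + z) = Suc L''" "L'' + ?l e = L'"
        using edge unfolding z_def by (cases "s 7 (k * n + s 9 idx)") auto
      have u: "I (7 + e * 5) = u e" by (rule I_edges(5)[OF edge(1)])
      define \<alpha>1 where "\<alpha>1 = bought_of t"
      define \<alpha>2 where "\<alpha>2 = (if \<alpha>1 e = 0 then \<alpha>1(e := copies r e) else \<alpha>1)"
      have eff: "fexec ?body t 27 0 = z" "fexec ?body t 1 0 = t 1 0"
         "bought_of (fexec ?body t) = \<alpha>2"
        using edge t0 t(3) u s(6)
        by (auto simp: idx[symmetric] y_def[symmetric] z_def \<alpha>2_def \<alpha>1_def bought_of_def copies_def fun_eq_iff)
      have fr: "fexec ?body t b = s b" if "b \<notin> ?W" for b
        using fexec_frame[of b ?body t] t(2) that by simp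
      have b1: "buys r \<alpha> \<alpha>1" using t(2) by (simp add: \<alpha>1_def)
      have b12: "buys r \<alpha>1 \<alpha>2" by (auto simp: buys_def \<alpha>2_def)
      have cost: "cost \<alpha>2 \<le> cost \<alpha>1 + ?l e"
      proof (cases "\<alpha>1 e = 0")
        case True
        \<comment> \<open>An edge still unbought was unbought when the table was computed, so its
          length there is the price paid now. An edge bought in the meantime costs nothing.\<close>
        then have "\<alpha> e = 0" using b1 edge(1) buys_le by (metis le_zero_eq)
        then show ?thesis using True cost_upd[of e \<alpha>1 "copies r e", OF edge(1) True]
          by (simp add: \<alpha>2_def len_def mult.commute)
      next
        case False
        then show ?thesis by (simp add: \<alpha>2_def)
      qed
      have pos: "0 < \<alpha>2 e" using copies_pos[OF edge(1) s(5)] by (simp add: \<alpha>2_def)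
      have "conn (\<lambda>e. 0 < \<alpha>1 e) y w" using t(2) by (simp add: y_def \<alpha>1_def)
      then have "conn (\<lambda>e. 0 < \<alpha>2 e) y w"
        by (rule conn_mono) (rule buys_pos[OF b12])
      then have "conn (\<lambda>e. 0 < \<alpha>2 e) z w"
        using conn_trans conn_edge[of e "\<lambda>e. 0 < \<alpha>2 e" z y] edge(1,3) pos unfolding z_def by blast
      moreover have "cost \<alpha>2 + L'' \<le> cost \<alpha> + L"
        using cost L'(2) L''(2) by (simp add: \<alpha>1_def)
      moreover have "bought_of (upd (fexec ?body t) 12 0 (Suc i)) = \<alpha>2"
        using eff(3) by (simp add: bought_of_def fun_eq_iff)
      ultimately show ?thesis
        using eff fr t(2) z buys_trans[OF b1 b12] L''(1) k(2) by auto
    qed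
  qed auto
  moreover have "s1 0 1 = n" using s(1) I_sizes by (simp add: s1_def ready_def)
  ultimately have inv: "?Inv n s'" unfolding s' buy_path_def s1_def using s(3) by simp
  then obtain L' where L': "s 7 (s' 27 0) = Suc L'" "cost (bought_of s') + L' \<le> cost \<alpha> + L" by auto
  then have "traced ?l v (s 7) (s 8) (s 9) 0 (s' 27 0)"
    using rows inv unfolding rows_correct_def by (metis Suc_neq_Zero add_0 le0 mult_0)
  then have "s' 27 0 = v" by (simp add: traced_def)
  with inv L' show "buys r \<alpha> (bought_of s')" "cost (bought_of s') \<le> cost \<alpha> + L"
    "conn (\<lambda>e. 0 < bought_of s' e) v w" "s' 1 0 = s 1 0" by auto
qed

text \<open>The walk is measured with respect to \<open>\<alpha>\<close>, the purchases at the
  beginning of the step, whereas the path is computed afresh. Edges bought in between have length 0,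
  so the path is no longer than the walk; this allows several calls in one step.\<close>

lemma connect_correct:
  assumes s: "ready s" "v < n" "w < n" "0 < r" "r = I (s 21 0)"
    and xy: "eval_exp x s = v" "eval_exp y (upd s 25 0 v) = w"
    and buys: "buys r \<alpha> (bought_of s)" and walk: "walk (len \<alpha> r) v k w L"
    and s': "s' = fexec (connect x y) s"
  shows "buys r \<alpha> (bought_of s')" "cost (bought_of s') \<le> cost (bought_of s) + L"
    and "conn (\<lambda>e. 0 < bought_of s' e) v w" "s' 1 0 = s 1 0"
    and "\<And>b. b \<notin> {1, 6, 7, 8, 9, 10, 11, 12, 25, 26, 27, 31} \<Longrightarrow> s' b = s b"
    and "buys r (bought_of s) (bought_of s')"
proof -
  show "s' b = s b" if "b \<notin> {1, 6, 7, 8, 9, 10, 11, 12, 25, 26, 27, 31}" for b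
    unfolding s' using that by (intro fexec_frame) (simp add: program_defs)
  define s1 where "s1 = upd (upd s 25 0 v) 26 0 w"
  define s2 where "s2 = fexec distances s1"
  have s'2: "s' = fexec buy_path s2"
    using xy by (simp add: s' connect_def s2_def s1_def)
  have s1: "ready s1" "s1 25 0 = v" "bought_of s1 = bought_of s" "s1 21 = s 21"
    using s(1) by (simp_all add: s1_def ready_def bought_of_def fun_eq_iff)
  note rows = distances_correct(1)[OF s1(1,2) s(2) s2_def]
  note frame = distances_correct(2)[OF s1(1,2) s(2) s2_def]
  have s2: "ready s2" "s2 26 0 = w" "bought_of s2 = bought_of s" "s2 21 = s 21" "s2 1 0 = s 1 0"
    using s1 frame by (simp_all add: ready_def bought_of_def fun_eq_iff s1_def)
  obtain L' where L': "L' \<le> L" "walk (len (bought_of s) r) v k w L'"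
    using walk_mono[OF walk] len_le buys_pos[OF buys] by (metis order_refl)
  have rows': "rows_correct (len (bought_of s) r) v (s2 7) (s2 8) (s2 9) n"
    using rows s1 s(5) by simp
  from rows_correct_complete[OF this s(2,3) L'(2)]
  obtain L0 where L0: "s2 7 (n * n + w) = Suc L0" "L0 \<le> L'"
    by (cases "s2 7 (n * n + w)") auto
  have r: "r = I (s2 21 0)" using s(5) s2(4) by simp
  note path = buy_path_correct[OF s2(1) s(2) s2(2) s(3) s(4) r s2(3)[symmetric] rows' L0(1) s'2]
  show "buys r (bought_of s) (bought_of s')" by (rule path(1))
  show "buys r \<alpha> (bought_of s')" using buys path(1) by (rule buys_trans)
  show "cost (bought_of s') \<le> cost (bought_of s) + L" using path(2) L0(2) L'(1) by linarith
  show "conn (\<lambda>e. 0 < bought_of s' e) v w" by (rule path(3))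
  show "s' 1 0 = s 1 0" using path(4) s2(5) by simp
qed

lemma find_near_correct:
  assumes s: "s 0 = I" "s 28 0 = d" "v < n" and w: "w = 29 \<or> w = 30"
    and rows: "rows_correct (len \<alpha> r) v (s 7) (s 8) (s 9) n"
    and s': "s' = fexec (find_near w) s"
  shows "s' w 0 = 0 \<Longrightarrow> \<not> near \<alpha> (s 5) r d v x"
    and "s' w 0 \<noteq> 0 \<Longrightarrow> s' w 0 - 1 < n \<and> near \<alpha> (s 5) r d v (s' w 0 - 1)"
    and "\<And>b. b \<notin> {w, 11} \<Longrightarrow> s' b = s b"
proof -
  define P where "P x \<longleftrightarrow> s 7 (n * n + x) \<noteq> 0 \<and> 2 * (s 7 (n * n + x) - 1) < d \<and> d \<le> 2 * s 5 x" for x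
  have P: "P x \<longleftrightarrow> near \<alpha> (s 5) r d v x" if "x < n" for x
  proof
    assume "P x"
    note P = this[unfolded P_def]
    obtain L where L: "s 7 (n * n + x) = Suc L" using P by (cases "s 7 (n * n + x)") auto
    from rows_correct_sound[OF rows le_refl that L] P L
    show "near \<alpha> (s 5) r d v x" by (auto simp: near_def)
  next
    assume "near \<alpha> (s 5) r d v x"
    then obtain k L where L: "walk (len \<alpha> r) v k x L" "2 * L < d" "d \<le> 2 * s 5 x"
      by (auto simp: near_def)
    from rows_correct_complete[OF rows s(3) that L(1)] L(2,3) show "P x" by (auto simp: P_def)
  qed
  show frame: "s' b = s b" if "b \<notin> {w, 11}" for b
    unfolding s' using that by (intro fexec_frame) (auto simp: program_defs)
  let ?Inv = "\<lambda>j t. (\<forall>b. b \<notin> {w, 11} \<longrightarrow> t b = s b) \<and> (t w 0 = 0 \<longrightarrow> (\<forall>x<j. \<not> P x)) \<and>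
    (t w 0 \<noteq> 0 \<longrightarrow> t w 0 - 1 < n \<and> P (t w 0 - 1))"
  let ?body = "FIf (Get 7 (cell (Get 0 (Num 1)) (var 11)))
               (FIf (Minus (var 28) (Times (Minus (Get 7 (cell (Get 0 (Num 1)) (var 11))) (Num 1)) (Num 2)))
                 (FIf (Minus (var 28) (Times (Get 5 (var 11)) (Num 2)))
                    FSkip
                    (set_var w (Plus (var 11) (Num 1))))
                 FSkip)
               FSkip"
  let ?s = "upd s w 0 0"
  have "?Inv (?s 0 1) (fexec (FFor 11 1 ?body) ?s)"
  proof (rule fexec_For_invariant[where Inv = ?Inv])
    fix i t assume i: "i < ?s 0 1" and t: "?Inv i t" "t 11 0 = i"
    have "i < n" using i w s I_sizes by auto
    have eq: "t 0 = I" "t 28 0 = d" "t 7 = s 7" "t 5 = s 5" using t(1) s w by auto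
    have "fexec ?body t = (if P i then upd t w 0 (Suc i) else t)"
      using eq t(2) I_sizes by (auto simp: P_def)
    then show "?Inv (Suc i) (upd (fexec ?body t) 11 0 (Suc i))"
      using t w \<open>i < n\<close> by (elim disjE) (simp_all add: All_less_Suc)
  qed (use w in auto)
  moreover have "?s 0 1 = n" using w s I_sizes by auto
  ultimately have inv: "?Inv n s'" by (simp add: s' find_near_def)
  show "s' w 0 \<noteq> 0 \<Longrightarrow> s' w 0 - 1 < n \<and> near \<alpha> (s 5) r d v (s' w 0 - 1)"
    using inv P by blast
  have "x < n" if "near \<alpha> (s 5) r d v x"
    using that walk_less s(3) by (auto simp: near_def)
  then show "s' w 0 = 0 \<Longrightarrow> \<not> near \<alpha> (s 5) r d v x" using inv P by blast
qed

section \<open>Selecting and serving one demand\<close>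

definition ptr :: "nat \<Rightarrow> nat \<Rightarrow> nat" where
  "ptr i j = 3 + m * 5 + (\<Sum>{..<j} + i)"

text \<open>Row \<open>j\<close> of the triangular table starts after
  \<open>0 + ... + (j - 1)\<close> entries and has \<open>j\<close> of its own, so different rows
  occupy disjoint ranges.\<close>

lemma ptr_inj:
  assumes "ptr i j = ptr i' j'" "i < j" "i' < j'"
  shows "i = i' \<and> j = j'"
proof -
  have less: "ptr i j < ptr i' j'" if "j < j'" "i < j" for i j i' j'
  proof -
    have "\<Sum>{..<j} + i < \<Sum>{..<Suc j}" using that by simp
    also have "\<dots> \<le> \<Sum>{..<j'}" by (rule sum_mono2) (use that in auto)
    finally show ?thesis by (simp add: ptr_def)
  qed
  have "j = j'" using less[of j j' i i'] less[of j' j i' i] assms by (metis less_irrefl linorder_neqE_nat)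
  with assms(1) show ?thesis by (simp add: ptr_def)
qed

lemma select_correct:
  assumes s: "s 0 = I" and s': "s' = fexec select s"
  shows "s' 24 0 = 0 \<Longrightarrow> (i, j) \<in> demands \<Longrightarrow> s 4 (ptr i j) \<noteq> 0"
    and "s' 24 0 \<noteq> 0 \<Longrightarrow> (s' 22 0, s' 23 0) \<in> demands \<and> s 4 (ptr (s' 22 0) (s' 23 0)) = 0 \<and>
      s' 21 0 = ptr (s' 22 0) (s' 23 0) \<and>
      (\<forall>(i, j)\<in>demands. s 4 (ptr i j) = 0 \<longrightarrow> R i j \<le> R (s' 22 0) (s' 23 0))"
    and "\<And>b. b \<notin> {13, 14, 20, 21, 22, 23, 24} \<Longrightarrow> s' b = s b"
proof -
  let ?W = "{13, 14, 20, 21, 22, 23, 24} :: nat set"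
  show frame: "s' b = s b" if "b \<notin> ?W" for b
    unfolding s' using that by (intro fexec_frame) (auto simp: program_defs)
  define Sel where "Sel X t \<longleftrightarrow> (\<forall>b. b \<notin> ?W \<longrightarrow> t b = s b) \<and>
      (\<forall>(i, j)\<in>X. s 4 (ptr i j) = 0 \<longrightarrow> R i j \<le> t 24 0) \<and>
      (t 24 0 \<noteq> 0 \<longrightarrow> t 22 0 < t 23 0 \<and> t 23 0 < n \<and> s 4 (ptr (t 22 0) (t 23 0)) = 0 \<and>
         t 21 0 = ptr (t 22 0) (t 23 0) \<and> R (t 22 0) (t 23 0) = t 24 0)"
    for X :: "(nat \<times> nat) set" and t :: store
  let ?X = "\<lambda>i j. {(i', j'). i' < j' \<and> (j' < j \<or> j' = j \<and> i' < i)}"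
  have Sel_upd: "Sel X (upd t b 0 y) = Sel X t" if "b \<in> {13, 14, 20}" for X t b y
    using that by (elim insertE emptyE; simp add: Sel_def)
  define s0 where "s0 = upd (upd s 24 0 0) 20 0 (ptr 0 0)"
  let ?Outer = "\<lambda>j t. Sel (?X 0 j) t \<and> t 20 0 = ptr 0 j"
  have "?Outer (s0 0 1) (fexec (FFor 14 1 (FFor 13 1 select_body)) s0)"
  proof (rule fexec_For_invariant[where Inv = ?Outer])
    show "?Outer 0 (upd s0 14 0 0)"
      by (auto simp: Sel_def s0_def)
  next
    fix j t assume j: "j < s0 0 1" and t: "?Outer j t" "t 14 0 = j"
    have jn: "j < n" using j s I_sizes by (simp add: s0_def)
    let ?Inner = "\<lambda>i t. Sel (?X i j) t \<and> t 20 0 = ptr (min i j) j \<and> t 14 0 = j"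
    have t0: "t 0 = I" using t(1) s by (simp add: Sel_def)
    have "?Inner (t 0 1) (fexec (FFor 13 1 select_body) t)"
    proof (rule fexec_For_invariant[where Inv = ?Inner])
      show "?Inner 0 (upd t 13 0 0)" using t by (simp add: Sel_upd)
    next
      fix i t1 assume i: "i < t 0 1" and t1: "?Inner i t1" "t1 13 0 = i"
      show "?Inner (Suc i) (upd (fexec select_body t1) 13 0 (Suc i))"
      proof (cases "i < j")
        case False
        have "fexec select_body t1 = t1" using t1 False by (simp add: select_body_def)
        moreover have "?X (Suc i) j = ?X i j" using False by auto
        ultimately show ?thesis using t1 False by (simp add: Sel_upd)
      next
        case True
        have X: "?X (Suc i) j = insert (i, j) (?X i j)" using True by auto
        have t10: "t1 0 = I" "t1 4 = s 4" using t1(1) s by (simp_all add: Sel_def)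
        have p: "t1 20 0 = ptr i j" using t1(1) True by simp
        have Ip: "I (ptr i j) = R i j" using I_reqs[OF True jn] by (simp add: ptr_def)
        define t2 where "t2 = (if s 4 (ptr i j) = 0 \<and> t1 24 0 < R i j then
          upd (upd (upd (upd t1 21 0 (ptr i j)) 22 0 i) 23 0 j) 24 0 (R i j) else t1)"
        have "fexec select_body t1 = upd t2 20 0 (Suc (ptr i j))"
          using t1 True t10 p Ip by (auto simp: select_body_def t2_def)
        moreover have "Sel (?X (Suc i) j) t2"
        proof (cases "s 4 (ptr i j) = 0 \<and> t1 24 0 < R i j")
          case new: True
          have "\<forall>(i', j')\<in>?X i j. s 4 (ptr i' j') = 0 \<longrightarrow> R i' j' \<le> R i j"
            using t1(1) new unfolding Sel_def by fastforce
          then show ?thesis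
            using t1(1) new True jn unfolding X Sel_def t2_def by simp
        next
          case False
          then have "t2 = t1" "s 4 (ptr i j) = 0 \<longrightarrow> R i j \<le> t1 24 0" by (auto simp: t2_def)
          then show ?thesis using t1(1) unfolding X Sel_def by simp
        qed
        moreover have "t2 14 0 = j" using t1(1) by (simp add: t2_def)
        ultimately show ?thesis using True by (simp add: Sel_upd ptr_def)
      qed
    qed (auto simp: select_body_def)
    then have inner: "Sel (?X n j) (fexec (FFor 13 1 select_body) t)"
        "fexec (FFor 13 1 select_body) t 20 0 = ptr j j"
      using t0 I_sizes jn by simp_all
    have "?X n j = ?X 0 (Suc j)" using jn by auto
    moreover have "ptr j j = ptr 0 (Suc j)" by (simp add: ptr_def)
    ultimately show "?Outer (Suc j) (upd (fexec (FFor 13 1 select_body) t) 14 0 (Suc j))"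
      using inner by (simp add: Sel_upd)
  qed (auto simp: select_body_def)
  moreover have "s0 0 1 = n" using s I_sizes by (simp add: s0_def)
  moreover have "s' = fexec (FFor 14 1 (FFor 13 1 select_body)) s0"
    using s I_sizes by (simp add: s' select_def s0_def ptr_def)
  ultimately have sel: "Sel (?X 0 n) s'" by simp
  have dem: "demands \<subseteq> ?X 0 n" by (auto simp: demands_def)
  show "s 4 (ptr i j) \<noteq> 0" if "s' 24 0 = 0" "(i, j) \<in> demands"
    using sel dem that unfolding Sel_def demands_def by fastforce
  show "(s' 22 0, s' 23 0) \<in> demands \<and> s 4 (ptr (s' 22 0) (s' 23 0)) = 0 \<and>
      s' 21 0 = ptr (s' 22 0) (s' 23 0) \<and>
      (\<forall>(i, j)\<in>demands. s 4 (ptr i j) = 0 \<longrightarrow> R i j \<le> R (s' 22 0) (s' 23 0))" if "s' 24 0 \<noteq> 0"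
    using sel dem that unfolding Sel_def demands_def by auto
qed

lemma process_correct:
  assumes s: "ready s" "s 22 0 = i" "s 23 0 = j" "s 21 0 = ptr i j"
    and ij: "(i, j) \<in> demands - D" and max: "\<And>i' j'. (i', j') \<in> demands - D \<Longrightarrow> R i' j' \<le> R i j"
    and inv: "greedy_invariant (bought_of s) (s 5) D" and sat: "satisfies \<beta>"
    and s': "s' = fexec process s"
  shows "ready s'" "s' 1 0 = s 1 0" "s' 4 = (s 4)(ptr i j := 1)"
    and "greedy_invariant (bought_of s') (s' 5) (insert (i, j) D)"
proof -
  let ?r = "R i j"
  define \<alpha> where "\<alpha> = bought_of s"
  have less: "i < j" "i < n" "j < n" "0 < ?r" using ij by (auto simp: demands_def)
  have Ip: "I (ptr i j) = ?r" using I_reqs[OF less(1,3)] by (simp add: ptr_def)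
  define sA where "sA = upd (upd s 4 (ptr i j) 1) 25 0 i"
  define sB where "sB = fexec distances sA"
  define d where "d = sB 7 (n * n + j) - 1"
  define sC where "sC = upd sB 28 0 d"
  define sD where "sD = (if d \<noteq> 0 then fexec add_centres sC else sC)"
  have sA: "ready sA" "sA 25 0 = i" "bought_of sA = \<alpha>" "sA 21 0 = ptr i j"
    using s by (simp_all add: sA_def ready_def \<alpha>_def bought_of_def fun_eq_iff)
  note frB = distances_correct(2)[OF sA(1,2) less(2) sB_def]
  have rowsB: "rows_correct (len \<alpha> ?r) i (sB 7) (sB 8) (sB 9) n"
    using distances_correct(1)[OF sA(1,2) less(2) sB_def] sA Ip by simp
  have sC: "ready sC" "bought_of sC = \<alpha>" "sC 21 0 = ptr i j" "sC 22 0 = i" "sC 23 0 = j"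
      "sC 28 0 = d" "sC 5 = s 5" "sC 1 0 = s 1 0" "sC 4 = (s 4)(ptr i j := 1)" "sC 0 = I"
    using s frB sA
    by (auto simp: sC_def sA_def ready_def \<alpha>_def bought_of_def fun_eq_iff)
  have s'C: "s' = fexec (connect (var 22) (var 23)) sD"
  proof -
    have A: "fexec (set_var 25 (var 22)) (fexec (FAssign 4 (var 21) (Num 1)) s) = sA"
      using s by (simp add: sA_def)
    have "sB 0 = I" "sB 23 0 = j" using s frB by (simp_all add: sA_def ready_def)
    then have C: "fexec (set_var 28 (Minus (Get 7 (cell (Get 0 (Num 1)) (var 23))) (Num 1))) sB = sC"
      using I_sizes by (simp add: sC_def d_def)
    have D: "fexec (FIf (var 28) add_centres FSkip) sC = sD" using sC(6) by (simp add: sD_def)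
    show ?thesis unfolding s' process_def fexec.simps(3) A sB_def[symmetric] C D ..
  qed
  \<comment> \<open>Solvability of the instance makes the table entry nonzero, so that subtracting 1
    from it gives the true distance.\<close>
  obtain k0 L0 where "walk (len \<alpha> ?r) i k0 j L0" using satisfies_reachable[OF sat] ij by blast
  from rows_correct_complete[OF rowsB less(2,3) this] have Td: "sB 7 (n * n + j) = Suc d"
    by (simp add: d_def)
  from rows_correct_sound[OF rowsB le_refl less(3) this]
  obtain k where walk: "walk (len \<alpha> ?r) i k j d" by blast
  have dist: "d \<le> L" if "walk (len \<alpha> ?r) i k j L" for k L
    using rows_correct_complete[OF rowsB less(2,3) that] Td by simp
  have connD: "buys ?r \<alpha> (bought_of s')" "cost (bought_of s') \<le> cost (bought_of sD) + d"
      "conn (\<lambda>e. 0 < bought_of s' e) i j" "s' 1 0 = sD 1 0"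
      "b \<notin> {1, 6, 7, 8, 9, 10, 11, 12, 25, 26, 27, 31} \<Longrightarrow> s' b = sD b"
      "buys ?r (bought_of sD) (bought_of s')"
    if "ready sD" "sD 22 0 = i" "sD 23 0 = j" "sD 21 0 = ptr i j" "buys ?r \<alpha> (bought_of sD)" for b
    using connect_correct[OF that(1) less(2,3,4) _ _ _ that(5) walk s'C] that Ip by simp_all
  have "((ready s' \<and> s' 1 0 = s 1 0) \<and> s' 4 = (s 4)(ptr i j := 1)) \<and>
      greedy_invariant (bought_of s') (s' 5) (insert (i, j) D)"
  proof (cases "d = 0")
    case True
    then have sD: "sD = sC" by (simp add: sD_def)
    note C = connD[unfolded sD, OF sC(1,4,5,3), unfolded sC(2), OF buys_refl]
    have "greedy_invariant (bought_of s') (s 5) (insert (i, j) D)"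
      using greedy_step_zero[OF inv ij max C(1)[unfolded \<alpha>_def] _ C(3)] C(2) True
      by (simp add: \<alpha>_def)
    then show ?thesis
      using C(4) C(5)[of 4] C(5)[of 5] C(5)[of 0] C(5)[of 3] sC by (simp add: ready_def)
  next
    case False
    define sE where "sE = fexec (find_near 29) sC"
    define sF where "sF = upd sE 25 0 j"
    define sG where "sG = fexec distances sF"
    define sH where "sH = fexec (find_near 30) sG"
    have rowsC: "rows_correct (len \<alpha> ?r) i (sC 7) (sC 8) (sC 9) n" using rowsB by (simp add: sC_def)
    note E = find_near_correct[OF sC(10,6) less(2) disjI1[OF refl] rowsC sE_def, unfolded sC(7)]
    have sF: "ready sF" "sF 25 0 = j" "bought_of sF = \<alpha>" "sF 21 0 = ptr i j"
      using sC E(3) by (simp_all add: sF_def ready_def bought_of_def fun_eq_iff)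
    note frG = distances_correct(2)[OF sF(1,2) less(3) sG_def]
    have rowsG: "rows_correct (len \<alpha> ?r) j (sG 7) (sG 8) (sG 9) n"
      using distances_correct(1)[OF sF(1,2) less(3) sG_def] sF Ip by simp
    have sG: "sG 0 = I" "sG 28 0 = d" "sG 5 = s 5"
      using frG E(3) sC by (simp_all add: sF_def)
    note H = find_near_correct[OF sG(1,2) less(3) disjI2[OF refl] rowsG sH_def, unfolded sG(3)]
    have sH: "ready sH" "bought_of sH = \<alpha>" "sH 21 0 = ptr i j" "sH 22 0 = i" "sH 23 0 = j"
      "sH 28 0 = d" "sH 5 = s 5" "sH 1 0 = s 1 0" "sH 4 = (s 4)(ptr i j := 1)" "sH 29 0 = sE 29 0"
      using sC E(3) frG H(3) by (simp_all add: ready_def sF_def bought_of_def fun_eq_iff)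
    have sD: "sD = (if sH 29 0 \<noteq> 0 then if sH 30 0 \<noteq> 0
        then fexec (FSeq (connect (var 22) (Minus (var 29) (Num 1)))
                         (connect (var 23) (Minus (var 30) (Num 1)))) sH
        else upd sH 5 j d else upd sH 5 i d)"
      using False sC(5) sH(4-6) E(3)
      by (simp add: sD_def add_centres_def sE_def[symmetric] sH_def sG_def sF_def)
    show ?thesis
    proof (cases "sH 29 0 = 0 \<or> sH 30 0 = 0")
      case True
      define v where "v = (if sH 29 0 = 0 then i else j)"
      have sDv: "sD = upd sH 5 v d" using True by (auto simp: sD v_def)
      have D: "ready sD" "sD 22 0 = i" "sD 23 0 = j" "sD 21 0 = ptr i j" "bought_of sD = \<alpha>"
        "sD 5 = (s 5)(v := d)" "sD 4 = (s 4)(ptr i j := 1)" "sD 1 0 = s 1 0"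
        using sH unfolding sDv ready_def bought_of_def by (simp_all add: fun_eq_iff)
      note C = connD[OF D(1-4), unfolded D(5), OF buys_refl]
      have v: "v = i \<or> v = j" and far: "\<not> near \<alpha> (s 5) ?r d v x" for x
        using True E(1) H(1) sH(10) by (auto simp: v_def)
      have "greedy_invariant (bought_of s') ((s 5)(v := d)) (insert (i, j) D)"
        by (rule greedy_step_centre[OF inv ij max C(1)[unfolded \<alpha>_def] _ C(3) _ _ v])
          (use C(2) False dist far in \<open>simp_all add: \<alpha>_def\<close>)
      then show ?thesis
        using C(4) C(5)[of 4] C(5)[of 5] C(5)[of 0] C(5)[of 3] D by (simp add: ready_def)
    next
      case near: False
      define x where "x = sH 29 0 - 1"
      define y where "y = sH 30 0 - 1"
      have x: "x < n" "near \<alpha> (s 5) ?r d i x" using E(2) near sH(10) by (simp_all add: x_def)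
      have y: "y < n" "near \<alpha> (s 5) ?r d j y" using H(2) near by (simp_all add: y_def)
      obtain k1 L1 where L1: "walk (len \<alpha> ?r) i k1 x L1" "2 * L1 < d" using x by (auto simp: near_def)
      obtain k2 L2 where L2: "walk (len \<alpha> ?r) j k2 y L2" "2 * L2 < d" using y by (auto simp: near_def)
      define s1 where "s1 = fexec (connect (var 22) (Minus (var 29) (Num 1))) sH"
      have b0: "buys ?r \<alpha> (bought_of sH)" using sH(2) buys_refl by simp
      have r: "?r = I (sH 21 0)" using sH(3) Ip by simp
      have ev: "eval_exp (var 22) sH = i" "eval_exp (Minus (var 29) (Num 1)) (upd sH 25 0 i) = x"
        using sH by (simp_all add: x_def)
      note A = connect_correct[OF sH(1) less(2) x(1) less(4) r ev b0 L1(1) s1_def]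
      have s1: "ready s1" "s1 21 0 = ptr i j" "s1 23 0 = j" "s1 30 = sH 30" "s1 22 0 = i"
          "s1 5 = s 5" "s1 4 = (s 4)(ptr i j := 1)"
        using sH A(5) by (simp_all add: ready_def)
      have sD2: "sD = fexec (connect (var 23) (Minus (var 30) (Num 1))) s1"
        using near by (simp add: sD s1_def)
      have r1: "?r = I (s1 21 0)" using s1(2) Ip by simp
      have ev1: "eval_exp (var 23) s1 = j" "eval_exp (Minus (var 30) (Num 1)) (upd s1 25 0 j) = y"
        using s1 by (simp_all add: y_def)
      note B = connect_correct[OF s1(1) less(3) y(1) less(4) r1 ev1 A(1) L2(1) sD2]
      have D: "ready sD" "sD 22 0 = i" "sD 23 0 = j" "sD 21 0 = ptr i j"
        "sD 5 = s 5" "sD 4 = (s 4)(ptr i j := 1)" "sD 1 0 = s 1 0"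
        using s1 B(4,5) A(4) sH(8) by (simp_all add: ready_def)
      note C = connD[OF D(1-4) B(1)]
      \<comment> \<open>The links have lengths with \<open>2 * L1 < d\<close> and
        \<open>2 * L2 < d\<close>; the path adds at most \<open>d\<close>.\<close>
      have "cost (bought_of s') \<le> cost \<alpha> + 2 * d"
        using C(2) B(2) A(2) L1(2) L2(2) sH(2) by simp
      moreover have "conn (\<lambda>e. 0 < bought_of s' e) j y"
        by (rule conn_mono[OF B(3)]) (rule buys_pos[OF C(6)])
      moreover have "conn (\<lambda>e. 0 < bought_of s' e) i x"
        by (rule conn_mono[OF A(3)]) (rule buys_pos[OF buys_trans[OF B(6) C(6)]])
      ultimately have "greedy_invariant (bought_of s') (s 5) (insert (i, j) D)"
        by (intro greedy_step_merge[OF inv ij max C(1)[unfolded \<alpha>_def] _ C(3) _ _ x(2)[unfolded \<alpha>_def] y(2)[unfolded \<alpha>_def]])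
          (use False dist in \<open>simp_all add: \<alpha>_def\<close>)
      then show ?thesis
        using C(4) C(5)[of 4] C(5)[of 5] C(5)[of 0] C(5)[of 3] D by (simp add: ready_def)
    qed
  qed
  then show "ready s'" "s' 1 0 = s 1 0" "s' 4 = (s 4)(ptr i j := 1)"
    and "greedy_invariant (bought_of s') (s' 5) (insert (i, j) D)" by simp_all
qed

section \<open>The main loop\<close>

definition processed :: "store \<Rightarrow> (nat \<times> nat) set" where
  "processed s = {(i, j) \<in> demands. s 4 (ptr i j) \<noteq> 0}"

definition good_store :: "store \<Rightarrow> bool" where
  "good_store s \<longleftrightarrow> ready s \<and> s 1 0 = m \<and> greedy_invariant (bought_of s) (s 5) (processed s)"

lemma good_store_upd: "z > 6 \<Longrightarrow> good_store (upd s z i x) = good_store s"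
  by (simp add: good_store_def ready_def bought_of_def[abs_def] processed_def)

lemma processed_upd: "z > 6 \<Longrightarrow> processed (upd s z i x) = processed s"
  by (simp add: processed_def)

text \<open>A step either serves a new demand or finds none left. The second alternative persists,
  which makes surplus steps harmless.\<close>

lemma step_correct:
  assumes s: "good_store s" and sat: "satisfies \<beta>" and s': "s' = fexec step s"
  shows "good_store s' \<and> (card (processed s) < card (processed s') \<or> processed s' = demands)"
proof -
  define s1 where "s1 = fexec select s"
  have I: "s 0 = I" using s by (simp add: good_store_def ready_def)
  note sel = select_correct[OF I s1_def]
  have s1: "ready s1" "s1 1 0 = m" "bought_of s1 = bought_of s" "s1 5 = s 5" "s1 4 = s 4"
    using s sel(3) by (simp_all add: good_store_def ready_def bought_of_def[abs_def])
  have proc: "processed s1 = processed s" using s1(5) by (simp add: processed_def)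
  have inv: "greedy_invariant (bought_of s1) (s1 5) (processed s)"
    using s s1 by (simp add: good_store_def)
  show ?thesis
  proof (cases "s1 24 0 = 0")
    case True
    then have "s' = s1" by (simp add: s' step_def s1_def)
    moreover have "processed s = demands"
      using sel(1)[OF True] by (auto simp: processed_def)
    ultimately show ?thesis using s1 proc inv by (simp add: good_store_def)
  next
    case False
    define i j where "i = s1 22 0" and "j = s1 23 0"
    have s'1: "s' = fexec process s1" using False by (simp add: s' step_def s1_def)
    have ij: "(i, j) \<in> demands - processed s" "s1 21 0 = ptr i j"
      and max: "\<And>i' j'. (i', j') \<in> demands - processed s \<Longrightarrow> R i' j' \<le> R i j"
      using sel(2)[OF False] by (auto simp: processed_def i_def j_def)
    note P = process_correct[OF s1(1) i_def[symmetric] j_def[symmetric] ij(2,1) max inv sat s'1]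
    have "processed s' = insert (i, j) (processed s)"
    proof -
      have "ptr i' j' = ptr i j \<longleftrightarrow> (i', j') = (i, j)" if "(i', j') \<in> demands" for i' j'
        using ptr_inj[of i' j' i j] that ij(1) by (auto simp: demands_def)
      then show ?thesis using P(3) ij(1) s1(5) by (auto simp: processed_def)
    qed
    moreover have "finite (processed s)"
      by (rule finite_subset[OF _ finite_demands]) (auto simp: processed_def)
    ultimately show ?thesis using P s1(2) ij(1) by (simp add: good_store_def)
  qed
qed

lemma greedy_correct:
  assumes s: "s 0 = I" "\<And>b j. b \<noteq> 0 \<Longrightarrow> s b j = 0" and sat: "satisfies \<beta>"
    and s': "s' = fexec greedy s"
  shows "s' 1 0 = m" "\<exists>\<sigma>. greedy_invariant (bought_of s') \<sigma> demands"
proof -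
  define s1 where "s1 = upd (upd s 1 0 m) 2 0 1"
  define s2 where "s2 = fexec (FFor 10 2 (set_var 2 (Times (var 2) (field 6)))) s1"
  define s3 where "s3 = fexec (FFor 10 2 (FAssign 3 (var 10) (Times (Div (var 2) (field 6)) (field 5)))) s2"
  have s'3: "s' = fexec (FFor 15 1 (FFor 16 1 step)) s3"
    using s I_sizes by (simp add: s' greedy_def s1_def s2_def s3_def)
  have s10: "s1 0 = I" using s by (simp add: s1_def)
  let ?Inv2 = "\<lambda>i t. (\<forall>b. b \<notin> {2, 10} \<longrightarrow> t b = s1 b) \<and> t 2 0 = (\<Prod>e<i. den e)"
  have "?Inv2 (s1 0 2) s2"
    unfolding s2_def
  proof (rule fexec_For_invariant[where Inv = ?Inv2])
    fix i t assume "i < s1 0 2" "?Inv2 i t" "t 10 0 = i"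
    then show "?Inv2 (Suc i) (upd (fexec (set_var 2 (Times (var 2) (field 6))) t) 10 0 (Suc i))"
      using s10 I_sizes I_edges(4)[of i] by simp
  qed (auto simp: s1_def)
  then have s2: "\<And>b. b \<notin> {2, 10} \<Longrightarrow> s2 b = s1 b" "s2 2 0 = (\<Prod>e<m. den e)"
    using s10 I_sizes by simp_all
  have s20: "s2 0 = I" using s2 s10 by simp
  let ?Inv3 = "\<lambda>i t. (\<forall>b. b \<notin> {3, 10} \<longrightarrow> t b = s2 b) \<and> (\<forall>e<i. t 3 e = c e)"
  have "?Inv3 (s2 0 2) s3"
    unfolding s3_def
  proof (rule fexec_For_invariant[where Inv = ?Inv3])
    fix i t assume i: "i < s2 0 2" "?Inv3 i t" "t 10 0 = i"
    then have im: "i < m" using s20 I_sizes by simp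
    show "?Inv3 (Suc i) (upd (fexec (FAssign 3 (var 10) (Times (Div (var 2) (field 6)) (field 5))) t) 10 0 (Suc i))"
      using i s20 I_edges(3,4)[OF im] c_eq[OF im] s2(2) by (auto simp: less_Suc_eq)
  qed auto
  then have s3: "\<And>b. b \<notin> {3, 10} \<Longrightarrow> s3 b = s2 b" "\<forall>e<m. s3 3 e = c e"
    using s20 I_sizes by simp_all
  have old: "s3 b = s1 b" if "b \<notin> {2, 3, 10}" for b using s2(1) s3(1) that by simp
  have "bought_of s3 = (\<lambda>_. 0)" "s3 5 = (\<lambda>_. 0)" "processed s3 = {}"
    using old s(2) by (simp_all add: bought_of_def s1_def processed_def fun_eq_iff)
  then have g3: "good_store s3"
    using old s10 s3(2) greedy_invariant_init by (simp add: good_store_def ready_def s1_def)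
  have fin: "finite (processed t)" "processed t \<subseteq> demands" for t
    using finite_demands by (auto simp: processed_def intro: finite_subset)
  \<comment> \<open>After \<open>N\<close> steps at least \<open>N\<close> demands are served unless
    all are. Since there are at most \<open>n * n\<close> demands, \<open>N = n * n\<close> forces
    that all are served.\<close>
  let ?P = "\<lambda>N t. good_store t \<and> (N \<le> card (processed t) \<or> processed t = demands)"
  have step: "?P (Suc N) (fexec step t)" if P: "?P N t" for N t
  proof -
    note st = step_correct[OF conjunct1[OF P] sat refl]
    have "card (processed (fexec step t)) \<le> card demands"
      by (rule card_mono[OF finite_demands fin(2)])
    then have "Suc N \<le> card (processed (fexec step t)) \<or> processed (fexec step t) = demands"
      using conjunct2[OF P] conjunct2[OF st] by (elim disjE) simp_all
    then show ?thesis using conjunct1[OF st] by blast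
  qed
  have P_upd: "?P N (upd t b i x) = ?P N t" if "b \<in> {15, 16}" for N t b i x
    using that by (elim insertE emptyE) (simp_all add: good_store_upd processed_upd)
  have P0: "t 0 1 = n" if "?P N t" for N t
    using that I_sizes by (simp add: good_store_def ready_def)
  let ?Outer = "\<lambda>k t. ?P (k * n) t"
  have "?Outer (s3 0 1) s'"
    unfolding s'3
  proof (rule fexec_For_invariant[where Inv = ?Outer])
    show "?Outer 0 (upd s3 15 0 0)" using g3 by (simp add: good_store_upd)
  next
    fix k t assume t: "?Outer k t" "t 15 0 = k"
    let ?Inner = "\<lambda>i t. ?P (k * n + i) t"
    have "?Inner (t 0 1) (fexec (FFor 16 1 step) t)"
    proof (rule fexec_For_invariant[where Inv = ?Inner])
      show "?Inner 0 (upd t 16 0 0)" using t(1) by (simp add: P_upd)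
    next
      fix i t1 assume "?Inner i t1"
      from step[OF this] show "?Inner (Suc i) (upd (fexec step t1) 16 0 (Suc i))"
        by (simp add: P_upd)
    qed (simp_all add: program_defs)
    then show "?Outer (Suc k) (upd (fexec (FFor 16 1 step) t) 15 0 (Suc k))"
      using P0[OF t(1)] by (simp add: P_upd add.commute)
  qed (simp_all add: program_defs)
  then have final: "?P (n * n) s'" using P0[where t = s3 and N = 0] g3 by simp
  have "demands \<subseteq> {..<n} \<times> {..<n}" by (auto simp: demands_def)
  then have "card demands \<le> n * n" using card_mono[of "{..<n} \<times> {..<n}" demands] by simp
  then have "processed s' = demands"
    using final card_seteq[OF finite_demands fin(2)[of s']] by auto
  with final show "s' 1 0 = m" "\<exists>\<sigma>. greedy_invariant (bought_of s') \<sigma> demands"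
    by (auto simp: good_store_def)
qed

end

section \<open>Instances and their encoding\<close>

lemma concat_uniform:
  assumes "\<forall>x\<in>set xs. length x = K"
  shows "length (concat xs) = length xs * K"
    and "i < length xs \<Longrightarrow> f < K \<Longrightarrow> concat xs ! (i * K + f) = xs ! i ! f"
proof -
  show "length (concat xs) = length xs * K"
    using assms by (induction xs) simp_all
  show "concat xs ! (i * K + f) = xs ! i ! f" if "i < length xs" "f < K"
    using assms that
  proof (induction xs arbitrary: i)
    case (Cons x xs)
    then show ?case by (cases i) (simp_all add: nth_append)
  qed simp
qed

lemma concat_triangular:
  "length (concat (map (\<lambda>j. map (f j) [0..<j]) [0..<n])) = \<Sum>{..<n}"
  "i < j \<Longrightarrow> j < n \<Longrightarrow> concat (map (\<lambda>j. map (f j) [0..<j]) [0..<n]) ! (\<Sum>{..<j} + i) = f j i"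
proof -
  show len: "length (concat (map (\<lambda>j. map (f j) [0..<j]) [0..<n])) = \<Sum>{..<n}" for n
    by (induction n) simp_all
  show "concat (map (\<lambda>j. map (f j) [0..<j]) [0..<n]) ! (\<Sum>{..<j} + i) = f j i" if "i < j" "j < n"
    using that
  proof (induction n)
    case (Suc n)
    have c: "concat (map (\<lambda>j. map (f j) [0..<j]) [0..<Suc n]) =
        concat (map (\<lambda>j. map (f j) [0..<j]) [0..<n]) @ map (f n) [0..<n]" by simp
    show ?case
    proof (cases "j = n")
      case True
      then show ?thesis unfolding c nth_append len using Suc.prems by simp
    next
      case False
      then have "j < n" using Suc.prems by simp
      have "\<Sum>{..<j} + i < \<Sum>{..<Suc j}" using Suc.prems by simp
      also have "\<dots> \<le> \<Sum>{..<n}" by (rule sum_mono2) (use \<open>j < n\<close> in auto)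
      finally show ?thesis unfolding c nth_append len using Suc.IH[OF Suc.prems(1) \<open>j < n\<close>] by simp
    qed
  qed simp
qed

lemma length_encode_edges: "length (concat (map encode_edge es)) = length es * 5"
  using concat_uniform(1)[of "map encode_edge es" 5] by (simp add: encode_edge_def)

lemma length_encode_instance:
  "length (encode_instance I) = 2 + length (edges I) * 5 + \<Sum>{..<num_verts I}"
  by (simp add: encode_instance_def length_encode_edges concat_triangular)

lemma init_store_input:
  assumes "k < length xs" shows "init_store xs 0 (Suc k) = xs ! k"
  using assms by (simp add: init_store_def)

lemma init_store_edge:
  assumes e: "e < length (edges I)" and f: "f < 5"
  shows "init_store (encode_instance I) 0 (3 + f + e * 5) = encode_edge (edges I ! e) ! f"
proof -
  have less: "e * 5 + f < length (edges I) * 5"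
    using e f mult_le_mono1[of "Suc e" "length (edges I)" 5] by simp
  then have "init_store (encode_instance I) 0 (Suc (2 + (e * 5 + f))) = encode_instance I ! (2 + (e * 5 + f))"
    by (intro init_store_input) (simp add: length_encode_instance)
  also have "\<dots> = concat (map encode_edge (edges I)) ! (e * 5 + f)"
    unfolding encode_instance_def using less by (simp add: nth_append length_encode_edges)
  also have "\<dots> = encode_edge (edges I ! e) ! f"
    using concat_uniform(2)[of "map encode_edge (edges I)" 5 e f] e f by (simp add: encode_edge_def)
  finally show ?thesis by (simp add: numeral_eq_Suc ac_simps)
qed

lemma init_store_req:
  assumes "i < j" "j < num_verts I"
  shows "init_store (encode_instance I) 0 (3 + length (edges I) * 5 + (\<Sum>{..<j} + i)) = req I {i, j}"
proof -
  let ?k = "\<Sum>{..<j} + i" and ?M = "length (edges I) * 5"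
  have "?k < \<Sum>{..<Suc j}" using assms by simp
  also have "\<dots> \<le> \<Sum>{..<num_verts I}" by (rule sum_mono2) (use assms in auto)
  finally have less: "?k < \<Sum>{..<num_verts I}" .
  then have "init_store (encode_instance I) 0 (Suc (2 + (?M + ?k))) = encode_instance I ! (2 + (?M + ?k))"
    by (intro init_store_input) (simp add: length_encode_instance)
  also have "\<dots> = concat (map (\<lambda>j. map (\<lambda>i. req I {i, j}) [0..<j]) [0..<num_verts I]) ! ?k"
    unfolding encode_instance_def by (simp add: nth_append length_encode_edges)
  also have "\<dots> = req I {i, j}" by (rule concat_triangular(2)[OF assms])
  finally show ?thesis by (simp add: numeral_eq_Suc ac_simps)
qed

lemma length_le_input_size: "length xs \<le> input_size xs"
  unfolding input_size_def
proof (induction xs)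
  case (Cons x xs)
  then show ?case using nbits_pos[of x] by simp
qed simp

text \<open>Trip counts must be polynomial in the input size although the number \<open>n\<close> of
  vertices is written in binary. The triangular table guarantees this: it has at least
  \<open>n - 1\<close> entries, and each entry contributes at least one bit.\<close>

lemma init_store_bounded:
  fixes I :: cap_sndp
  defines "xs \<equiv> encode_instance I"
  shows "input_bounded (input_size xs) (init_store xs)" "bits_bounded (input_size xs) (init_store xs)"
proof -
  have len: "length xs = 2 + length (edges I) * 5 + \<Sum>{..<num_verts I}"
    unfolding xs_def by (rule length_encode_instance)
  have "num_verts I \<le> Suc (\<Sum>{..<num_verts I})"
    by (cases "num_verts I") simp_all
  then have sizes: "init_store xs 0 1 \<le> length xs" "init_store xs 0 2 \<le> length xs"
    using init_store_input[of 0 xs] init_store_input[of 1 xs] len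
    by (simp_all add: xs_def encode_instance_def numeral_eq_Suc)
  have "nbits (init_store xs a i) \<le> input_size xs" for a i
  proof -
    have "nbits x \<le> input_size xs" if "x \<in> set xs" for x
      unfolding input_size_def using that by (intro member_le_sum_list) auto
    moreover have "nbits (length xs) \<le> input_size xs"
      using nbits_le_self[of "length xs"] length_le_input_size[of xs] len by simp
    moreover have "nbits 0 \<le> input_size xs"
      using length_le_input_size[of xs] len by (simp add: nbits_le_iff)
    ultimately show ?thesis by (auto simp: init_store_def)
  qed
  then show "input_bounded (input_size xs) (init_store xs)" "bits_bounded (input_size xs) (init_store xs)"
    using sizes length_le_input_size[of xs] by (simp_all add: input_bounded_def bits_bounded_def)
qed

lemma greedy_runs:
  fixes I :: cap_sndp
  defines "xs \<equiv> encode_instance I"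
  obtains t where "exec (compile greedy) (init_store xs) t (fexec greedy (init_store xs))"
    and "t \<le> poly (com_time_bound greedy [:0, 1:]) (input_size xs)"
proof -
  have "bits_bounded (poly [:0, 1:] (input_size xs)) (init_store xs)"
    using init_store_bounded(2)[of I] by (simp add: xs_def)
  from compile_correct[OF ok_greedy init_store_bounded(1)[of I, folded xs_def] this]
  show thesis by (elim exE conjE) (rule that)
qed

text \<open>Termination and time come from the syntactic criterion \<open>ok\<close> alone, so
  instances without a feasible solution are covered as well.\<close>

lemma greedy_polynomial_time: "polynomial_time (compile greedy) (encode_instance ` X)"
  unfolding polynomial_time_def
proof (intro exI[of _ "com_time_bound greedy [:0, 1:]"] ballI)
  fix xs assume "xs \<in> encode_instance ` X"
  then obtain I where xs: "xs = encode_instance I" by blast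
  show "\<exists>t ys. runs (compile greedy) xs t ys \<and> t \<le> poly (com_time_bound greedy [:0, 1:]) (input_size xs)"
    unfolding runs_def xs by (rule greedy_runs[of I]) blast
qed

section \<open>Rational instances as integral networks\<close>

locale instance_network =
  fixes I :: cap_sndp
  assumes valid: "valid_instance I"
begin

definition numerator :: "nat \<Rightarrow> nat" where
  "numerator e = nat (fst (quotient_of (edge_cost (edges I ! e))))"

definition denominator :: "nat \<Rightarrow> nat" where
  "denominator e = nat (snd (quotient_of (edge_cost (edges I ! e))))"

definition common_denominator :: nat where
  "common_denominator = (\<Prod>e<length (edges I). denominator e)"

definition scaled_cost :: "nat \<Rightarrow> nat" where
  "scaled_cost e = common_denominator div denominator e * numerator e"

sublocale encoded_network "num_verts I" "length (edges I)" "\<lambda>e. end1 (edges I ! e)" "\<lambda>e. end2 (edges I ! e)"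
  scaled_cost "\<lambda>e. edge_cap (edges I ! e)" "\<lambda>i j. req I {i, j}"
  "init_store (encode_instance I) 0" numerator denominator
proof
  fix e assume e: "e < length (edges I)"
  then have "edges I ! e \<in> set (edges I)" by simp
  then show "end1 (edges I ! e) < num_verts I" "end2 (edges I ! e) < num_verts I"
    "0 < edge_cap (edges I ! e)"
    using valid by (auto simp: valid_instance_def verts_def)
  show "init_store (encode_instance I) 0 (3 + e * 5) = end1 (edges I ! e)"
    "init_store (encode_instance I) 0 (4 + e * 5) = end2 (edges I ! e)"
    "init_store (encode_instance I) 0 (5 + e * 5) = numerator e"
    "init_store (encode_instance I) 0 (6 + e * 5) = denominator e"
    "init_store (encode_instance I) 0 (7 + e * 5) = edge_cap (edges I ! e)"
    using init_store_edge[OF e, of 0] init_store_edge[OF e, of 1] init_store_edge[OF e, of 2]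
      init_store_edge[OF e, of 3] init_store_edge[OF e, of 4]
    by (simp_all add: encode_edge_def numerator_def denominator_def)
  show "scaled_cost e = (\<Prod>e<length (edges I). denominator e) div denominator e * numerator e"
    by (simp add: scaled_cost_def common_denominator_def)
next
  show "init_store (encode_instance I) 0 1 = num_verts I"
    "init_store (encode_instance I) 0 2 = length (edges I)"
    using init_store_input[of 0 "encode_instance I"] init_store_input[of 1 "encode_instance I"]
    by (simp_all add: length_encode_instance encode_instance_def numeral_eq_Suc)
next
  fix i j assume "i < j" "j < num_verts I"
  then show "init_store (encode_instance I) 0 (3 + length (edges I) * 5 + (\<Sum>{..<j} + i)) = req I {i, j}"
    by (rule init_store_req)
qed

lemma denominator_pos: "0 < denominator e"
  by (simp add: denominator_def quotient_of_denom_pos')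

lemma common_denominator_pos: "0 < common_denominator"
  by (simp add: common_denominator_def denominator_pos)

text \<open>Nonnegative costs make the conversion of the numerator to a natural number lossless, and
  each denominator divides the product, so the division is exact.\<close>

lemma scaled_cost_eq:
  assumes "e < length (edges I)"
  shows "real (scaled_cost e) = real common_denominator * of_rat (edge_cost (edges I ! e))"
proof -
  obtain p q where pq: "quotient_of (edge_cost (edges I ! e)) = (p, q)" by fastforce
  have q: "0 < q" using quotient_of_denom_pos[OF pq] .
  have c: "edge_cost (edges I ! e) = of_int p / of_int q" using quotient_of_div[OF pq] .
  have "0 \<le> edge_cost (edges I ! e)" using valid assms by (simp add: valid_instance_def)
  then have p: "0 \<le> p" using q by (simp add: c zero_le_divide_iff)
  have "denominator e dvd common_denominator"
    unfolding common_denominator_def using assms by (intro dvd_prodI) simp_all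
  then have "real (scaled_cost e) = real common_denominator / real (denominator e) * real (numerator e)"
    by (simp add: scaled_cost_def real_of_nat_div)
  moreover have "real (denominator e) = of_int q" "real (numerator e) = of_int p"
    using p q by (simp_all add: denominator_def numerator_def pq)
  ultimately show ?thesis by (simp add: c of_rat_divide)
qed

lemma cost_eq: "real (cost (\<lambda>e. \<alpha> ! e)) = real common_denominator * solution_cost I \<alpha>"
  unfolding cost_def solution_cost_def sum_distrib_left of_nat_sum
  by (intro sum.cong) (simp_all add: scaled_cost_eq)

lemma cut_eq: "cut_capacity I \<alpha> S = cut (\<lambda>e. \<alpha> ! e * edge_cap (edges I ! e)) S"
  by (simp add: cut_capacity_def cut_def crosses_def)

lemma finite_cuts: "finite {S. S \<subseteq> verts I \<and> P S}"
  by (rule finite_subset[of _ "Pow (verts I)"]) (auto simp: verts_def)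

lemma min_cut_le:
  "S \<subseteq> verts I \<Longrightarrow> i \<in> S \<Longrightarrow> j \<notin> S \<Longrightarrow> min_cut I \<alpha> i j \<le> cut_capacity I \<alpha> S"
  unfolding min_cut_def by (intro Min_le) (auto intro: finite_cuts)

text \<open>\<open>min_cut\<close> fixes which endpoint lies in the set, \<open>satisfies\<close>
  accepts either. Both orders of a pair are therefore considered, the requirement being attached to
  the unordered pair.\<close>

lemma feasible_iff:
  "feasible I \<alpha> \<longleftrightarrow> length \<alpha> = length (edges I) \<and> satisfies (\<lambda>e. \<alpha> ! e)"
proof (intro iffI conjI; (elim conjE)?)
  assume f: "feasible I \<alpha>"
  then show "length \<alpha> = length (edges I)" by (simp add: feasible_def)
  show "satisfies (\<lambda>e. \<alpha> ! e)"
    unfolding satisfies_def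
  proof (clarify)
    fix i j S assume ij: "(i, j) \<in> demands" and S: "S \<subseteq> {..<num_verts I}" "(i \<in> S) \<noteq> (j \<in> S)"
    have v: "i \<in> verts I" "j \<in> verts I" "i \<noteq> j" "S \<subseteq> verts I"
      using ij S by (auto simp: demands_def verts_def)
    have "req I {i, j} \<le> min_cut I \<alpha> i j" "req I {i, j} \<le> min_cut I \<alpha> j i"
      using f v unfolding feasible_def by (blast, metis insert_commute)
    then show "req I {i, j} \<le> cut (\<lambda>e. \<alpha> ! e * edge_cap (edges I ! e)) S"
      using min_cut_le[OF v(4), of i j \<alpha>] min_cut_le[OF v(4), of j i \<alpha>] S(2)
      unfolding cut_eq by (meson le_trans)
  qed
next
  assume len: "length \<alpha> = length (edges I)" and sat: "satisfies (\<lambda>e. \<alpha> ! e)"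
  have "req I {i, j} \<le> min_cut I \<alpha> i j" if v: "i \<in> verts I" "j \<in> verts I" "i \<noteq> j" for i j
  proof -
    have "req I {i, j} \<le> cut_capacity I \<alpha> S" if S: "S \<subseteq> verts I" "i \<in> S" "j \<notin> S" for S
    proof (cases "req I {i, j} = 0")
      case False
      have "(i, j) \<in> demands \<or> (j, i) \<in> demands"
        using v False by (auto simp: demands_def verts_def insert_commute)
      then show ?thesis
        using satisfiesD[OF sat, of i j S] satisfiesD[OF sat, of j i S] S
        by (auto simp: cut_eq verts_def insert_commute)
    qed simp
    moreover have "{i} \<in> {S. S \<subseteq> verts I \<and> i \<in> S \<and> j \<notin> S}" using v by simp
    ultimately show ?thesis
      unfolding min_cut_def using finite_cuts by (subst Min_ge_iff) auto
  qed
  with len show "feasible I \<alpha>" by (simp add: feasible_def)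
qed

lemma num_demands_eq: "num_demands I = card demands"
proof -
  have "bij_betw (\<lambda>(i, j). {i, j}) demands {P \<in> vertex_pairs I. req I P > 0}"
    unfolding bij_betw_def
  proof
    show "inj_on (\<lambda>(i, j). {i, j}) demands"
      by (auto simp: inj_on_def demands_def doubleton_eq_iff)
    show "(\<lambda>(i, j). {i, j}) ` demands = {P \<in> vertex_pairs I. req I P > 0}"
    proof (intro equalityI subsetI)
      fix P assume "P \<in> {P \<in> vertex_pairs I. req I P > 0}"
      then obtain i j where P: "P = {i, j}" "i < num_verts I" "j < num_verts I" "i \<noteq> j" "0 < req I P"
        by (auto simp: vertex_pairs_def verts_def)
      then have "(i, j) \<in> demands \<or> (j, i) \<in> demands"
        by (auto simp: demands_def insert_commute)
      then show "P \<in> (\<lambda>(i, j). {i, j}) ` demands"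
        using P(1) by (force simp: insert_commute)
    next
      fix P assume "P \<in> (\<lambda>(i, j). {i, j}) ` demands"
      then obtain i j where "P = {i, j}" "i < j" "j < num_verts I" "0 < req I P"
        by (auto simp: demands_def)
      moreover from this have "i < num_verts I" "i \<noteq> j" by simp_all
      ultimately show "P \<in> {P \<in> vertex_pairs I. req I P > 0}"
        unfolding vertex_pairs_def verts_def by blast
    qed
  qed
  then show ?thesis unfolding num_demands_def by (simp add: bij_betw_same_card)
qed

text \<open>The optimum is an infimum, so the cost is divided by the ratio \<open>K\<close> and the
  quotient is compared with every feasible solution separately. Scaling by the common denominator
  cancels in each comparison.\<close>

lemma greedy_approximates:
  assumes "feasible I \<beta>"
  defines "\<alpha> \<equiv> output_of (fexec greedy (init_store (encode_instance I)))"
  shows "feasible I \<alpha>" "solution_cost I \<alpha> \<le> 512 * (1 + ln (real (num_demands I))) * opt_cost I"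
proof -
  define s where "s = fexec greedy (init_store (encode_instance I))"
  define K where "K = 512 * (1 + ln (real (card demands)))"
  have K: "0 < K" by (cases "card demands = 0") (simp_all add: K_def add_pos_nonneg)
  have sat: "satisfies (\<lambda>e. \<beta> ! e)" using assms(1) by (simp add: feasible_iff)
  note G = greedy_correct[OF refl _ sat s_def]
  have s1: "s 1 0 = length (edges I)" by (rule G) (simp add: init_store_def)
  obtain \<sigma> where inv: "greedy_invariant (bought_of s) \<sigma> demands"
    using G(2) by (auto simp: init_store_def)
  have \<alpha>: "\<alpha> = map (bought_of s) [0..<length (edges I)]"
    unfolding \<alpha>_def s_def[symmetric] output_of_def s1 by (simp add: bought_of_def)
  have nth: "\<alpha> ! e = bought_of s e" if "e < length (edges I)" for e using that by (simp add: \<alpha>)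
  have cut: "cut (\<lambda>e. \<alpha> ! e * edge_cap (edges I ! e)) S = cut (\<lambda>e. bought_of s e * edge_cap (edges I ! e)) S" for S
    unfolding cut_def by (rule sum.cong) (auto simp: nth)
  show "feasible I \<alpha>"
    using greedy_result(1)[OF inv] by (simp add: feasible_iff \<alpha> satisfies_def cut[unfolded \<alpha>])
  have cost: "cost (\<lambda>e. \<alpha> ! e) = cost (bought_of s)"
    unfolding cost_def by (rule sum.cong) (simp_all add: nth)
  have "solution_cost I \<alpha> / K \<le> solution_cost I \<beta>" if "feasible I \<beta>" for \<beta>
  proof -
    have "satisfies (\<lambda>e. \<beta> ! e)" using that by (simp add: feasible_iff)
    from greedy_result(2)[OF inv this]
    have "real (cost (\<lambda>e. \<alpha> ! e)) \<le> K * real (cost (\<lambda>e. \<beta> ! e))"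
      unfolding cost K_def .
    then have "real common_denominator * solution_cost I \<alpha> \<le>
        real common_denominator * (K * solution_cost I \<beta>)"
      unfolding cost_eq by (simp add: ac_simps)
    then show ?thesis using common_denominator_pos K by (simp add: field_simps)
  qed
  then have "solution_cost I \<alpha> / K \<le> opt_cost I"
    unfolding opt_cost_def using assms(1) by (intro cINF_greatest) auto
  then show "solution_cost I \<alpha> \<le> 512 * (1 + ln (real (num_demands I))) * opt_cost I"
    using K unfolding num_demands_eq K_def[symmetric] by (simp add: field_simps)
qed

end

lemma greedy_approximation:
  "approximation_algorithm (compile greedy) (\<lambda>k. 512 * (1 + ln (real k)))"
  unfolding approximation_algorithm_def runs_def
proof (intro allI impI, elim conjE exE)
  fix I \<beta> assume valid: "valid_instance I" and feas: "feasible I \<beta>"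
  interpret instance_network I by standard (rule valid)
  obtain t where t: "exec (compile greedy) (init_store (encode_instance I)) t
      (fexec greedy (init_store (encode_instance I)))"
    by (rule greedy_runs)
  show "\<exists>t \<alpha>. (\<exists>s. exec (compile greedy) (init_store (encode_instance I)) t s \<and> \<alpha> = output_of s) \<and>
      feasible I \<alpha> \<and> solution_cost I \<alpha> \<le> 512 * (1 + ln (real (num_demands I))) * opt_cost I"
    by (intro exI conjI, rule t, rule refl) (rule greedy_approximates[OF feas])+
qed

text \<open>From \<open>k = 3\<close> on the logarithm is at least 1 and absorbs the additive 1,
  which doubles the constant 512.\<close>

lemma ratio_bigo: "(\<lambda>k. 512 * (1 + ln (real k))) \<in> O(\<lambda>k. ln (real k))"
proof (rule bigoI[of _ 1024])
  have "1 \<le> ln (real k)" if "3 \<le> k" for k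
    using exp_le that by (subst ln_ge_iff) simp_all
  then have "norm (512 * (1 + ln (real k))) \<le> 1024 * norm (ln (real k))" if "3 \<le> k" for k
    using that by fastforce
  then show "\<forall>\<^sub>F k in sequentially. norm (512 * (1 + ln (real k))) \<le> 1024 * norm (ln (real k))"
    unfolding eventually_sequentially by blast
qed

theorem theorem5:
  "\<exists>(c :: com) (\<rho> :: nat \<Rightarrow> real).
     polynomial_time c (encode_instance ` {I. valid_instance I}) \<and>
     approximation_algorithm c \<rho> \<and>
     \<rho> \<in> O(\<lambda>k. ln (real k))"
  using greedy_polynomial_time greedy_approximation ratio_bigo by blast

end
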